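(* Let $f$ be a transcendental meromorphic function in $\mathbb{C}$ and let $P[f]=\sum_{j=1}^{t} b_j M_j[f]$, with $M_j[f]=(f)^{q_{0j}}(f^{(1)})^{q_{1j}}\cdots(f^{(k)})^{q_{kj}}$, be a homogeneous differential polynomial generated by $f$, of degree $d(P)$, where $k\ (\geq 1)$ is the highest order of the derivative of $f$ in $P[f]$. Suppose that $q_{0j}\geq 1$, $q_{ij}\geq 0$ $(i=1,2,\ldots,k-1)$ and $q_{kj}\geq 1$ are integers for all $1\leq j\leq t$. Let $\nu=\max_{1\leq j\leq t}\{q_{1j}+2q_{2j}+\cdots+kq_{kj}\}$. If $d(P)-\nu>2$, then either (i) $P[f]\equiv 0$, or (ii) $$T(r,f)\leq \frac{1}{d(P)-\nu-2}\,\overline{N}\left(r,\frac{1}{P[f]-1}\right)+S(r,f),$$ where $S(r,f)=o(T(r,f))$ as $r\to\infty$, $r\notin E$, for some set $E$ of positive real numbers of finite linear measure.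
   Context: Standard notation of Nevanlinna theory is used: $T(r,f)$ is the Nevanlinna characteristic and $\overline{N}(r,g)$ is the reduced integrated counting function of the poles of $g$ (each counted once, ignoring multiplicity), so that $\overline{N}(r,\frac{1}{g-1})$ counts the distinct $1$-points of $g$. A meromorphic function $f$ in $\mathbb{C}$ is transcendental if it is not rational (equivalently, $T(r,f)\neq O(\log r)$). $S(r,f)$ denotes any quantity satisfying $S(r,f)=o(T(r,f))$ as $r\to\infty$ outside a set of positive reals of finite linear measure, not necessarily the same at each occurrence. Differential polynomial: for non-negative integers $q_{0j},\ldots,q_{kj}$, the expression $M_j[f]=(f)^{q_{0j}}(f^{(1)})^{q_{1j}}\cdots(f^{(k)})^{q_{kj}}$ is a differential monomial of degree $d(M_j)=\sum_{i=0}^{k}q_{ij}$. A differential polynomial generated by $f$ is a sum $P[f]=\sum_{j=1}^{t}b_jM_j[f]$, where the $b_j$ are meromorphic functions with $T(r,b_j)=S(r,f)$ for $j=1,\ldots,t$. It is homogeneous if all the degrees $d(M_j)$, $1\le j\le t$, are equal; the common value is its degree $d(P)$. *)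

theory Defs
  imports
    "HOL-Complex_Analysis.Complex_Analysis"
    "HOL-Library.Landau_Symbols"
begin

text \<open>
  A meromorphic function is represented, as in the library, by a total function on the complex
  plane whose values on a discrete set carry no information; notions below are insensitive to
  changes on such a set.
\<close>

definition rational_fun :: "(complex \<Rightarrow> complex) \<Rightarrow> bool" where
  "rational_fun f \<longleftrightarrow> (\<exists>p q :: complex poly. q \<noteq> 0 \<and> (\<forall>\<^sub>\<approx>z. f z = poly p z / poly q z))"

definition transcendental_meromorphic :: "(complex \<Rightarrow> complex) \<Rightarrow> bool" where
  "transcendental_meromorphic f \<longleftrightarrow> f meromorphic_on UNIV \<and> \<not> rational_fun f"

definition log_plus :: "real \<Rightarrow> real" where
  "log_plus x = max 0 (ln x)"

definition proximity :: "(complex \<Rightarrow> complex) \<Rightarrow> real \<Rightarrow> real" where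
  "proximity f r = 1 / (2 * pi) * (LINT t:{0..2*pi}|lborel. log_plus (norm (f (of_real r * cis t))))"

definition poles_in :: "(complex \<Rightarrow> complex) \<Rightarrow> real \<Rightarrow> complex set" where
  "poles_in f r = {z. norm z \<le> r \<and> is_pole f z}"

text \<open>At a pole, the \<^const>\<open>zorder\<close> is minus the multiplicity of the pole.\<close>

definition pole_count :: "(complex \<Rightarrow> complex) \<Rightarrow> real \<Rightarrow> nat" where
  "pole_count f r = (\<Sum>z\<in>poles_in f r. nat (- zorder f z))"

definition reduced_pole_count :: "(complex \<Rightarrow> complex) \<Rightarrow> real \<Rightarrow> nat" where
  "reduced_pole_count f r = card (poles_in f r)"

definition integrated_count :: "(real \<Rightarrow> nat) \<Rightarrow> real \<Rightarrow> real" where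
  "integrated_count n r =
     (LINT t:{0<..r}|lborel. (real (n t) - real (n 0)) / t) + real (n 0) * ln r"

definition counting :: "(complex \<Rightarrow> complex) \<Rightarrow> real \<Rightarrow> real" where
  "counting f = integrated_count (pole_count f)"

definition reduced_counting :: "(complex \<Rightarrow> complex) \<Rightarrow> real \<Rightarrow> real" where
  "reduced_counting f = integrated_count (reduced_pole_count f)"

definition characteristic :: "(complex \<Rightarrow> complex) \<Rightarrow> real \<Rightarrow> real" where
  "characteristic f r = proximity f r + counting f r"

definition is_S :: "(complex \<Rightarrow> complex) \<Rightarrow> (real \<Rightarrow> real) \<Rightarrow> bool" where
  "is_S f s \<longleftrightarrow> (\<exists>E\<in>lmeasurable. E \<subseteq> {0<..} \<and>
     s \<in> o[inf at_top (principal (- E))](characteristic f))"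

text \<open>Exponents are indexed as in \<open>q i j\<close>: the power of the \<open>i\<close>-th derivative in the
  \<open>j\<close>-th monomial.\<close>

definition diff_monomial ::
    "nat \<Rightarrow> (nat \<Rightarrow> nat \<Rightarrow> nat) \<Rightarrow> nat \<Rightarrow> (complex \<Rightarrow> complex) \<Rightarrow> complex \<Rightarrow> complex" where
  "diff_monomial k q j f z = (\<Prod>i\<le>k. ((deriv ^^ i) f z) ^ q i j)"

definition monomial_degree :: "nat \<Rightarrow> (nat \<Rightarrow> nat \<Rightarrow> nat) \<Rightarrow> nat \<Rightarrow> nat" where
  "monomial_degree k q j = (\<Sum>i\<le>k. q i j)"

definition diff_poly ::
    "nat \<Rightarrow> nat \<Rightarrow> (nat \<Rightarrow> complex \<Rightarrow> complex) \<Rightarrow> (nat \<Rightarrow> nat \<Rightarrow> nat) \<Rightarrow>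
     (complex \<Rightarrow> complex) \<Rightarrow> complex \<Rightarrow> complex" where
  "diff_poly k t b q f z = (\<Sum>j=1..t. b j z * diff_monomial k q j f z)"

definition small_coefficients ::
    "(complex \<Rightarrow> complex) \<Rightarrow> nat \<Rightarrow> (nat \<Rightarrow> complex \<Rightarrow> complex) \<Rightarrow> bool" where
  "small_coefficients f t b \<longleftrightarrow>
     (\<forall>j\<in>{1..t}. b j meromorphic_on UNIV \<and> is_S f (characteristic (b j)))"

definition homogeneous_of_degree :: "nat \<Rightarrow> nat \<Rightarrow> (nat \<Rightarrow> nat \<Rightarrow> nat) \<Rightarrow> nat \<Rightarrow> bool" where
  "homogeneous_of_degree k t q d \<longleftrightarrow> (\<forall>j\<in>{1..t}. monomial_degree k q j = d)"

end

theory Submission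
  imports Defs "HOL-Real_Asymp.Real_Asymp"
begin

text \<open>
  Write \<open>P = P[f]\<close> and suppose first that \<open>P\<close> is not constant. From
  \<open>1 / f^d = P / f^d - (P / f^d) (P' / P) ((P - 1) / P')\<close> and the lemma on the logarithmic
  derivative, \<open>d m(r, 1/f) \<le> m(r, (P - 1) / P') + S(r, f)\<close>. Jensen's formula for
  \<open>W = P' / (P - 1)\<close> turns the right-hand side into a count of zeros and poles of \<open>W\<close>, and
  \<open>m(r, W)\<close> is small. A zero of \<open>f\<close> of order \<open>m\<close> that is no pole of a coefficient is a zero of \<open>P\<close>
  of order at least \<open>d m - \<nu>\<close>, so a comparison of orders at each point gives
  \<open>d T(r, f) \<le> N1(r, f) + (\<nu> + 1) N1(r, 1/f) + N1(r, 1/(P - 1)) + S(r, f)\<close> with reduced counting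
  functions \<open>N1\<close>, whence the claim.

  Poles and zeros on the circle of integration are avoided throughout: the radii for which they
  occur are countable, and the exceptional set absorbs them.
\<close>

section \<open>Circle means and the Poisson formula\<close>

text \<open>The 2 in \<open>d - \<nu> - 2\<close> has two sources. At a pole of \<open>f\<close> the
  function \<open>P' / (P - 1)\<close> may have a simple pole, which costs one unit per distinct
  pole. At a zero of \<open>f\<close> the lower bound \<open>d m - \<nu>\<close> for the order of
  \<open>P\<close> drops by one more under differentiation, which is the extra unit in
  \<open>\<nu> + 1\<close>. Both reduced counts are finally bounded by \<open>T(r, f)\<close>. In
  the estimate of \<open>m(r, g'/g)\<close> only the logarithm of a circle mean survives, so any
  bound polynomial in \<open>r\<close> and \<open>T\<close> is good enough. This allows a
  factorization \<open>g = prod (z - a)^n(a) * exp L\<close> on a disc in place of the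
  Poisson-Jensen formula. For \<open>g = P\<close> the estimate involves \<open>T(r, P)\<close>, so
  an a priori bound of \<open>T(r, P)\<close> in terms of \<open>T(r, f)\<close> has to come before
  it. Transcendence enters through \<open>ln r = o(T(r, f))\<close>, which absorbs the logarithmic
  errors. Every estimate brings its own exceptional set, while the conclusion asks for a single
  one.\<close>

definition circle_mean :: "(complex \<Rightarrow> real) \<Rightarrow> real \<Rightarrow> real" where
  "circle_mean u r = integral {0..2*pi} (\<lambda>t. u (of_real r * cis t)) / (2*pi)"

lemma continuous_on_circle:
  assumes "continuous_on (sphere 0 r) u" "r \<ge> 0"
  shows "continuous_on A (\<lambda>t. u (of_real r * cis t))"
  by (rule continuous_on_compose2[OF assms(1)])
     (use assms(2) in \<open>auto intro!: continuous_intros simp: norm_mult\<close>)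

lemma integrable_on_circle:
  fixes u :: "complex \<Rightarrow> 'a::banach"
  assumes "continuous_on (sphere 0 r) u" "r \<ge> 0"
  shows "(\<lambda>t. u (of_real r * cis t)) integrable_on {a..b}"
  by (intro integrable_continuous_interval continuous_on_circle assms)

lemma circle_mean_cong:
  assumes "\<And>z. norm z = r \<Longrightarrow> u z = v z" "r \<ge> 0"
  shows "circle_mean u r = circle_mean v r"
proof -
  have "(\<lambda>t. u (of_real r * cis t)) = (\<lambda>t. v (of_real r * cis t))"
    using assms by (auto simp: norm_mult)
  thus ?thesis unfolding circle_mean_def by simp
qed

lemma circle_mean_const [simp]: "circle_mean (\<lambda>_. c) r = c"
  by (simp add: circle_mean_def)

lemma circle_mean_cmult [simp]: "circle_mean (\<lambda>z. c * u z) r = c * circle_mean u r"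
  by (simp add: circle_mean_def)

lemma circle_mean_add:
  assumes "continuous_on (sphere 0 r) u" "continuous_on (sphere 0 r) v" "r \<ge> 0"
  shows "circle_mean (\<lambda>z. u z + v z) r = circle_mean u r + circle_mean v r"
  unfolding circle_mean_def
  by (subst integral_add) (auto intro!: integrable_on_circle assms simp: add_divide_distrib)

lemma circle_mean_diff:
  assumes "continuous_on (sphere 0 r) u" "continuous_on (sphere 0 r) v" "r \<ge> 0"
  shows "circle_mean (\<lambda>z. u z - v z) r = circle_mean u r - circle_mean v r"
  unfolding circle_mean_def
  by (subst integral_diff) (auto intro!: integrable_on_circle assms simp: diff_divide_distrib)

lemma circle_mean_sum:
  assumes "\<And>i. i \<in> I \<Longrightarrow> continuous_on (sphere 0 r) (u i)" "r \<ge> 0"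
  shows "circle_mean (\<lambda>z. \<Sum>i\<in>I. u i z) r = (\<Sum>i\<in>I. circle_mean (u i) r)"
  using assms(1)
proof (induction I rule: infinite_finite_induct)
  case (insert i I)
  thus ?case using assms(2)
    by (simp add: circle_mean_add continuous_on_sum)
qed auto

lemma circle_mean_mono:
  assumes "continuous_on (sphere 0 r) u" "continuous_on (sphere 0 r) v" "r \<ge> 0"
  assumes "\<And>z. norm z = r \<Longrightarrow> u z \<le> v z"
  shows "circle_mean u r \<le> circle_mean v r"
  unfolding circle_mean_def
  by (intro divide_right_mono integral_le integrable_on_circle assms)
     (use assms in \<open>auto simp: norm_mult\<close>)

lemma circle_mean_nonneg:
  assumes "continuous_on (sphere 0 r) u" "r \<ge> 0" "\<And>z. norm z = r \<Longrightarrow> 0 \<le> u z"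
  shows "0 \<le> circle_mean u r"
  using circle_mean_mono[of r "\<lambda>_. 0" u] assms by simp

section \<open>The Cauchy, Schwarz and Poisson formulas on a circle about the origin\<close>

lemma Cauchy_formula_circle:
  assumes "L holomorphic_on cball 0 R" "norm z < R"
  shows "((\<lambda>t. L (of_real R * cis t) * (of_real R * cis t) / (of_real R * cis t - z))
           has_integral (of_real (2 * pi) * L z)) {0..2*pi}"
proof -
  have "((\<lambda>u. L u / (u - z)) has_contour_integral (2 * of_real pi * \<i> * L z)) (circlepath 0 R)"
    by (rule Cauchy_integral_circlepath_simple[OF assms(1)]) (use assms(2) in auto)
  hence "((\<lambda>t. L (of_real R * cis t) / (of_real R * cis t - z) * of_real R * \<i> * cis t)
           has_integral (2 * of_real pi * \<i> * L z)) {0..2*pi}"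
    unfolding circlepath_def by (subst (asm) has_contour_integral_part_circlepath_iff) auto
  from has_integral_mult_right[OF this, of "-\<i>"] show ?thesis
    by (simp add: mult_ac)
qed

text \<open>On the circle \<open>cnj w = R^2 / w\<close>, so the integrand is the conjugate of
  \<open>L w * R^2 / (R^2 - cnj z * w)\<close>. The only possible new pole of that function,
  \<open>R^2 / cnj z\<close>, lies outside the disc, and the mean value property at 0 gives
  \<open>L 0\<close>.\<close>

lemma Cauchy_formula_circle_cnj:
  assumes "L holomorphic_on cball 0 R" "norm z < R"
  shows "((\<lambda>t. cnj (L (of_real R * cis t)) * (of_real R * cis t) / (of_real R * cis t - z))
           has_integral (of_real (2 * pi) * cnj (L 0))) {0..2*pi}"
proof -
  have R: "R > 0" using assms(2) norm_ge_zero[of z] by linarith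
  have nz: "of_real (R^2) - cnj z * w \<noteq> 0" if "norm w \<le> R" for w
  proof
    assume "of_real (R^2) - cnj z * w = 0"
    hence "norm (of_real (R^2) :: complex) = norm (cnj z * w)" by simp
    hence "R^2 = norm z * norm w" by (simp add: norm_mult norm_power)
    moreover have "norm z * norm w \<le> norm z * R" "norm z * R < R * R"
      using assms(2) that R by (auto intro: mult_left_mono)
    ultimately show False by (simp add: power2_eq_square)
  qed
  have "(\<lambda>w. L w * of_real (R^2) / (of_real (R^2) - cnj z * w)) holomorphic_on cball 0 R"
    using nz by (intro holomorphic_intros assms) auto
  from Cauchy_formula_circle[OF this, of 0] R
  have "((\<lambda>t. L (of_real R * cis t) * of_real (R^2) / (of_real (R^2) - cnj z * (of_real R * cis t)))
           has_integral (of_real (2 * pi) * L 0)) {0..2*pi}"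
    by simp
  hence "((\<lambda>t. cnj (L (of_real R * cis t) * of_real (R^2) / (of_real (R^2) - cnj z * (of_real R * cis t))))
           has_integral cnj (of_real (2 * pi) * L 0)) {0..2*pi}"
    by (rule iffD2[OF has_integral_cnj, unfolded o_def])
  moreover have "cnj (L (of_real R * cis t) * of_real (R^2) / (of_real (R^2) - cnj z * (of_real R * cis t)))
    = cnj (L (of_real R * cis t)) * (of_real R * cis t) / (of_real R * cis t - z)" for t
  proof -
    define w where "w = of_real R * cis t"
    have w: "w * cnj w = of_real (R^2)" "norm w = R"
      using R complex_norm_square[of w] by (auto simp: w_def norm_mult)
    have w0: "w \<noteq> 0" using R by (simp add: w_def)
    hence w': "w \<noteq> 0" "cnj w \<noteq> 0" by auto
    have wz: "w - z \<noteq> 0" using w assms(2) by auto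
    have "cnj (of_real (R^2) - cnj z * w) = (w - z) * cnj w"
      using w by (simp add: algebra_simps)
    hence "cnj (L w * of_real (R^2) / (of_real (R^2) - cnj z * w)) = cnj (L w) * (w * cnj w) / ((w - z) * cnj w)"
      by (simp only: complex_cnj_divide complex_cnj_mult complex_cnj_complex_of_real w)
    thus ?thesis unfolding w_def[symmetric] using w' wz by simp
  qed
  ultimately show ?thesis by simp
qed

text \<open>Since \<open>(w + z) / (w - z) = 2 w / (w - z) - 1\<close> and
  \<open>Re L = (L + cnj L) / 2\<close>, the integrand is a combination of the two preceding Cauchy
  integrands at \<open>z\<close> and at 0.\<close>

lemma Schwarz_formula:
  assumes "L holomorphic_on cball 0 R" "norm z < R"
  shows "((\<lambda>t. of_real (Re (L (of_real R * cis t))) * ((of_real R * cis t + z) / (of_real R * cis t - z)))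
           has_integral (of_real (2 * pi) * (L z - \<i> * of_real (Im (L 0))))) {0..2*pi}"
proof -
  have R: "R > 0" using assms(2) norm_ge_zero[of z] by linarith
  let ?w = "\<lambda>t. of_real R * cis t"
  have z0: "norm (0::complex) < R" using R by simp
  have 1: "((\<lambda>t. L (?w t)) has_integral (of_real (2 * pi) * L 0)) {0..2*pi}"
    using Cauchy_formula_circle[OF assms(1) z0] R by simp
  have 2: "((\<lambda>t. cnj (L (?w t))) has_integral (of_real (2 * pi) * cnj (L 0))) {0..2*pi}"
    using Cauchy_formula_circle_cnj[OF assms(1) z0] R by simp
  have "((\<lambda>t. (L (?w t) * ?w t / (?w t - z) + cnj (L (?w t)) * ?w t / (?w t - z))
         - (L (?w t) + cnj (L (?w t))) * (1/2)) has_integral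
       ((of_real (2 * pi) * L z + of_real (2 * pi) * cnj (L 0)) - (of_real (2 * pi) * L 0 + of_real (2 * pi) * cnj (L 0)) * (1/2))) {0..2*pi}"
    by (intro has_integral_diff has_integral_add has_integral_mult_left
         Cauchy_formula_circle Cauchy_formula_circle_cnj assms 1 2)
  moreover have "(of_real (2 * pi) * L z + of_real (2 * pi) * cnj (L 0)) - (of_real (2 * pi) * L 0 + of_real (2 * pi) * cnj (L 0)) * (1/2)
     = of_real (2 * pi) * (L z - \<i> * of_real (Im (L 0)))"
    by (simp add: complex_eq_iff algebra_simps)
  moreover have "(L (?w t) * ?w t / (?w t - z) + cnj (L (?w t)) * ?w t / (?w t - z))
         - (L (?w t) + cnj (L (?w t))) * (1/2) =
      of_real (Re (L (?w t))) * ((?w t + z) / (?w t - z))" for t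
  proof -
    have wz: "?w t - z \<noteq> 0" using R assms(2) by (auto simp: norm_mult)
    have *: "of_real (Re x) = (x + cnj x) / 2" for x by (simp add: complex_eq_iff)
    show ?thesis unfolding * using wz by (simp add: divide_simps) (simp add: algebra_simps)
  qed
  ultimately show ?thesis by simp
qed

text \<open>For \<open>|z| < |w|\<close> this equals \<open>(|w|^2 - |z|^2) / |w - z|^2\<close>.
  Written as a real part it is visibly harmonic in \<open>z\<close> as well as in
  \<open>w\<close>.\<close>

definition Poisson_kernel :: "complex \<Rightarrow> complex \<Rightarrow> real" where
  "Poisson_kernel z w = Re ((w + z) / (w - z))"

lemma continuous_on_Poisson_kernel:
  "norm z < R \<Longrightarrow> continuous_on (sphere 0 R) (Poisson_kernel z)"
  unfolding Poisson_kernel_def by (intro continuous_intros) auto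

lemma Poisson_kernel_nonneg:
  assumes "norm z < norm w"
  shows "Poisson_kernel z w \<ge> 0"
proof -
  have "Re ((w + z) / (w - z)) = Re ((w + z) * cnj (w - z)) / (norm (w - z))^2"
    by (metis Re_divide_of_real complex_div_cnj of_real_power)
  also have "Re ((w + z) * cnj (w - z)) = (norm w)^2 - (norm z)^2"
    by (simp add: cmod_power2) (simp add: power2_eq_square algebra_simps)
  finally show ?thesis unfolding Poisson_kernel_def
    using assms by (simp add: power_mono)
qed

lemma Poisson_formula:
  assumes "L holomorphic_on cball 0 R" "norm z < R"
  shows "circle_mean (\<lambda>w. Re (L w) * Poisson_kernel z w) R = Re (L z)"
proof -
  have "((\<lambda>t. Re (of_real (Re (L (of_real R * cis t))) * ((of_real R * cis t + z) / (of_real R * cis t - z))))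
           has_integral Re (of_real (2 * pi) * (L z - \<i> * of_real (Im (L 0))))) {0..2*pi}"
    by (rule has_integral_Re[OF Schwarz_formula[OF assms]])
  hence "integral {0..2*pi} (\<lambda>t. Re (L (of_real R * cis t)) * Poisson_kernel z (of_real R * cis t)) = 2 * pi * Re (L z)"
    by (simp add: Poisson_kernel_def integral_unique del: times_divide_eq_right)
  thus ?thesis by (simp add: circle_mean_def)
qed

lemma circle_mean_Re:
  assumes "L holomorphic_on cball 0 R" "0 < R"
  shows "circle_mean (\<lambda>w. Re (L w)) R = Re (L 0)"
proof -
  have "circle_mean (\<lambda>w. Re (L w) * Poisson_kernel 0 w) R = circle_mean (\<lambda>w. Re (L w)) R"
    using assms by (intro circle_mean_cong) (auto simp: Poisson_kernel_def)
  thus ?thesis using Poisson_formula[OF assms(1), of 0] assms by simp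
qed

text \<open>The average runs over \<open>z\<close>, not over \<open>w\<close>: the kernel is
  harmonic in \<open>z\<close> with value 1 at the origin. This is the form that appears after
  exchanging the two integrals in a comparison of circles.\<close>

lemma circle_mean_Poisson_kernel:
  assumes "0 < r" "r < norm w"
  shows "circle_mean (\<lambda>z. Poisson_kernel z w) r = 1"
proof -
  have "(\<lambda>z. (w + z) / (w - z)) holomorphic_on cball 0 r"
    using assms by (intro holomorphic_intros) auto
  moreover have "w \<noteq> 0" using assms by auto
  ultimately show ?thesis
    using circle_mean_Re[of "\<lambda>z. (w + z) / (w - z)" r] assms by (simp add: Poisson_kernel_def)
qed

text \<open>The Schwarz formula is applied at \<open>y\<close> and at \<open>z\<close>; the two
  kernels differ by \<open>2 w (y - z) / ((w - y) (w - z))\<close>, and the bound for the difference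
  quotient survives the limit. Only \<open>Re L\<close> occurs on the right, which is the part of
  \<open>L\<close> that \<open>ln |g|\<close> controls.\<close>

lemma norm_deriv_le_circle_mean:
  assumes "L holomorphic_on cball 0 R" "norm z < R"
  shows "norm (deriv L z) \<le> 2 * R / (R - norm z)^2 * circle_mean (\<lambda>w. \<bar>Re (L w)\<bar>) R"
proof -
  have R: "R > 0" using assms(2) norm_ge_zero[of z] by linarith
  let ?w = "\<lambda>t. of_real R * cis t"
  define M where "M = circle_mean (\<lambda>w. \<bar>Re (L w)\<bar>) R"
  have contL: "continuous_on (sphere 0 R) L"
    using assms(1) by (intro holomorphic_on_imp_continuous_on holomorphic_on_subset[OF assms(1)]) auto
  have le: "norm (L y - L z) \<le> 2 * R * norm (y - z) / ((R - norm y) * (R - norm z)) * M" if y: "norm y < R" for y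
  proof -
    have "((\<lambda>t. of_real (Re (L (?w t))) * ((?w t + y) / (?w t - y)) - of_real (Re (L (?w t))) * ((?w t + z) / (?w t - z)))
      has_integral (of_real (2 * pi) * (L y - \<i> * of_real (Im (L 0))) - of_real (2 * pi) * (L z - \<i> * of_real (Im (L 0))))) {0..2*pi}"
      by (intro has_integral_diff Schwarz_formula assms y)
    hence *: "((\<lambda>t. of_real (Re (L (?w t))) * ((?w t + y) / (?w t - y)) - of_real (Re (L (?w t))) * ((?w t + z) / (?w t - z)))
      has_integral (of_real (2 * pi) * (L y - L z))) {0..2*pi}"
      by (simp add: algebra_simps)
    have "norm (of_real (2 * pi) * (L y - L z)) \<le> integral {0..2*pi} (\<lambda>t. 2 * R * norm (y - z) / ((R - norm y) * (R - norm z)) * \<bar>Re (L (?w t))\<bar>)"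
      unfolding integral_unique[OF *, symmetric]
    proof (rule integral_norm_bound_integral)
      show "(\<lambda>t. 2 * R * norm (y - z) / ((R - norm y) * (R - norm z)) * \<bar>Re (L (?w t))\<bar>) integrable_on {0..2*pi}"
        using R by (intro integrable_on_mult_right integrable_on_circle continuous_intros contL) auto
      fix t assume "t \<in> {0..2*pi}"
      let ?v = "?w t"
      have nv: "norm ?v = R" using R by (simp add: norm_mult)
      have 1: "norm (?v - y) \<ge> R - norm y" "norm (?v - z) \<ge> R - norm z"
        using norm_triangle_ineq2[of ?v y] norm_triangle_ineq2[of ?v z] nv by auto
      hence nz: "?v - y \<noteq> 0" "?v - z \<noteq> 0" using y assms(2) by auto
      have "(?v + y) / (?v - y) - (?v + z) / (?v - z) = 2 * ?v * (y - z) / ((?v - y) * (?v - z))"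
        using nz by (simp add: divide_simps) (simp add: algebra_simps)
      hence "norm ((?v + y) / (?v - y) - (?v + z) / (?v - z)) = 2 * R * norm (y - z) / (norm (?v - y) * norm (?v - z))"
        using nv by (simp add: norm_divide norm_mult)
      also have "\<dots> \<le> 2 * R * norm (y - z) / ((R - norm y) * (R - norm z))"
        using 1 R y assms(2) by (intro divide_left_mono mult_mono mult_pos_pos) auto
      finally have 2: "norm ((?v + y) / (?v - y) - (?v + z) / (?v - z)) \<le> 2 * R * norm (y - z) / ((R - norm y) * (R - norm z))" .
      have "norm (of_real (Re (L ?v)) * ((?v + y) / (?v - y)) - of_real (Re (L ?v)) * ((?v + z) / (?v - z)))
         = \<bar>Re (L ?v)\<bar> * norm ((?v + y) / (?v - y) - (?v + z) / (?v - z))"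
        by (simp only: right_diff_distrib[symmetric] norm_mult norm_of_real)
      also have "\<dots> \<le> \<bar>Re (L ?v)\<bar> * (2 * R * norm (y - z) / ((R - norm y) * (R - norm z)))"
        by (intro mult_left_mono 2) auto
      finally show "norm (of_real (Re (L ?v)) * ((?v + y) / (?v - y)) - of_real (Re (L ?v)) * ((?v + z) / (?v - z)))
         \<le> 2 * R * norm (y - z) / ((R - norm y) * (R - norm z)) * \<bar>Re (L ?v)\<bar>"
        by (simp add: mult_ac)
    qed (use * in \<open>auto simp: has_integral_integrable\<close>)
    also have "\<dots> = 2 * R * norm (y - z) / ((R - norm y) * (R - norm z)) * (2 * pi * M)"
      by (simp add: M_def circle_mean_def)
    finally have "2 * pi * norm (L y - L z) \<le> 2 * pi * (2 * R * norm (y - z) / ((R - norm y) * (R - norm z)) * M)"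
      by (simp only: norm_mult norm_of_real) (simp add: mult_ac)
    thus ?thesis by (subst (asm) mult_le_cancel_left_pos) auto
  qed
  have "(L has_field_derivative deriv L z) (at z)"
    using assms by (intro holomorphic_derivI[of L "ball 0 R"] holomorphic_on_subset[OF assms(1)]) auto
  hence lim: "((\<lambda>y. norm ((L y - L z) / (y - z))) \<longlongrightarrow> norm (deriv L z)) (at z)"
    by (intro tendsto_norm) (simp add: has_field_derivative_iff)
  have "((\<lambda>y. 2 * R / ((R - norm y) * (R - norm z)) * M) \<longlongrightarrow> 2 * R / ((R - norm z) * (R - norm z)) * M) (at z)"
    using assms(2) by (intro tendsto_intros) auto
  moreover have "\<forall>\<^sub>F y in at z. norm ((L y - L z) / (y - z)) \<le> 2 * R / ((R - norm y) * (R - norm z)) * M"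
  proof -
    have "\<forall>\<^sub>F y in at z. y \<in> ball 0 R - {z}"
      using assms(2) by (intro eventually_at_in_open) auto
    thus ?thesis
    proof eventually_elim
      case (elim y)
      hence "norm (y - z) > 0" "norm y < R" by auto
      with le[of y] show ?case by (simp add: norm_divide pos_divide_le_eq mult_ac)
    qed
  qed
  ultimately have "norm (deriv L z) \<le> 2 * R / ((R - norm z) * (R - norm z)) * M"
    by (intro tendsto_le[OF _ _ lim]) auto
  thus ?thesis by (simp add: M_def power2_eq_square)
qed

section \<open>The function \<open>ln |w - a|\<close> on a circle: reflection, means and
  subharmonicity\<close>

lemma Ln_one_minus:
  assumes "norm b * R < 1" "R > 0"
  shows "(\<lambda>z. Ln (1 - b * z)) holomorphic_on cball 0 R"
    and "norm z \<le> R \<Longrightarrow> Re (Ln (1 - b * z)) = ln (norm (1 - b * z))"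
proof -
  \<comment> \<open>Staying in the right half-plane keeps the argument of \<open>Ln\<close> off its
    branch cut.\<close>
  have *: "Re (1 - b * z) > 0" if "norm z \<le> R" for z
  proof -
    have "norm (b * z) \<le> norm b * R" using that by (simp add: norm_mult mult_left_mono)
    hence "norm (b * z) < 1" using assms by linarith
    thus ?thesis using complex_Re_le_cmod[of "b * z"] by simp
  qed
  show "(\<lambda>z. Ln (1 - b * z)) holomorphic_on cball 0 R"
    using * by (intro holomorphic_intros) (metis complex_nonpos_Reals_iff mem_cball_0 not_le)
  show "Re (Ln (1 - b * z)) = ln (norm (1 - b * z))" if "norm z \<le> R"
    using *[OF that] by (intro Re_Ln) (metis less_irrefl zero_complex.sel(1))
qed

text \<open>Reflection in the circle: on \<open>|w| = R\<close> the factor vanishing at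
  \<open>a\<close> may be exchanged for one vanishing at the mirror point
  \<open>R^2 / cnj a\<close>. For \<open>a\<close> inside, the logarithm of the new factor is
  harmonic in the whole disc.\<close>

lemma norm_diff_on_circle:
  assumes "norm w = R" "R > 0"
  shows "norm (w - a) = R * norm (1 - cnj a / of_real (R^2) * w)"
proof -
  have w: "w * cnj w = of_real (R^2)" using assms complex_norm_square[of w] by simp
  have "R * norm (1 - cnj a / of_real (R^2) * w) = norm w * norm (cnj (1 - cnj a / of_real (R^2) * w))"
    using assms by (simp only: complex_mod_cnj)
  also have "\<dots> = norm (w * cnj (1 - cnj a / of_real (R^2) * w))" by (simp add: norm_mult)
  also have "w * cnj (1 - cnj a / of_real (R^2) * w) = w - a * (w * cnj w) / of_real (R^2)"
    by (simp add: algebra_simps)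
  also have "\<dots> = w - a" using w assms by simp
  finally show ?thesis by simp
qed

lemma ln_norm_diff_eq_Re_Ln:
  assumes "norm w = R" "norm a < R"
  shows "ln (norm (w - a)) = Re (of_real (ln R) + Ln (1 - cnj a / of_real (R^2) * w))"
proof -
  have R: "R > 0" using assms norm_ge_zero[of a] by linarith
  have b: "norm (cnj a / of_real (R^2)) * R < 1"
    using R assms by (simp add: norm_divide norm_power norm_mult field_simps power2_eq_square)
  have "w \<noteq> a" using assms by auto
  hence "norm (1 - cnj a / of_real (R^2) * w) > 0" using norm_diff_on_circle[OF assms(1) R, of a]
    by (metis R mult_eq_0_iff right_minus_eq zero_less_norm_iff norm_eq_zero)
  thus ?thesis using R Ln_one_minus(2)[OF b R] assms
    by (simp add: norm_diff_on_circle[OF assms(1) R] ln_mult del: Re_Ln)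
qed

lemma holomorphic_ln_norm_diff_aux:
  assumes "norm a < R"
  shows "(\<lambda>w. of_real (ln R) + Ln (1 - cnj a / of_real (R^2) * w)) holomorphic_on cball 0 R"
proof -
  have R: "R > 0" using assms norm_ge_zero[of a] by linarith
  have b: "norm (cnj a / of_real (R^2)) * R < 1"
    using R assms by (simp add: norm_divide norm_power norm_mult field_simps power2_eq_square)
  show ?thesis by (intro holomorphic_intros Ln_one_minus(1)[OF b R])
qed

lemma ln_norm_diff_eq_Re_Ln_outside:
  assumes "R > 0" "norm a > R"
  shows "(\<lambda>w. of_real (ln (norm a)) + Ln (1 - 1/a * w)) holomorphic_on cball 0 R"
    and "norm w \<le> R \<Longrightarrow> ln (norm (w - a)) = Re (of_real (ln (norm a)) + Ln (1 - 1/a * w))"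
proof -
  have a: "a \<noteq> 0" using assms by auto
  have b: "norm (1/a) * R < 1" using a assms by (simp add: norm_divide divide_simps)
  show "(\<lambda>w. of_real (ln (norm a)) + Ln (1 - 1/a * w)) holomorphic_on cball 0 R"
    by (intro holomorphic_intros Ln_one_minus(1)[OF b assms(1)])
  assume w: "norm w \<le> R"
  hence wa: "w \<noteq> a" using assms by auto
  have "Re (of_real (ln (norm a)) + Ln (1 - 1/a * w)) = ln (norm a) + ln (norm (1 - 1/a * w))"
    using Ln_one_minus(2)[OF b assms(1) w] by simp
  also have "\<dots> = ln (norm (a * (1 - 1/a * w)))"
    using a wa by (simp add: norm_mult ln_mult)
  also have "a * (1 - 1/a * w) = a - w" using a by (simp add: algebra_simps)
  finally show "ln (norm (w - a)) = Re (of_real (ln (norm a)) + Ln (1 - 1/a * w))"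
    by (simp add: norm_minus_commute)
qed

text \<open>Jensen's formula for a single linear factor. The harmonic replacement is evaluated at 0:
  the reflected factor has modulus \<open>r\<close> there, and an outer point \<open>a\<close>
  leaves the factor itself, of modulus \<open>|a|\<close>.\<close>

lemma circle_mean_ln_norm_diff:
  assumes "r > 0" "norm a \<noteq> r"
  shows "circle_mean (\<lambda>z. ln (norm (z - a))) r = ln (if norm a < r then r else norm a)"
proof (cases "norm a < r")
  case True
  let ?L = "\<lambda>w. of_real (ln r) + Ln (1 - cnj a / of_real (r^2) * w)"
  have "circle_mean (\<lambda>z. ln (norm (z - a))) r = circle_mean (\<lambda>z. Re (?L z)) r"
    using True assms by (intro circle_mean_cong ln_norm_diff_eq_Re_Ln) auto
  also have "\<dots> = Re (?L 0)"
    by (intro circle_mean_Re holomorphic_ln_norm_diff_aux True assms)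
  finally show ?thesis using True by simp
next
  case False
  hence a: "norm a > r" using assms by auto
  let ?L = "\<lambda>w. of_real (ln (norm a)) + Ln (1 - 1/a * w)"
  have "circle_mean (\<lambda>z. ln (norm (z - a))) r = circle_mean (\<lambda>z. Re (?L z)) r"
    using assms(1) by (intro circle_mean_cong ln_norm_diff_eq_Re_Ln_outside(2)[OF assms(1) a]) auto
  also have "\<dots> = Re (?L 0)"
    by (intro circle_mean_Re ln_norm_diff_eq_Re_Ln_outside(1)[OF assms(1) a] assms)
  finally show ?thesis using False by simp
qed

text \<open>The Poisson integral reproduces the logarithm of the reflected factor at
  \<open>z\<close>. That factor dominates \<open>|z - a|\<close> inside the disc, because a Blaschke
  factor has modulus at most 1.\<close>

lemma ln_norm_diff_le_Poisson:
  assumes "norm a < R" "norm z < R" "z \<noteq> a"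
  shows "ln (norm (z - a)) \<le> circle_mean (\<lambda>w. ln (norm (w - a)) * Poisson_kernel z w) R"
proof -
  have R: "R > 0" using assms norm_ge_zero[of a] by linarith
  have b: "norm (cnj a / of_real (R^2)) * R < 1"
    using R assms by (simp add: norm_divide norm_power norm_mult field_simps power2_eq_square)
  let ?L = "\<lambda>w. of_real (ln R) + Ln (1 - cnj a / of_real (R^2) * w)"
  have "circle_mean (\<lambda>w. ln (norm (w - a)) * Poisson_kernel z w) R = circle_mean (\<lambda>w. Re (?L w) * Poisson_kernel z w) R"
    using assms R by (intro circle_mean_cong arg_cong2[where f = "(*)"] ln_norm_diff_eq_Re_Ln) auto
  also have "\<dots> = Re (?L z)"
    by (rule Poisson_formula[OF holomorphic_ln_norm_diff_aux]) (use assms in auto)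
  also have "\<dots> = ln R + ln (norm (1 - cnj a / of_real (R^2) * z))"
    using Ln_one_minus(2)[OF b R, of z] assms by simp
  finally have eq: "circle_mean (\<lambda>w. ln (norm (w - a)) * Poisson_kernel z w) R
      = ln R + ln (norm (1 - cnj a / of_real (R^2) * z))" .
  have pos: "norm (z - a) > 0" using assms by simp
  have le: "norm (z - a) \<le> R * norm (1 - cnj a / of_real (R^2) * z)"
  proof -
    have "(R * norm (z - a))^2 \<le> norm (of_real (R^2) - cnj a * z)^2"
    proof -
      \<comment> \<open>The identity behind the Blaschke bound: the difference of squares is a
        product of two factors that are nonnegative inside the disc.\<close>
      have "norm (of_real (R^2) - cnj a * z)^2 - (R * norm (z - a))^2 = (R^2 - (norm z)^2) * (R^2 - (norm a)^2)"
        by (simp add: cmod_power2 power_mult_distrib) (simp add: power2_eq_square algebra_simps)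
      moreover have "(norm z)^2 \<le> R^2" "(norm a)^2 \<le> R^2" using assms by (auto intro!: power_mono)
      ultimately show ?thesis by (smt (verit) mult_nonneg_nonneg)
    qed
    hence "R * norm (z - a) \<le> norm (of_real (R^2) - cnj a * z)"
      using power2_le_imp_le norm_ge_zero by blast
    also have "of_real (R^2) - cnj a * z = of_real (R^2) * (1 - cnj a / of_real (R^2) * z)"
      using R by (simp add: algebra_simps)
    also have "norm \<dots> = R^2 * norm (1 - cnj a / of_real (R^2) * z)"
      using R by (simp only: norm_mult norm_of_real) simp
    finally show ?thesis using R by (simp add: power2_eq_square)
  qed
  hence "norm (1 - cnj a / of_real (R^2) * z) > 0" using pos R
    by (smt (verit) mult_eq_0_iff norm_ge_zero)
  hence "ln R + ln (norm (1 - cnj a / of_real (R^2) * z)) = ln (R * norm (1 - cnj a / of_real (R^2) * z))"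
    using R by (subst ln_mult) auto
  moreover have "ln (norm (z - a)) \<le> \<dots>" using le pos order.strict_trans2[OF pos le] by (subst ln_le_cancel_iff) auto
  ultimately show ?thesis using eq by simp
qed

section \<open>An integrable singularity, and integrated counting functions\<close>

text \<open>Jordan's inequality with 1/2 in place of \<open>2 / pi\<close>. Up to
  \<open>pi / 3\<close> the derivative \<open>cos - 1/2\<close> is nonnegative; beyond,
  \<open>sin y \<ge> sqrt 3 / 2 \<ge> pi / 4 \<ge> y / 2\<close>.\<close>

lemma sin_ge_half:
  assumes "0 \<le> y" "y \<le> pi/2"
  shows "y / 2 \<le> sin y"
proof (cases "y \<le> pi/3")
  case True
  have "sin 0 - 0 / 2 \<le> sin y - y / 2"
  proof (rule DERIV_nonneg_imp_nondecreasing[OF assms(1)])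
    fix x assume x: "0 \<le> x" "x \<le> y"
    have "cos (pi/3) \<le> cos x" using x True pi_gt_zero by (intro cos_monotone_0_pi_le) auto
    moreover have "((\<lambda>x. sin x - x / 2) has_real_derivative (cos x - 1 / 2)) (at x)"
      by (auto intro!: derivative_eq_intros)
    ultimately show "\<exists>d. ((\<lambda>x. sin x - x / 2) has_real_derivative d) (at x) \<and> 0 \<le> d"
      by (intro exI[of _ "cos x - 1/2"]) (simp add: cos_60)
  qed
  thus ?thesis by simp
next
  case False
  have "sin (pi/3) \<le> sin y" using False assms pi_gt_zero by (intro sin_monotone_2pi_le) auto
  moreover have "pi / 4 \<le> sqrt 3 / 2"
  proof -
    have "(1.7::real) \<le> sqrt 3" by (rule real_le_rsqrt) (simp add: power2_eq_square)
    thus ?thesis using pi_less_4 pi_approx(2) by simp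
  qed
  ultimately show ?thesis using assms by (simp add: sin_60)
qed

lemma abs_sin_ge_half:
  assumes "\<bar>x - of_int k * pi\<bar> \<le> pi/2"
  shows "\<bar>x - of_int k * pi\<bar> / 2 \<le> \<bar>sin x\<bar>"
proof -
  have "\<bar>sin (x - of_int k * pi)\<bar> = \<bar>sin x\<bar>"
  proof -
    have "sin (of_int k * pi) = 0" by (auto simp: sin_zero_iff_int2)
    thus ?thesis using sin_zero_abs_cos_one[of "of_int k * pi"] by (simp add: sin_diff abs_mult)
  qed
  moreover have "\<bar>sin (x - of_int k * pi)\<bar> = \<bar>sin \<bar>x - of_int k * pi\<bar>\<bar>"
    by (cases "x - of_int k * pi \<ge> 0") (simp_all only: abs_of_nonneg abs_of_neg sin_minus abs_minus_cancel not_le)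
  ultimately show ?thesis using sin_ge_half[of "\<bar>x - of_int k * pi\<bar>"] assms by linarith
qed

text \<open>The multiple of \<open>pi\<close> nearest to \<open>x\<close> already gives a sufficient
  term. Summing over all multiples that can be nearest on this interval yields one majorant without
  a case distinction in \<open>x\<close>.\<close>

lemma inverse_sqrt_sin_le:
  assumes "-pi \<le> x" "x \<le> 3 * pi"
  shows "1 / sqrt \<bar>sin x\<bar> \<le> (\<Sum>k\<in>{-1..3::int}. 2 / sqrt \<bar>x - of_int k * pi\<bar>)"
proof -
  define k where "k = round (x / pi)"
  have k1: "\<bar>of_int k - x / pi\<bar> \<le> 1/2" unfolding k_def by (rule of_int_round_abs_le)
  have "x / pi \<le> 3" "-1 \<le> x / pi" using assms pi_gt_zero by (auto simp: field_simps)
  hence "of_int k \<le> 3 + (1/2 :: real)" "of_int k \<ge> -1 - (1/2 :: real)"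
    using k1 unfolding abs_le_iff by linarith+
  hence "k \<le> 3" "k \<ge> -1" by linarith+
  hence k2: "k \<in> {-1..3}" by simp
  have "\<bar>x - of_int k * pi\<bar> = pi * \<bar>of_int k - x / pi\<bar>"
    by (subst abs_minus_commute) (simp add: abs_mult_pos[symmetric] right_diff_distrib abs_mult field_simps)
  also have "\<dots> \<le> pi * (1/2)" using k1 by (intro mult_left_mono) auto
  finally have le: "\<bar>x - of_int k * pi\<bar> / 2 \<le> \<bar>sin x\<bar>" by (intro abs_sin_ge_half) simp
  have "1 / sqrt \<bar>sin x\<bar> \<le> 2 / sqrt \<bar>x - of_int k * pi\<bar>"
  proof (cases "x - of_int k * pi = 0")
    \<comment> \<open>At a zero of the sine both sides of the comparison are
      \<open>1 / 0\<close>-type expressions with value 0.\<close>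
    case True
    hence "sin x = 0" by (simp add: mult.commute sin_zero_iff_int2)
    thus ?thesis using True by simp
  next
    case False
    have "\<bar>x - of_int k * pi\<bar> \<le> 4 * \<bar>sin x\<bar>" using le by simp
    hence "sqrt \<bar>x - of_int k * pi\<bar> \<le> sqrt (4 * \<bar>sin x\<bar>)" by simp
    also have "\<dots> = 2 * sqrt \<bar>sin x\<bar>" by (simp add: real_sqrt_mult)
    finally show ?thesis using False by (auto simp: divide_simps)
  qed
  also have "\<dots> \<le> (\<Sum>k\<in>{-1..3::int}. 2 / sqrt \<bar>x - of_int k * pi\<bar>)"
    using k2 by (intro member_le_sum) auto
  finally show ?thesis .
qed

text \<open>The antiderivative \<open>2 sgn (t - c) sqrt |t - c|\<close> is continuous across the
  singularity, so the fundamental theorem applies with the single exceptional point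
  \<open>c\<close>.\<close>

lemma has_integral_inverse_sqrt:
  fixes a b c :: real
  assumes "a \<le> b"
  shows "((\<lambda>t. 1 / sqrt \<bar>t - c\<bar>) has_integral
     (2 * sgn (b - c) * sqrt \<bar>b - c\<bar> - 2 * sgn (a - c) * sqrt \<bar>a - c\<bar>)) {a..b}"
proof (rule fundamental_theorem_of_calculus_interior_strong[where S = "{c}"])
  have eq: "2 * sgn (t - c) * sqrt \<bar>t - c\<bar> = 2 * sqrt (max 0 (t - c)) - 2 * sqrt (max 0 (c - t))" for t
    by (auto simp: sgn_if max_def)
  show "continuous_on {a..b} (\<lambda>t. 2 * sgn (t - c) * sqrt \<bar>t - c\<bar>)"
    unfolding eq by (intro continuous_intros)
  fix x assume x: "x \<in> {a<..<b} - {c}"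
  have "((\<lambda>t. 2 * sgn (t - c) * sqrt \<bar>t - c\<bar>) has_real_derivative 1 / sqrt \<bar>x - c\<bar>) (at x)"
  proof (cases "x < c")
    case True
    have "((\<lambda>t. - 2 * sqrt (c - t)) has_real_derivative 1 / sqrt \<bar>x - c\<bar>) (at x)"
      using True by (auto intro!: derivative_eq_intros simp: field_simps)
    moreover have "\<forall>\<^sub>F t in nhds x. t \<in> {..<c}"
      by (rule eventually_nhds_in_open) (use True in auto)
    hence "\<forall>\<^sub>F t in nhds x. - 2 * sqrt (c - t) = 2 * sgn (t - c) * sqrt \<bar>t - c\<bar>"
      by eventually_elim auto
    ultimately show ?thesis by (subst (asm) DERIV_cong_ev[OF refl _ refl]) auto
  next
    case False
    hence xc: "x > c" using x by auto
    have "((\<lambda>t. 2 * sqrt (t - c)) has_real_derivative 1 / sqrt \<bar>x - c\<bar>) (at x)"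
      using xc by (auto intro!: derivative_eq_intros simp: field_simps)
    moreover have "\<forall>\<^sub>F t in nhds x. t \<in> {c<..}"
      by (rule eventually_nhds_in_open) (use xc in auto)
    hence "\<forall>\<^sub>F t in nhds x. 2 * sqrt (t - c) = 2 * sgn (t - c) * sqrt \<bar>t - c\<bar>"
      by eventually_elim auto
    ultimately show ?thesis by (subst (asm) DERIV_cong_ev[OF refl _ refl]) auto
  qed
  thus "((\<lambda>t. 2 * sgn (t - c) * sqrt \<bar>t - c\<bar>) has_vector_derivative 1 / sqrt \<bar>x - c\<bar>) (at x)"
    by (simp add: has_real_derivative_iff_has_vector_derivative)
qed (use assms in auto)

text \<open>The exponent \<open>1/2 < 1\<close> makes the singularity integrable, uniformly in its position.\<close>

lemma circle_mean_inverse_sqrt_bounded: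
  "\<exists>C>0. \<forall>r\<ge>1. \<forall>a. norm a \<noteq> r \<longrightarrow> circle_mean (\<lambda>z. 1 / sqrt (norm (z - a))) r \<le> C"
proof -
  \<comment> \<open>Each boundary value of an antiderivative below is at most
    \<open>2 sqrt (6 pi)\<close> in modulus, and there are two of them. The factor 10 is five
    multiples of \<open>pi\<close> times the coefficient 2.\<close>
  define B where "B = 4 * sqrt (6 * pi)"
  show ?thesis
  proof (intro exI[of _ "10 * B / (2 * pi)"] conjI allI impI)
    fix r :: real and a :: complex assume r: "r \<ge> 1" and a: "norm a \<noteq> r"
    define \<phi> where "\<phi> = Arg a"
    have \<phi>: "-pi < \<phi>" "\<phi> \<le> pi" unfolding \<phi>_def using Arg_bounded[of a] by auto
    have a_eq: "a = of_real (norm a) * cis \<phi>"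
      unfolding \<phi>_def by (metis rcis_cmod_Arg rcis_def)
    let ?g = "\<lambda>t. \<Sum>k\<in>{-1..3::int}. 2 * (1 / sqrt \<bar>t - (\<phi> + of_int k * pi)\<bar>)"
    define I where "I = (\<lambda>k::int. 2 * sgn (2 * pi - (\<phi> + of_int k * pi)) * sqrt \<bar>2 * pi - (\<phi> + of_int k * pi)\<bar>
         - 2 * sgn (0 - (\<phi> + of_int k * pi)) * sqrt \<bar>0 - (\<phi> + of_int k * pi)\<bar>)"
    have int: "(?g has_integral (\<Sum>k\<in>{-1..3::int}. 2 * I k)) {0..2*pi}"
      unfolding I_def by (intro has_integral_sum has_integral_mult_right has_integral_inverse_sqrt) auto
    \<comment> \<open>At these points the sine in the comparison function vanishes and its
      reciprocal has the default value 0, so the pointwise bound may fail. The set is finite and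
      does not affect the integral.\<close>
    define S where "S = {t\<in>{0..2*pi}. sin (t - \<phi>) = 0}"
    have pt: "1 / sqrt (norm (of_real r * cis t - a)) \<le> ?g t" if t: "t \<in> {0..2*pi} - S" for t
    proof -
      \<comment> \<open>Rotating by \<open>-\<phi>\<close> makes \<open>a\<close> real; the distance
        to \<open>a\<close> is then at least the modulus of the imaginary part, which is
        \<open>r |sin (t - \<phi>)|\<close>.\<close>
      have "\<bar>sin (t - \<phi>)\<bar> \<le> r * \<bar>sin (t - \<phi>)\<bar>" using r by (simp add: mult_le_cancel_right1)
      also have "\<dots> = \<bar>Im ((of_real r * cis t - a) * cis (-\<phi>))\<bar>"
      proof -
        have "(of_real r * cis t - a) * cis (-\<phi>) = of_real r * cis (t - \<phi>) - of_real (norm a)"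
        proof -
          have "(of_real r * cis t - of_real (norm a) * cis \<phi>) * cis (-\<phi>)
              = of_real r * (cis t * cis (-\<phi>)) - of_real (norm a) * (cis \<phi> * cis (-\<phi>))"
            by (simp only: algebra_simps)
          thus ?thesis by (simp add: cis_mult flip: a_eq)
        qed
        thus ?thesis using r by (simp add: abs_mult)
      qed
      also have "\<dots> \<le> norm ((of_real r * cis t - a) * cis (-\<phi>))" by (rule abs_Im_le_cmod)
      also have "\<dots> = norm (of_real r * cis t - a)" by (simp add: norm_mult)
      finally have le: "\<bar>sin (t - \<phi>)\<bar> \<le> norm (of_real r * cis t - a)" .
      have "1 / sqrt (norm (of_real r * cis t - a)) \<le> 1 / sqrt \<bar>sin (t - \<phi>)\<bar>"
        using le t by (intro divide_left_mono) (auto simp: S_def intro!: mult_pos_pos)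
      also have "\<dots> \<le> (\<Sum>k\<in>{-1..3::int}. 2 / sqrt \<bar>(t - \<phi>) - of_int k * pi\<bar>)"
        using \<phi> t by (intro inverse_sqrt_sin_le) auto
      finally show ?thesis by (simp add: diff_diff_eq)
    qed
    have "finite S"
    proof (rule finite_subset)
      show "S \<subseteq> (\<lambda>k. \<phi> + of_int k * pi) ` {-1..3::int}"
      proof
        fix t assume t: "t \<in> S"
        then obtain k :: int where k: "t - \<phi> = of_int k * pi" by (auto simp: S_def sin_zero_iff_int2)
        have t02: "0 \<le> t" "t \<le> 2 * pi" using t by (auto simp: S_def)
        have "of_int k * pi < 3 * pi + pi / 2" "of_int k * pi > (-1) * pi - pi / 2" using t02 \<phi> k by linarith+
        hence "of_int k * pi < (3 + 1/2) * pi" "(-1 - 1/2) * pi < of_int k * pi" by (simp_all add: algebra_simps)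
        hence "of_int k < (3 + 1/2::real)" "(-1 - 1/2::real) < of_int k"
          by (simp_all only: mult_less_cancel_right_pos[OF pi_gt_zero])
        hence "k \<le> 3" "k \<ge> -1" by linarith+
        hence "k \<in> {-1..3}" by simp
        thus "t \<in> (\<lambda>k. \<phi> + of_int k * pi) ` {-1..3::int}" using k by (intro image_eqI[of _ _ k]) auto
      qed
    qed auto
    have "integral {0..2*pi} (\<lambda>t. 1 / sqrt (norm (of_real r * cis t - a))) \<le> (\<Sum>k\<in>{-1..3::int}. 2 * I k)"
    proof (rule has_integral_le)
      have "(\<lambda>t. 1 / sqrt (norm (of_real r * cis t - a))) integrable_on {0..2*pi}"
        using a r by (intro integrable_on_circle[where u = "\<lambda>z. 1 / sqrt (norm (z - a))"] continuous_intros) auto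
      thus "((\<lambda>t. 1 / sqrt (norm (of_real r * cis t - a))) has_integral
          integral {0..2*pi} (\<lambda>t. 1 / sqrt (norm (of_real r * cis t - a)))) {0..2*pi}"
        by (rule integrable_integral)
      show "((\<lambda>t. if t \<in> S then 1 / sqrt (norm (of_real r * cis t - a)) else ?g t) has_integral
          (\<Sum>k\<in>{-1..3::int}. 2 * I k)) {0..2*pi}"
        by (rule has_integral_spike_finite[OF \<open>finite S\<close> _ int]) auto
    qed (use pt in auto)
    also have "\<dots> \<le> (\<Sum>k\<in>{-1..3::int}. 2 * B)"
    proof (intro sum_mono mult_left_mono)
      fix k :: int assume k: "k \<in> {-1..3}"
      define c where "c = \<phi> + of_int k * pi"
      have "of_int k * pi \<le> 3 * pi" "of_int k * pi \<ge> (-1) * pi"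
        using k mult_right_mono[of "-1" "of_int k" pi] mult_right_mono[of "of_int k" 3 pi] by auto
      hence c: "-2 * pi \<le> c" "c \<le> 4 * pi" using \<phi> unfolding c_def by linarith+
      have *: "\<bar>2 * sgn (x - c) * sqrt \<bar>x - c\<bar>\<bar> \<le> 2 * sqrt (6 * pi)" if "0 \<le> x" "x \<le> 2 * pi" for x
      proof -
        have "\<bar>sgn (x - c)\<bar> * sqrt \<bar>x - c\<bar> \<le> 1 * sqrt (6 * pi)"
          using c that by (intro mult_mono) (auto simp: abs_sgn_eq)
        thus ?thesis by (simp add: abs_mult)
      qed
      show "I k \<le> B" unfolding I_def B_def c_def[symmetric]
        using *[of "2*pi"] *[of 0] pi_ge_zero unfolding abs_le_iff by linarith
    qed auto
    also have "\<dots> = 10 * B" by simp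
    finally show "circle_mean (\<lambda>z. 1 / sqrt (norm (z - a))) r \<le> 10 * B / (2 * pi)"
      unfolding circle_mean_def by (intro divide_right_mono) auto
  qed (auto simp: B_def)
qed

section \<open>Integrated counting functions as weighted sums over points\<close>

definition pole_order :: "(complex \<Rightarrow> complex) \<Rightarrow> complex \<Rightarrow> nat" where
  "pole_order f z = (if is_pole f z then nat (- zorder f z) else 0)"

definition loc_finite :: "(complex \<Rightarrow> real) \<Rightarrow> bool" where
  "loc_finite c \<longleftrightarrow> (\<forall>r. finite {z. norm z \<le> r \<and> c z \<noteq> 0})"

text \<open>The summand at the origin is \<open>c 0 * ln r\<close>, because \<open>ln 0 = 0\<close>.\<close>

definition int_count :: "(complex \<Rightarrow> real) \<Rightarrow> real \<Rightarrow> real" where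
  "int_count c r = (\<Sum>z\<in>{z. norm z \<le> r \<and> c z \<noteq> 0}. c z * (ln r - ln (norm z)))"

lemma loc_finiteD: "loc_finite c \<Longrightarrow> finite {z. norm z \<le> r \<and> c z \<noteq> 0}"
  by (auto simp: loc_finite_def)

lemma loc_finite_subset:
  assumes "loc_finite c" "\<And>z. c z = 0 \<Longrightarrow> c' z = 0"
  shows "loc_finite c'"
  unfolding loc_finite_def
  by (intro allI finite_subset[OF _ loc_finiteD[OF assms(1)]]) (use assms(2) in blast)

lemma loc_finite_cmult [intro]: "loc_finite c \<Longrightarrow> loc_finite (\<lambda>z. k * c z)"
  by (erule loc_finite_subset) auto

lemma loc_finite_add [intro]:
  assumes "loc_finite c" "loc_finite c'"
  shows "loc_finite (\<lambda>z. c z + c' z)"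
  unfolding loc_finite_def
proof
  fix r
  show "finite {z. norm z \<le> r \<and> c z + c' z \<noteq> 0}"
    by (rule finite_subset[OF _ finite_UnI[OF loc_finiteD[OF assms(1), of r] loc_finiteD[OF assms(2), of r]]]) auto
qed

lemma loc_finite_diff [intro]:
  "loc_finite c \<Longrightarrow> loc_finite c' \<Longrightarrow> loc_finite (\<lambda>z. c z - c' z)"
  using loc_finite_add[of c "\<lambda>z. (-1) * c' z"] loc_finite_cmult[of c' "-1"] by simp

lemma loc_finite_0 [simp]: "loc_finite (\<lambda>_. 0)"
  by (simp add: loc_finite_def)

lemma loc_finite_sum [intro]:
  "(\<And>i. i \<in> I \<Longrightarrow> loc_finite (c i)) \<Longrightarrow> loc_finite (\<lambda>z. \<Sum>i\<in>I. c i z)"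
  by (induction I rule: infinite_finite_induct) auto

lemma int_count_superset:
  assumes "finite A" "\<And>z. norm z \<le> r \<Longrightarrow> c z \<noteq> 0 \<Longrightarrow> z \<in> A" "\<And>z. z \<in> A \<Longrightarrow> norm z \<le> r"
  shows "int_count c r = (\<Sum>z\<in>A. c z * (ln r - ln (norm z)))"
  unfolding int_count_def by (intro sum.mono_neutral_left) (use assms in auto)

lemma int_count_cmult: "int_count (\<lambda>z. k * c z) r = k * int_count c r"
  by (cases "k = 0") (simp_all add: int_count_def sum_distrib_left mult.assoc)

lemma int_count_add:
  assumes "loc_finite c" "loc_finite c'"
  shows "int_count (\<lambda>z. c z + c' z) r = int_count c r + int_count c' r"
proof -
  define A where "A = {z. norm z \<le> r \<and> c z \<noteq> 0} \<union> {z. norm z \<le> r \<and> c' z \<noteq> 0}"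
  have A: "finite A" unfolding A_def using assms by (auto dest: loc_finiteD)
  have "int_count (\<lambda>z. c z + c' z) r = (\<Sum>z\<in>A. (c z + c' z) * (ln r - ln (norm z)))"
    by (rule int_count_superset[OF A]) (auto simp: A_def)
  also have "\<dots> = (\<Sum>z\<in>A. c z * (ln r - ln (norm z))) + (\<Sum>z\<in>A. c' z * (ln r - ln (norm z)))"
    by (simp only: distrib_right sum.distrib)
  also have "(\<Sum>z\<in>A. c z * (ln r - ln (norm z))) = int_count c r"
    by (rule int_count_superset[OF A, symmetric]) (auto simp: A_def)
  also have "(\<Sum>z\<in>A. c' z * (ln r - ln (norm z))) = int_count c' r"
    by (rule int_count_superset[OF A, symmetric]) (auto simp: A_def)
  finally show ?thesis .
qed

lemma int_count_diff:
  assumes "loc_finite c" "loc_finite c'"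
  shows "int_count (\<lambda>z. c z - c' z) r = int_count c r - int_count c' r"
  using int_count_add[OF assms(1) loc_finite_cmult[OF assms(2), of "-1"], of r] int_count_cmult[of "-1" c' r]
  by simp

lemma int_count_0 [simp]: "int_count (\<lambda>_. 0) r = 0"
  by (simp add: int_count_def)

lemma int_count_sum:
  assumes "\<And>i. i \<in> I \<Longrightarrow> loc_finite (c i)"
  shows "int_count (\<lambda>z. \<Sum>i\<in>I. c i z) r = (\<Sum>i\<in>I. int_count (c i) r)"
  using assms
  by (induction I rule: infinite_finite_induct) (auto simp: int_count_add loc_finite_sum)

lemma ln_diff_nonneg:
  assumes "r \<ge> 1" "norm (z::complex) \<le> r"
  shows "ln r - ln (norm z) \<ge> 0"
  using assms by (cases "z = 0") auto

lemma int_count_nonneg: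
  assumes "r \<ge> 1" "\<And>z. c z \<ge> 0"
  shows "int_count c r \<ge> 0"
  unfolding int_count_def
  by (intro sum_nonneg mult_nonneg_nonneg ln_diff_nonneg assms) auto

lemma int_count_mono:
  assumes "loc_finite c" "loc_finite c'" "r \<ge> 1" "\<And>z. c z \<le> c' z"
  shows "int_count c r \<le> int_count c' r"
  using int_count_nonneg[OF assms(3), of "\<lambda>z. c' z - c z"] int_count_diff[OF assms(2,1)] assms(4)
  by simp

text \<open>Exchange of sum and integral: a point \<open>z \<noteq> 0\<close> contributes
  \<open>c z\<close> times the integral of \<open>1 / t\<close> from \<open>|z|\<close> to
  \<open>r\<close>. The origin is removed from the integrand by subtracting \<open>n 0 = c 0\<close>
  and returns in the term with \<open>ln r\<close>.\<close>

lemma integrated_count_eq: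
  fixes c :: "complex \<Rightarrow> nat"
  assumes fin: "loc_finite (\<lambda>z. real (c z))" and r: "r > 0"
    and n: "\<And>t. n t = (\<Sum>z\<in>{z. norm z \<le> t \<and> c z \<noteq> 0}. c z)"
  shows "integrated_count n r = int_count (\<lambda>z. real (c z)) r"
proof -
  define D where "D = {z. norm z \<le> r \<and> c z \<noteq> 0}"
  have D: "finite D" using loc_finiteD[OF fin, of r] by (simp add: D_def)
  have n0: "n 0 = c 0"
  proof -
    have "{z. norm z \<le> 0 \<and> c z \<noteq> 0} = (if c 0 = 0 then {} else {0})" by auto
    thus ?thesis by (simp add: n)
  qed
  have nt: "real (n t) - real (n 0) = (\<Sum>z\<in>D - {0}. real (c z) * indicator {norm z..r} t)" if t: "0 < t" "t \<le> r" for t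
  proof -
    have "real (n t) = (\<Sum>z\<in>D. if norm z \<le> t then real (c z) else 0)"
      unfolding n of_nat_sum using t D
      by (simp add: sum.If_cases D_def) (intro sum.cong, auto)
    also have "\<dots> = (\<Sum>z\<in>insert 0 D. if norm z \<le> t then real (c z) else 0)"
      using D r by (intro sum.mono_neutral_left) (auto simp: D_def)
    also have "\<dots> = real (c 0) + (\<Sum>z\<in>D - {0}. if norm z \<le> t then real (c z) else 0)"
      using D t by (subst sum.insert_remove) auto
    also have "(\<Sum>z\<in>D - {0}. if norm z \<le> t then real (c z) else 0) = (\<Sum>z\<in>D - {0}. real (c z) * indicator {norm z..r} t)"
      using t by (intro sum.cong) (auto simp: indicator_def)
    finally show ?thesis using n0 by simp
  qed
  have "has_bochner_integral lborel (\<lambda>t. \<Sum>z\<in>D - {0}. real (c z) * ((1 / t) * indicator {norm z..r} t))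
     (\<Sum>z\<in>D - {0}. real (c z) * (ln r - ln (norm z)))"
  proof (intro has_bochner_integral_sum has_bochner_integral_mult_right has_bochner_integral_FTC_Icc_real)
    fix z x assume "z \<in> D - {0}" "norm z \<le> x"
    hence "x > 0" by (auto intro: less_le_trans[of _ "norm z"])
    thus "(ln has_real_derivative 1 / x) (at x)" "isCont (\<lambda>x. 1 / x) x"
      by (auto intro!: derivative_eq_intros continuous_intros simp: field_simps)
  qed (auto simp: D_def)
  hence "(\<integral>t. (\<Sum>z\<in>D - {0}. real (c z) * ((1 / t) * indicator {norm z..r} t)) \<partial>lborel)
    = (\<Sum>z\<in>D - {0}. real (c z) * (ln r - ln (norm z)))"
    by (rule has_bochner_integral_integral_eq)
  also have "(\<lambda>t. \<Sum>z\<in>D - {0}. real (c z) * ((1 / t) * indicator {norm z..r} t))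
     = (\<lambda>t. indicator {0<..r} t *\<^sub>R ((real (n t) - real (n 0)) / t))"
  proof
    fix t
    show "(\<Sum>z\<in>D - {0}. real (c z) * ((1 / t) * indicator {norm z..r} t)) = indicator {0<..r} t *\<^sub>R ((real (n t) - real (n 0)) / t)"
    proof (cases "0 < t \<and> t \<le> r")
      case True
      thus ?thesis using nt[of t] by (simp add: sum_divide_distrib)
    next
      case False
      have "indicator {norm z..r} t = (0::real)" if "z \<in> D - {0}" for z
        using False that norm_ge_zero[of z] zero_less_norm_iff[of z]
        by (auto simp: indicator_def simp del: norm_ge_zero zero_less_norm_iff)
      thus ?thesis using False by simp
    qed
  qed
  finally have "(LINT t:{0<..r}|lborel. (real (n t) - real (n 0)) / t) = (\<Sum>z\<in>D - {0}. real (c z) * (ln r - ln (norm z)))"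
    by (simp add: set_lebesgue_integral_def)
  moreover have "int_count (\<lambda>z. real (c z)) r = (\<Sum>z\<in>insert 0 D. real (c z) * (ln r - ln (norm z)))"
    using D r by (intro int_count_superset) (auto simp: D_def)
  moreover have "\<dots> = real (c 0) * ln r + (\<Sum>z\<in>D - {0}. real (c z) * (ln r - ln (norm z)))"
    using D by (subst sum.insert_remove) auto
  ultimately show ?thesis by (simp add: integrated_count_def n0)
qed

lemma loc_finite_sparse:
  assumes "{z. c z \<noteq> 0} sparse_in UNIV"
  shows "loc_finite c"
  unfolding loc_finite_def
proof
  fix r
  have "{z. c z \<noteq> 0} sparse_in cball 0 r" by (rule sparse_in_subset[OF assms]) auto
  from sparse_in_compact_finite[OF this compact_cball]
  have "finite (cball 0 r \<inter> {z. c z \<noteq> 0})" .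
  moreover have "cball 0 r \<inter> {z. c z \<noteq> 0} = {z. norm z \<le> r \<and> c z \<noteq> 0}" by auto
  ultimately show "finite {z. norm z \<le> r \<and> c z \<noteq> 0}" by simp
qed

lemma loc_finite_is_pole:
  assumes "f meromorphic_on UNIV"
  shows "loc_finite (\<lambda>z. of_bool (is_pole f z))"
  using meromorphic_on_imp_not_pole_cosparse[OF assms]
  by (intro loc_finite_sparse) (simp add: eventually_cosparse)

lemma loc_finite_pole_order:
  assumes "f meromorphic_on UNIV"
  shows "loc_finite (\<lambda>z. real (pole_order f z))"
  by (rule loc_finite_subset[OF loc_finite_is_pole[OF assms]]) (auto simp: pole_order_def)

lemma counting_eq:
  assumes "f meromorphic_on UNIV" "r > 0"
  shows "counting f r = int_count (\<lambda>z. real (pole_order f z)) r"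
  unfolding counting_def
proof (rule integrated_count_eq[OF loc_finite_pole_order[OF assms(1)] assms(2)])
  fix t
  have fin: "finite {z. norm z \<le> t \<and> is_pole f z}"
    using loc_finiteD[OF loc_finite_is_pole[OF assms(1)], of t] by simp
  have "pole_count f t = (\<Sum>z\<in>{z. norm z \<le> t \<and> is_pole f z}. pole_order f z)"
    unfolding pole_count_def poles_in_def by (intro sum.cong) (auto simp: pole_order_def)
  also have "\<dots> = (\<Sum>z\<in>{z. norm z \<le> t \<and> pole_order f z \<noteq> 0}. pole_order f z)"
    by (intro sum.mono_neutral_right fin) (auto simp: pole_order_def split: if_splits)
  finally show "pole_count f t = (\<Sum>z\<in>{z. norm z \<le> t \<and> pole_order f z \<noteq> 0}. pole_order f z)" .
qed

lemma reduced_counting_eq: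
  assumes "f meromorphic_on UNIV" "r > 0"
  shows "reduced_counting f r = int_count (\<lambda>z. of_bool (is_pole f z)) r"
proof -
  have "integrated_count (reduced_pole_count f) r = int_count (\<lambda>z. real (of_bool (is_pole f z))) r"
  proof (rule integrated_count_eq)
    show "loc_finite (\<lambda>z. real (of_bool (is_pole f z)))" using loc_finite_is_pole[OF assms(1)] by simp
    fix t show "reduced_pole_count f t = (\<Sum>z\<in>{z. norm z \<le> t \<and> of_bool (is_pole f z) \<noteq> (0::nat)}. of_bool (is_pole f z))"
      unfolding reduced_pole_count_def poles_in_def card_eq_sum by (intro sum.cong) auto
  qed fact
  thus ?thesis by (simp add: reduced_counting_def)
qed

section \<open>Jensen's formula\<close>

text \<open>By the identity theorem this amounts to being meromorphic and not zero off a sparse set.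
  The form with \<open>\<forall>\<^sub>\<approx>\<close> can be combined directly with other
  statements valid off sparse sets.\<close>

definition nonzero_mero :: "(complex \<Rightarrow> complex) \<Rightarrow> bool" where
  "nonzero_mero g \<longleftrightarrow> g meromorphic_on UNIV \<and> (\<forall>\<^sub>\<approx>z. g z \<noteq> 0)"

text \<open>Analyticity at each point of the circle ensures that the values there are the true ones
  and not arbitrary values on a discrete set. Excluding zeros makes \<open>ln |g|\<close> continuous
  on the circle.\<close>

definition good_circle :: "(complex \<Rightarrow> complex) \<Rightarrow> real \<Rightarrow> bool" where
  "good_circle g r \<longleftrightarrow> r > 0 \<and> (\<forall>z. norm z = r \<longrightarrow> g analytic_on {z} \<and> g z \<noteq> 0)"

lemma countable_bad_circles:
  assumes "\<forall>\<^sub>\<approx>z. P (z::complex)"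
  shows "countable {r. \<exists>z. norm z = r \<and> \<not> P z}"
proof -
  have "{z. \<not> P z} sparse_in UNIV" using assms by (simp add: eventually_cosparse)
  from sparse_imp_countable[OF open_UNIV this] have "countable {z. \<not> P z}" by simp
  hence "countable (norm ` {z. \<not> P z})" by (rule countable_image)
  thus ?thesis by (rule countable_subset[rotated]) auto
qed

lemma countable_not_good_circle:
  assumes "nonzero_mero g"
  shows "countable {r. r > 0 \<and> \<not> good_circle g r}"
proof -
  have "\<forall>\<^sub>\<approx>z. g analytic_on {z}" "\<forall>\<^sub>\<approx>z. g z \<noteq> 0"
    using assms meromorphic_on_imp_analytic_cosparse by (auto simp: nonzero_mero_def)
  hence "\<forall>\<^sub>\<approx>z. g analytic_on {z} \<and> g z \<noteq> 0" by eventually_elim simp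
  from countable_bad_circles[OF this] show ?thesis
    by (rule countable_subset[rotated]) (auto simp: good_circle_def)
qed

lemma exists_between_not_in_countable:
  fixes a b :: real
  assumes "countable X" "a < b"
  shows "\<exists>r. a < r \<and> r < b \<and> r \<notin> X"
proof (rule ccontr)
  assume "\<not> ?thesis"
  hence "{a<..<b} \<subseteq> X" by auto
  thus False using assms countable_subset uncountable_open_interval by blast
qed

lemma exists_good_circle:
  assumes "nonzero_mero g" "0 \<le> a" "a < b"
  shows "\<exists>r. a < r \<and> r < b \<and> good_circle g r"
  using exists_between_not_in_countable[OF countable_not_good_circle[OF assms(1)] assms(3)] assms(2)
  by force

lemma nonzero_meroD:
  assumes "nonzero_mero g"
  shows "g meromorphic_on {z}" "\<forall>\<^sub>F w in at z. g w \<noteq> 0" "\<exists>\<^sub>F w in at z. g w \<noteq> 0"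
    "isolated_singularity_at g z" "not_essential g z"
proof -
  show m: "g meromorphic_on {z}"
    using assms by (auto simp: nonzero_mero_def intro: meromorphic_on_subset)
  show e: "\<forall>\<^sub>F w in at z. g w \<noteq> 0"
    using assms eventually_cosparse_imp_eventually_at[of _ UNIV z UNIV] by (auto simp: nonzero_mero_def)
  show "\<exists>\<^sub>F w in at z. g w \<noteq> 0" using e by (simp add: eventually_frequently)
  show "isolated_singularity_at g z" "not_essential g z"
    using m meromorphic_at_iff by blast+
qed

lemma nonzero_mero_if_frequently:
  assumes "g meromorphic_on UNIV" "\<not> (\<forall>\<^sub>\<approx>z. g z = 0)"
  shows "nonzero_mero g"
  using meromorphic_imp_constant_or_avoid[OF assms(1) open_UNIV connected_UNIV, of 0] assms
  by (auto simp: nonzero_mero_def)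

lemma nonzero_mero_inverse: "nonzero_mero g \<Longrightarrow> nonzero_mero (\<lambda>z. 1 / g z)"
  by (auto simp: nonzero_mero_def intro!: meromorphic_intros)

lemma nonzero_mero_divide: "nonzero_mero g \<Longrightarrow> nonzero_mero h \<Longrightarrow> nonzero_mero (\<lambda>z. g z / h z)"
  unfolding nonzero_mero_def
proof (intro conjI)
  assume *: "g meromorphic_on UNIV \<and> (\<forall>\<^sub>\<approx>z. g z \<noteq> 0)" "h meromorphic_on UNIV \<and> (\<forall>\<^sub>\<approx>z. h z \<noteq> 0)"
  thus "(\<lambda>z. g z / h z) meromorphic_on UNIV" by (intro meromorphic_intros) auto
  from * have "\<forall>\<^sub>\<approx>z. g z \<noteq> 0" "\<forall>\<^sub>\<approx>z. h z \<noteq> 0" by auto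
  thus "\<forall>\<^sub>\<approx>z. g z / h z \<noteq> 0" by eventually_elim simp
qed

lemma is_pole_iff_zorder:
  assumes "nonzero_mero g"
  shows "is_pole g z \<longleftrightarrow> zorder g z < 0"
  using isolated_pole_imp_neg_zorder zorder_neg_imp_is_pole nonzero_meroD[OF assms] by blast

lemma zorder_one_over:
  assumes "nonzero_mero g"
  shows "zorder (\<lambda>z. 1 / g z) z = - zorder g z"
  using zorder_divide[of "\<lambda>_. 1" z g] nonzero_meroD[OF assms] by (simp add: analytic_on_imp_meromorphic_on)

lemma pole_order_eq: "nonzero_mero g \<Longrightarrow> pole_order g z = nat (- zorder g z)"
  by (simp add: pole_order_def is_pole_iff_zorder)

lemma pole_order_one_over: "nonzero_mero g \<Longrightarrow> pole_order (\<lambda>z. 1 / g z) z = nat (zorder g z)"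
  by (simp add: pole_order_eq nonzero_mero_inverse zorder_one_over)

lemma zorder_eq_pole_orders:
  "nonzero_mero g \<Longrightarrow> real_of_int (zorder g z) = real (pole_order (\<lambda>z. 1 / g z) z) - real (pole_order g z)"
  by (simp add: pole_order_eq pole_order_one_over)

lemma loc_finite_pole_order': "nonzero_mero g \<Longrightarrow> loc_finite (\<lambda>z. real (pole_order g z))"
  by (simp add: nonzero_mero_def loc_finite_pole_order)

lemma loc_finite_zorder: "nonzero_mero g \<Longrightarrow> loc_finite (\<lambda>z. real_of_int (zorder g z))"
  by (simp add: zorder_eq_pole_orders loc_finite_diff loc_finite_pole_order' nonzero_mero_inverse)

section \<open>Factorization over finitely many zeros and poles\<close>

lemma zorder_linear_power_int: "zorder (\<lambda>w. (w - a) powi n) z = (if z = a then n else 0)"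
proof (cases "z = a")
  case True
  show ?thesis unfolding True by (simp, rule zorder_eqI[where g = "\<lambda>_. 1" and S = UNIV]) auto
next
  case False
  thus ?thesis by (auto intro!: zorder_eq_0I analytic_intros)
qed

text \<open>Dividing \<open>g\<close> by the product over its zeros and poles leaves order 0
  throughout \<open>S\<close>. With the singularities removed, the quotient is holomorphic without
  zeros on a convex set and has a logarithm. The factorization is claimed only where
  \<open>g\<close> is analytic and nonzero, since elsewhere its values may be arbitrary.\<close>

lemma mero_factorization:
  assumes g: "nonzero_mero g" and S: "open S" "convex S"
    and A: "A = {z\<in>S. zorder g z \<noteq> 0}" "finite A"
  obtains L where "L holomorphic_on S"
    "\<And>z. z \<in> S \<Longrightarrow> g analytic_on {z} \<Longrightarrow> g z \<noteq> 0 \<Longrightarrow>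
       z \<notin> A \<and> g z = (\<Prod>a\<in>A. (z - a) powi zorder g a) * exp (L z)"
proof -
  define q where "q = (\<lambda>z. \<Prod>a\<in>A. (z - a) powi zorder g a)"
  have q_mero: "q meromorphic_on UNIV" unfolding q_def by (auto intro!: meromorphic_intros)
  have q_nz: "q z \<noteq> 0" if "z \<notin> A" for z using that A(2) by (auto simp: q_def power_int_eq_0_iff)
  have "\<forall>\<^sub>\<approx>z. z \<notin> A" by (simp add: eventually_cosparse finite_imp_sparse[OF A(2)])
  hence q: "nonzero_mero q" unfolding nonzero_mero_def using q_mero q_nz
    by (auto elim: eventually_mono)
  have q_ord: "zorder q z = zorder g z" if "z \<in> S" for z
  proof -
    have "zorder q z = (\<Sum>a\<in>A. zorder (\<lambda>w. (w - a) powi zorder g a) z)"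
      unfolding q_def
      by (intro zorder_prod) (use nonzero_meroD(2)[OF q, of z] in \<open>auto simp: q_def intro!: meromorphic_intros\<close>)
    also have "\<dots> = (\<Sum>a\<in>A. if z = a then zorder g a else 0)"
      by (simp add: zorder_linear_power_int)
    also have "\<dots> = zorder g z" using A that by (simp add: sum.delta')
    finally show ?thesis .
  qed
  define h where "h = (\<lambda>z. g z / q z)"
  have h: "nonzero_mero h" unfolding h_def by (intro nonzero_mero_divide g q)
  define H where "H = remove_sings h"
  have H: "H analytic_on {z} \<and> H z \<noteq> 0" if z: "z \<in> S" for z
  proof -
    have "zorder h z = zorder g z - zorder q z" unfolding h_def
      by (intro zorder_divide nonzero_meroD g q)
    hence h0: "zorder h z = 0" using q_ord[OF z] by simp
    hence "\<not> is_pole h z" using is_pole_iff_zorder[OF h] by simp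
    then obtain c where c: "h \<midarrow>z\<rightarrow> c" using nonzero_meroD(5)[OF h, of z] by (auto simp: not_essential_def)
    have an: "H analytic_on {z}" unfolding H_def
      using remove_sings_analytic_at[OF nonzero_meroD(4)[OF h] c] .
    have "\<forall>\<^sub>F w in at z. H w = h w" unfolding H_def
      by (rule eventually_remove_sings_eq_at[OF nonzero_meroD(4)[OF h]])
    hence "\<forall>\<^sub>F w in at z. H w \<noteq> 0" using nonzero_meroD(2)[OF h, of z] by eventually_elim simp
    hence "\<exists>\<^sub>F w in at z. H w \<noteq> 0" by (simp add: eventually_frequently)
    moreover have "zorder H z = 0" unfolding H_def using h0 nonzero_meroD(4)[OF h] by simp
    ultimately show ?thesis using an zorder_pos_iff'[OF an] by auto
  qed
  have "H holomorphic_on S" using H analytic_imp_holomorphic analytic_on_analytic_at by blast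
  from contractible_imp_holomorphic_log[OF this convex_imp_contractible[OF S(2)]] H
  obtain L where L: "L holomorphic_on S" "\<And>z. z \<in> S \<Longrightarrow> H z = exp (L z)" by blast
  show ?thesis
  proof (rule that[OF L(1)])
    fix z assume z: "z \<in> S" "g analytic_on {z}" "g z \<noteq> 0"
    have nA: "z \<notin> A" using zorder_eq_0I[OF z(2,3)] A by simp
    have "q analytic_on {z}" unfolding q_def using nA by (intro analytic_intros) auto
    hence "h analytic_on {z}" unfolding h_def using q_nz[OF nA] z by (auto intro!: analytic_intros)
    hence "H z = h z" unfolding H_def by simp
    hence "g z = q z * exp (L z)" using L(2)[OF z(1)] q_nz[OF nA] by (simp add: h_def field_simps)
    thus "z \<notin> A \<and> g z = (\<Prod>a\<in>A. (z - a) powi zorder g a) * exp (L z)"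
      using nA by (simp add: q_def)
  qed
qed

lemma ln_power_int': "x > 0 \<Longrightarrow> ln (x powi n) = of_int n * ln (x::real)"
  by (cases n rule: int_cases4) (auto simp: power_int_minus ln_inverse ln_realpow)

lemma has_field_derivative_prod_power_int:
  assumes "finite A" "z \<notin> A"
  shows "((\<lambda>z. \<Prod>a\<in>A. (z - a) powi n a) has_field_derivative
      (\<Prod>a\<in>A. (z - a) powi n a) * (\<Sum>a\<in>A. of_int (n a) / (z - a))) (at (z::complex))"
  using assms
proof (induction A rule: finite_induct)
  case (insert a A)
  have za: "z - a \<noteq> 0" using insert.prems by auto
  have pw: "(z - a) powi (n a - 1) = (z - a) powi n a / (z - a)"
    using za by (simp add: power_int_diff)
  have "((\<lambda>z. (z - a) powi n a * (\<Prod>a\<in>A. (z - a) powi n a)) has_field_derivative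
      (z - a) powi n a * ((\<Prod>a\<in>A. (z - a) powi n a) * (\<Sum>a\<in>A. of_int (n a) / (z - a)))
      + of_int (n a) * (z - a) powi (n a - 1) * (1 - 0) * (\<Prod>a\<in>A. (z - a) powi n a)) (at z)"
    using insert za by (intro DERIV_mult' DERIV_power_int derivative_intros) auto
  thus ?case using insert.hyps unfolding pw
    by (simp add: algebra_simps)
qed auto

lemma ln_norm_factorization:
  assumes "finite A" "z \<notin> A" "g z = (\<Prod>a\<in>A. (z - a) powi n a) * exp (L z)"
  shows "ln (norm (g z)) = (\<Sum>a\<in>A. of_int (n a) * ln (norm (z - a))) + Re (L z)"
proof -
  have nz: "(z - a) powi n a \<noteq> 0" if "a \<in> A" for a using that assms(2) by (auto simp: power_int_eq_0_iff)
  have "norm (g z) = (\<Prod>a\<in>A. norm (z - a) powi n a) * exp (Re (L z))"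
    by (simp add: assms(3) norm_mult norm_power_int flip: prod_norm)
  moreover have "(\<Prod>a\<in>A. norm (z - a) powi n a) \<noteq> 0"
    using assms by (auto simp: power_int_eq_0_iff)
  ultimately have "ln (norm (g z)) = ln (\<Prod>a\<in>A. norm (z - a) powi n a) + Re (L z)"
    by (simp add: ln_mult)
  also have "ln (\<Prod>a\<in>A. norm (z - a) powi n a) = (\<Sum>a\<in>A. ln (norm (z - a) powi n a))"
    using assms by (intro ln_prod) (auto simp: power_int_eq_0_iff)
  also have "\<dots> = (\<Sum>a\<in>A. of_int (n a) * ln (norm (z - a)))"
    using assms by (intro sum.cong ln_power_int') auto
  finally show ?thesis .
qed

lemma analytic_nonzero_nearby:
  assumes "g analytic_on {z}" "g z \<noteq> 0"
  shows "\<forall>\<^sub>F w in nhds z. g analytic_on {w} \<and> g w \<noteq> 0"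
proof -
  obtain S where S: "open S" "z \<in> S" "g holomorphic_on S"
    using assms(1) analytic_at by blast
  have "\<forall>\<^sub>F w in nhds z. w \<in> S" using S by (intro eventually_nhds_in_open)
  moreover have "isCont g z" using assms(1) analytic_at_imp_isCont by blast
  hence "\<forall>\<^sub>F w in nhds z. g w \<noteq> 0" using assms(2) 
    unfolding continuous_at_imp_continuous_within continuous_at
    by (intro tendsto_imp_eventually_ne) (simp add: tendsto_at_iff_tendsto_nhds)
  ultimately show ?thesis
  proof eventually_elim
    case (elim w) thus ?case using S analytic_at by blast
  qed
qed

lemma deriv_over_factorization:
  assumes S: "open S" "z \<in> S" "finite A" "L holomorphic_on S"
    and fact: "\<And>z. z \<in> S \<Longrightarrow> g analytic_on {z} \<Longrightarrow> g z \<noteq> 0 \<Longrightarrow>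
       z \<notin> A \<and> g z = (\<Prod>a\<in>A. (z - a) powi n a) * exp (L z)"
    and z: "g analytic_on {z}" "g z \<noteq> 0"
  shows "deriv g z / g z = (\<Sum>a\<in>A. of_int (n a) / (z - a)) + deriv L z"
proof -
  let ?q = "\<lambda>z. \<Prod>a\<in>A. (z - a) powi n a"
  have zA: "z \<notin> A" "g z = ?q z * exp (L z)" using fact[OF S(2) z] by auto
  have "\<forall>\<^sub>F w in nhds z. w \<in> S" using S by (intro eventually_nhds_in_open)
  with analytic_nonzero_nearby[OF z] have ev: "\<forall>\<^sub>F w in nhds z. g w = ?q w * exp (L w)"
    by eventually_elim (use fact in blast)
  have "(L has_field_derivative deriv L z) (at z)"
    using S holomorphic_derivI by blast
  hence "((\<lambda>w. ?q w * exp (L w)) has_field_derivative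
     ?q z * (exp (L z) * deriv L z) + ?q z * (\<Sum>a\<in>A. of_int (n a) / (z - a)) * exp (L z)) (at z)"
    by (intro DERIV_mult' has_field_derivative_prod_power_int S zA DERIV_fun_exp)
  hence "(g has_field_derivative
     ?q z * (exp (L z) * deriv L z) + ?q z * (\<Sum>a\<in>A. of_int (n a) / (z - a)) * exp (L z)) (at z)"
    using ev by (subst DERIV_cong_ev[OF refl _ refl])
  hence "deriv g z = g z * ((\<Sum>a\<in>A. of_int (n a) / (z - a)) + deriv L z)"
    unfolding zA(2) by (simp add: DERIV_imp_deriv algebra_simps)
  thus ?thesis using z by simp
qed

lemma circle_mean_sum_ln:
  assumes "r > 0" "\<And>a. a \<in> A \<Longrightarrow> norm a \<noteq> r"
  shows "circle_mean (\<lambda>z. \<Sum>a\<in>A. c a * ln (norm (z - a))) r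
     = (\<Sum>a\<in>A. c a * ln (if norm a < r then r else norm a))"
proof -
  have "circle_mean (\<lambda>z. \<Sum>a\<in>A. c a * ln (norm (z - a))) r = (\<Sum>a\<in>A. circle_mean (\<lambda>z. c a * ln (norm (z - a))) r)"
    using assms by (intro circle_mean_sum continuous_intros) auto
  also have "\<dots> = (\<Sum>a\<in>A. c a * ln (if norm a < r then r else norm a))"
    using assms by (intro sum.cong) (simp_all add: circle_mean_ln_norm_diff)
  finally show ?thesis .
qed

text \<open>For each point the mean is \<open>ln |a|\<close>, plus \<open>ln r - ln |a|\<close> if
  \<open>|a| < r\<close>. The first part does not depend on \<open>r\<close>; the second is the
  counting term. The origin fits in because \<open>ln 0 = 0\<close>.\<close>

lemma circle_mean_sum_ln_eq_int_count:
  assumes "r > 0" "finite A" "\<And>a. a \<in> A \<Longrightarrow> norm a \<noteq> r"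
    and "\<And>z. norm z \<le> r \<Longrightarrow> c z \<noteq> 0 \<Longrightarrow> z \<in> A"
  shows "circle_mean (\<lambda>z. \<Sum>a\<in>A. c a * ln (norm (z - a))) r
     = int_count c r + (\<Sum>a\<in>A. c a * ln (norm a))"
proof -
  have "int_count c r = (\<Sum>a\<in>{a\<in>A. norm a \<le> r}. c a * (ln r - ln (norm a)))"
    using assms by (intro int_count_superset) auto
  also have "\<dots> = (\<Sum>a\<in>A. if norm a \<le> r then c a * (ln r - ln (norm a)) else 0)"
    using assms(2) by (rule sum.inter_filter)
  finally have "int_count c r + (\<Sum>a\<in>A. c a * ln (norm a))
     = (\<Sum>a\<in>A. (if norm a \<le> r then c a * (ln r - ln (norm a)) else 0) + c a * ln (norm a))"
    by (simp add: sum.distrib)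
  also have "\<dots> = (\<Sum>a\<in>A. c a * ln (if norm a < r then r else norm a))"
    using assms(3) by (intro sum.cong) (auto simp: algebra_simps)
  finally show ?thesis using circle_mean_sum_ln[OF assms(1,3), where c = c] by simp
qed

lemma finite_zorder_ball:
  assumes "nonzero_mero g"
  shows "finite {z \<in> ball 0 R. zorder g z \<noteq> 0}"
  by (rule finite_subset[OF _ loc_finiteD[OF loc_finite_zorder[OF assms], of R]]) auto

theorem Jensen_formula:
  assumes g: "nonzero_mero g"
  shows "\<exists>K. \<forall>r. good_circle g r \<longrightarrow>
     circle_mean (\<lambda>z. ln (norm (g z))) r = int_count (\<lambda>z. real_of_int (zorder g z)) r + K"
proof -
  let ?n = "\<lambda>z. real_of_int (zorder g z)"
  have *: "\<exists>K. \<forall>r<R. good_circle g r \<longrightarrow> circle_mean (\<lambda>z. ln (norm (g z))) r = int_count ?n r + K" for R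
  proof -
    define A where "A = {z \<in> ball 0 R. zorder g z \<noteq> 0}"
    have A: "finite A" unfolding A_def by (rule finite_zorder_ball[OF g])
    obtain L where L: "L holomorphic_on ball 0 R"
      "\<And>z. z \<in> ball 0 R \<Longrightarrow> g analytic_on {z} \<Longrightarrow> g z \<noteq> 0 \<Longrightarrow>
         z \<notin> A \<and> g z = (\<Prod>a\<in>A. (z - a) powi zorder g a) * exp (L z)"
      using mero_factorization[OF g open_ball convex_ball A_def A] by blast
    show ?thesis
    proof (intro exI[of _ "(\<Sum>a\<in>A. ?n a * ln (norm a)) + Re (L 0)"] allI impI)
      fix r assume r: "r < R" and good: "good_circle g r"
      have r0: "r > 0" using good by (simp add: good_circle_def)
      have nA: "norm a \<noteq> r" if "a \<in> A" for a
        using L(2)[of a] good that r by (auto simp: good_circle_def)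
      have LC: "L holomorphic_on cball 0 r" using r by (intro holomorphic_on_subset[OF L(1)]) auto
      have "circle_mean (\<lambda>z. ln (norm (g z))) r = circle_mean (\<lambda>z. (\<Sum>a\<in>A. ?n a * ln (norm (z - a))) + Re (L z)) r"
        using good r r0 L(2) by (intro circle_mean_cong ln_norm_factorization A) (auto simp: good_circle_def)
      also have "\<dots> = circle_mean (\<lambda>z. \<Sum>a\<in>A. ?n a * ln (norm (z - a))) r + circle_mean (\<lambda>z. Re (L z)) r"
        using nA r0 by (intro circle_mean_add continuous_intros
            holomorphic_on_imp_continuous_on holomorphic_on_subset[OF LC]) auto
      also have "circle_mean (\<lambda>z. Re (L z)) r = Re (L 0)" by (rule circle_mean_Re[OF LC r0])
      also have "circle_mean (\<lambda>z. \<Sum>a\<in>A. ?n a * ln (norm (z - a))) r = int_count ?n r + (\<Sum>a\<in>A. ?n a * ln (norm a))"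
        using r by (intro circle_mean_sum_ln_eq_int_count r0 A nA) (auto simp: A_def)
      finally show "circle_mean (\<lambda>z. ln (norm (g z))) r = int_count ?n r + ((\<Sum>a\<in>A. ?n a * ln (norm a)) + Re (L 0))"
        by simp
    qed
  qed
  \<comment> \<open>The factorization on a disc of radius \<open>R\<close> gives a constant that
    might depend on \<open>R\<close>. Evaluation on one fixed good circle, contained in all the
    discs that matter, identifies these constants.\<close>
  obtain r0 where r0: "good_circle g r0" using exists_good_circle[OF g, of 0 1] by auto
  show ?thesis
  proof (intro exI[of _ "circle_mean (\<lambda>z. ln (norm (g z))) r0 - int_count ?n r0"] allI impI)
    fix r assume r: "good_circle g r"
    from *[of "max r r0 + 1"] obtain K where
      "\<And>r'. r' < max r r0 + 1 \<Longrightarrow> good_circle g r' \<Longrightarrow> circle_mean (\<lambda>z. ln (norm (g z))) r' = int_count ?n r' + K"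
      by blast
    from this[of r] this[of r0] r r0
    show "circle_mean (\<lambda>z. ln (norm (g z))) r = int_count ?n r + (circle_mean (\<lambda>z. ln (norm (g z))) r0 - int_count ?n r0)"
      by simp
  qed
qed

section \<open>The characteristic and the exceptional sets\<close>

text \<open>The formula includes \<open>x = 0\<close> because \<open>ln 0 = 0\<close>; in this form
  the continuity of the positive logarithm is visible.\<close>

lemma log_plus_eq: "x \<ge> 0 \<Longrightarrow> log_plus x = ln (max 1 x)"
  by (cases "x = 0") (auto simp: log_plus_def max_def)

lemma log_plus_nonneg [simp]: "log_plus x \<ge> 0"
  by (simp add: log_plus_def)

lemma continuous_on_log_plus_norm:
  assumes "continuous_on S g"
  shows "continuous_on S (\<lambda>z. log_plus (norm (g z)))"
proof -
  have "continuous_on S (\<lambda>z. ln (max 1 (norm (g z))))"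
    using assms by (intro continuous_intros) auto
  thus ?thesis by (simp add: log_plus_eq)
qed

text \<open>Zeros on the circle are allowed here, since the positive logarithm is continuous at
  them. This matters for the coefficients \<open>b j\<close>, which may vanish identically.\<close>

definition regular_circle :: "(complex \<Rightarrow> complex) \<Rightarrow> real \<Rightarrow> bool" where
  "regular_circle g r \<longleftrightarrow> r > 0 \<and> continuous_on (sphere 0 r) g"

lemma regular_circleD: "regular_circle g r \<Longrightarrow> r > 0"
  by (simp add: regular_circle_def)

text \<open>Continuity on the circle makes the Lebesgue integral in \<open>proximity\<close> agree
  with the gauge integral in \<open>circle_mean\<close>, for which the Poisson and Jensen formulas
  are stated.\<close>

lemma proximity_eq_circle_mean:
  assumes "regular_circle g r"
  shows "proximity g r = circle_mean (\<lambda>z. log_plus (norm (g z))) r"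
proof -
  have cont: "continuous_on (sphere 0 r) (\<lambda>z. log_plus (norm (g z)))" and r: "r > 0"
    using assms by (auto simp: regular_circle_def intro: continuous_on_log_plus_norm)
  have "set_integrable lborel {0..2*pi} (\<lambda>t. log_plus (norm (g (of_real r * cis t))))"
    using continuous_on_circle[OF cont] r by (intro borel_integrable_atLeastAtMost') auto
  hence "(LINT t:{0..2*pi}|lborel. log_plus (norm (g (of_real r * cis t))))
      = integral {0..2*pi} (\<lambda>t. log_plus (norm (g (of_real r * cis t))))"
    by (rule set_borel_integral_eq_integral)
  thus ?thesis by (simp add: proximity_def circle_mean_def)
qed

lemma good_imp_regular:
  assumes "good_circle g r"
  shows "regular_circle g r"
  unfolding regular_circle_def
  using assms analytic_at_imp_isCont
  by (auto simp: good_circle_def intro!: continuous_at_imp_continuous_on)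

lemma good_circle_one_over:
  assumes "good_circle g r"
  shows "good_circle (\<lambda>z. 1 / g z) r"
  using assms by (auto simp: good_circle_def intro!: analytic_intros)

lemma proximity_nonneg:
  assumes "regular_circle g r"
  shows "proximity g r \<ge> 0"
  unfolding proximity_eq_circle_mean[OF assms] using assms
  by (intro circle_mean_nonneg continuous_on_log_plus_norm) (auto simp: regular_circle_def)

lemma counting_nonneg:
  assumes "g meromorphic_on UNIV" "r \<ge> 1"
  shows "counting g r \<ge> 0"
  using assms by (subst counting_eq) (auto intro!: int_count_nonneg)

lemma characteristic_nonneg:
  assumes "g meromorphic_on UNIV" "r \<ge> 1" "regular_circle g r"
  shows "characteristic g r \<ge> 0"
  unfolding characteristic_def
  using proximity_nonneg[OF assms(3)] counting_nonneg[OF assms(1,2)] by simp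

lemma log_plus_minus_inverse:
  assumes "x > 0"
  shows "log_plus x - log_plus (1 / x) = ln x"
  using assms by (simp add: log_plus_def ln_div)

lemma proximity_diff_one_over:
  assumes "good_circle g r"
  shows "proximity g r - proximity (\<lambda>z. 1 / g z) r = circle_mean (\<lambda>z. ln (norm (g z))) r"
proof -
  note reg = good_imp_regular[OF assms] good_imp_regular[OF good_circle_one_over[OF assms]]
  have "proximity g r - proximity (\<lambda>z. 1 / g z) r
      = circle_mean (\<lambda>z. log_plus (norm (g z)) - log_plus (norm (1 / g z))) r"
    unfolding proximity_eq_circle_mean[OF reg(1)] proximity_eq_circle_mean[OF reg(2)]
    using reg by (subst circle_mean_diff) (auto simp: regular_circle_def intro!: continuous_on_log_plus_norm)
  also have "\<dots> = circle_mean (\<lambda>z. ln (norm (g z))) r"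
    using assms log_plus_minus_inverse
    by (intro circle_mean_cong) (auto simp: good_circle_def norm_divide)
  finally show ?thesis .
qed

lemma counting_diff_one_over:
  assumes "nonzero_mero g" "r > 0"
  shows "counting (\<lambda>z. 1 / g z) r - counting g r = int_count (\<lambda>z. real_of_int (zorder g z)) r"
proof -
  have m: "g meromorphic_on UNIV" "(\<lambda>z. 1 / g z) meromorphic_on UNIV"
    using assms nonzero_mero_inverse[OF assms(1)] by (auto simp: nonzero_mero_def)
  show ?thesis
    using assms by (simp only: zorder_eq_pole_orders counting_eq[OF m(1)] counting_eq[OF m(2)])
     (intro int_count_diff[symmetric] loc_finite_pole_order m)
qed

text \<open>In Jensen's formula the mean of \<open>ln |g|\<close> is
  \<open>m(r, g) - m(r, 1/g)\<close> and the count of orders is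
  \<open>N(r, 1/g) - N(r, g)\<close>.\<close>

theorem first_main_theorem:
  assumes g: "nonzero_mero g"
  shows "\<exists>K. \<forall>r. good_circle g r \<longrightarrow> characteristic (\<lambda>z. 1 / g z) r = characteristic g r + K"
proof -
  obtain K where K: "\<And>r. good_circle g r \<Longrightarrow>
     circle_mean (\<lambda>z. ln (norm (g z))) r = int_count (\<lambda>z. real_of_int (zorder g z)) r + K"
    using Jensen_formula[OF g] by blast
  show ?thesis
  proof (intro exI[of _ "-K"] allI impI)
    fix r assume r: "good_circle g r"
    hence "r > 0" by (simp add: good_circle_def)
    thus "characteristic (\<lambda>z. 1 / g z) r = characteristic g r + - K"
      using K[OF r] proximity_diff_one_over[OF r] counting_diff_one_over[OF g, of r]
      by (simp add: characteristic_def)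
  qed
qed

section \<open>Monotonicity of the characteristic\<close>

lemma ln_norm_diff_le_Poisson':
  assumes "norm a \<noteq> R" "norm z < R" "z \<noteq> a"
  shows "ln (norm (z - a)) \<le> circle_mean (\<lambda>w. ln (norm (w - a)) * Poisson_kernel z w) R"
proof (cases "norm a < R")
  case True
  thus ?thesis using ln_norm_diff_le_Poisson assms by blast
next
  case False
  have R: "R > 0" using assms norm_ge_zero[of z] by linarith
  from False assms have a: "norm a > R" by auto
  let ?L = "\<lambda>w. of_real (ln (norm a)) + Ln (1 - 1/a * w)"
  note eq = ln_norm_diff_eq_Re_Ln_outside[OF R a]
  have "circle_mean (\<lambda>w. ln (norm (w - a)) * Poisson_kernel z w) R = circle_mean (\<lambda>w. Re (?L w) * Poisson_kernel z w) R"
    using R by (intro circle_mean_cong arg_cong2[where f = "(*)"] eq(2)) auto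
  also have "\<dots> = Re (?L z)" by (rule Poisson_formula[OF eq(1) assms(2)])
  also have "\<dots> = ln (norm (z - a))" using eq(2)[of z] assms by simp
  finally show ?thesis by simp
qed

text \<open>The harmonic part \<open>Re L\<close> is reproduced exactly and each logarithm is
  subharmonic; nonnegative weights preserve the direction. Hence it is applied to numerator and
  denominator of a meromorphic function separately.\<close>

lemma Poisson_inequality:
  assumes "finite A" "\<And>a. a \<in> A \<Longrightarrow> norm a \<noteq> R" "\<And>a. a \<in> A \<Longrightarrow> c a \<ge> 0"
    and "L holomorphic_on cball 0 R" "norm z < R" "z \<notin> A"
  shows "(\<Sum>a\<in>A. c a * ln (norm (z - a))) + Re (L z)
     \<le> circle_mean (\<lambda>w. ((\<Sum>a\<in>A. c a * ln (norm (w - a))) + Re (L w)) * Poisson_kernel z w) R"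
proof -
  have R: "R > 0" using assms norm_ge_zero[of z] by linarith
  have cont: "continuous_on (sphere 0 R) (\<lambda>w. ln (norm (w - a)) * Poisson_kernel z w)" if "a \<in> A" for a
    using assms that by (intro continuous_intros continuous_on_Poisson_kernel) auto
  have contL: "continuous_on (sphere 0 R) (\<lambda>w. Re (L w) * Poisson_kernel z w)"
    by (intro continuous_intros continuous_on_Poisson_kernel assms
        holomorphic_on_imp_continuous_on holomorphic_on_subset[OF assms(4)]) auto
  have "(\<Sum>a\<in>A. c a * ln (norm (z - a))) + Re (L z)
     \<le> (\<Sum>a\<in>A. c a * circle_mean (\<lambda>w. ln (norm (w - a)) * Poisson_kernel z w) R) + Re (L z)"
    using assms by (intro add_right_mono sum_mono mult_left_mono ln_norm_diff_le_Poisson') auto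
  also have "\<dots> = circle_mean (\<lambda>w. (\<Sum>a\<in>A. c a * (ln (norm (w - a)) * Poisson_kernel z w)) + Re (L w) * Poisson_kernel z w) R"
  proof -
    have "circle_mean (\<lambda>w. \<Sum>a\<in>A. c a * (ln (norm (w - a)) * Poisson_kernel z w)) R
        = (\<Sum>a\<in>A. circle_mean (\<lambda>w. c a * (ln (norm (w - a)) * Poisson_kernel z w)) R)"
      using R by (intro circle_mean_sum continuous_on_mult_left cont) auto
    thus ?thesis using R
      by (subst circle_mean_add) (auto simp: Poisson_formula[OF assms(4,5)]
          intro!: continuous_on_mult_left continuous_on_sum cont contL)
  qed
  also have "\<dots> = circle_mean (\<lambda>w. ((\<Sum>a\<in>A. c a * ln (norm (w - a))) + Re (L w)) * Poisson_kernel z w) R"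
    by (simp add: sum_distrib_right distrib_right mult.assoc)
  finally show ?thesis .
qed

text \<open>Averaging the sub-mean-value inequality over \<open>|z| = r\<close> and exchanging the
  integrals leaves the mean of the kernel over \<open>z\<close>, which is 1.\<close>

lemma circle_mean_mono_radius:
  assumes r: "0 < r" "r < R"
    and ur: "continuous_on (sphere 0 r) u" and uR: "continuous_on (sphere 0 R) u"
    and sub: "\<And>z. norm z = r \<Longrightarrow> u z \<le> circle_mean (\<lambda>w. u w * Poisson_kernel z w) R"
  shows "circle_mean u r \<le> circle_mean u R"
proof -
  let ?z = "\<lambda>s. of_real r * cis s" and ?w = "\<lambda>t. of_real R * cis t"
  have cont: "continuous_on (cbox (0, 0) (2*pi, 2*pi)) (\<lambda>(s, t). u (?w t) * Poisson_kernel (?z s) (?w t))"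
  proof -
    have nz: "?w t - ?z s \<noteq> 0" for s t
    proof
      assume "?w t - ?z s = 0"
      hence "norm (?w t) = norm (?z s)" by simp
      thus False using r by (simp add: norm_mult)
    qed
    have "continuous_on (cbox (0, 0) (2*pi, 2*pi)) (\<lambda>p. u (?w (snd p)))"
      by (rule continuous_on_compose2[OF uR]) (use r in \<open>auto intro!: continuous_intros simp: norm_mult\<close>)
    moreover have "continuous_on (cbox (0, 0) (2*pi, 2*pi)) (\<lambda>p. Poisson_kernel (?z (fst p)) (?w (snd p)))"
      unfolding Poisson_kernel_def using nz by (intro continuous_intros) auto
    ultimately show ?thesis unfolding case_prod_unfold by (rule continuous_on_mult)
  qed
  have swap: "integral {0..2*pi} (\<lambda>s. integral {0..2*pi} (\<lambda>t. u (?w t) * Poisson_kernel (?z s) (?w t)))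
      = integral {0..2*pi} (\<lambda>t. integral {0..2*pi} (\<lambda>s. u (?w t) * Poisson_kernel (?z s) (?w t)))"
    using integral_swap_continuous[OF cont] by simp
  have inner: "integral {0..2*pi} (\<lambda>s. Poisson_kernel (?z s) (?w t)) = 2 * pi" for t
    using circle_mean_Poisson_kernel[of r "?w t"] r by (simp add: circle_mean_def norm_mult field_simps)
  have int: "(\<lambda>s. integral {0..2*pi} (\<lambda>t. u (?w t) * Poisson_kernel (?z s) (?w t))) integrable_on {0..2*pi}"
    using integral_integrable_2dim[OF cont] by simp
  have "integral {0..2*pi} (\<lambda>s. u (?z s)) \<le> integral {0..2*pi} (\<lambda>s. integral {0..2*pi} (\<lambda>t. u (?w t) * Poisson_kernel (?z s) (?w t)) / (2 * pi))"
  proof (rule integral_le)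
    show "(\<lambda>s. u (?z s)) integrable_on {0..2*pi}" using r ur by (intro integrable_on_circle) auto
    show "(\<lambda>s. integral {0..2*pi} (\<lambda>t. u (?w t) * Poisson_kernel (?z s) (?w t)) / (2 * pi)) integrable_on {0..2*pi}"
      using integrable_on_divide[OF int] by blast
  qed (use sub r in \<open>auto simp: circle_mean_def norm_mult\<close>)
  also have "\<dots> = integral {0..2*pi} (\<lambda>t. u (?w t))"
    by (simp add: swap inner)
  finally show ?thesis unfolding circle_mean_def by (intro divide_right_mono) auto
qed

text \<open>Locally \<open>g = p / h\<close> with \<open>p\<close>, \<open>h\<close> holomorphic without common zeros, and by Jensen's formula
  \<open>T(r, g)\<close> is, up to a constant, the circle mean of the subharmonic function
  \<open>max (ln \<bar>p\<bar>) (ln \<bar>h\<bar>)\<close>.\<close>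

theorem characteristic_mono:
  assumes g: "nonzero_mero g" and r: "good_circle g r" and R: "good_circle g R" and rR: "r < R"
  shows "characteristic g r \<le> characteristic g R"
proof -
  define A where "A = {z \<in> ball 0 (R+1). zorder g z \<noteq> 0}"
  have A: "finite A" unfolding A_def by (rule finite_zorder_ball[OF g])
  obtain L where L: "L holomorphic_on ball 0 (R+1)"
    "\<And>z. z \<in> ball 0 (R+1) \<Longrightarrow> g analytic_on {z} \<Longrightarrow> g z \<noteq> 0 \<Longrightarrow>
       z \<notin> A \<and> g z = (\<Prod>a\<in>A. (z - a) powi zorder g a) * exp (L z)"
    using mero_factorization[OF g open_ball convex_ball A_def A] by blast
  define p where "p = (\<lambda>z. (\<Sum>a\<in>A. real (pole_order (\<lambda>z. 1 / g z) a) * ln (norm (z - a))) + Re (L z))"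
  define h where "h = (\<lambda>z. \<Sum>a\<in>A. real (pole_order g a) * ln (norm (z - a)))"
  define u where "u = (\<lambda>z. max (p z) (h z))"
  have gm: "g meromorphic_on UNIV" using g by (simp add: nonzero_mero_def)
  have nA: "norm a \<noteq> s" if "a \<in> A" "good_circle g s" "s \<le> R" for a s
    using L(2)[of a] that by (auto simp: good_circle_def)
  have Ls: "L holomorphic_on cball 0 s" if "s \<le> R" for s
    using that by (intro holomorphic_on_subset[OF L(1)]) auto
  have cont: "continuous_on (sphere 0 s) h \<and> continuous_on (sphere 0 s) p" if s: "good_circle g s" "s \<le> R" for s
    unfolding h_def p_def using nA[OF _ s]
    by (intro conjI continuous_intros holomorphic_on_imp_continuous_on holomorphic_on_subset[OF Ls[OF s(2)]]) auto
  have T: "characteristic g s = circle_mean u s - (\<Sum>a\<in>A. real (pole_order g a) * ln (norm a))"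
    if s: "good_circle g s" "s \<le> R" for s
  proof -
    have s0: "s > 0" using s by (simp add: good_circle_def)
    \<comment> \<open>Here \<open>p\<close> and \<open>h\<close> are the logarithms of the moduli of
      numerator and denominator, so \<open>ln |g| = p - h\<close> and its positive part is
      \<open>max p h - h\<close>. The mean of \<open>h\<close> is \<open>N(s, g)\<close> up to a
      constant and cancels in the characteristic.\<close>
    have "proximity g s = circle_mean (\<lambda>z. u z - h z) s"
      unfolding proximity_eq_circle_mean[OF good_imp_regular[OF s(1)]]
    proof (rule circle_mean_cong)
      fix z :: complex assume z: "norm z = s"
      hence z': "z \<in> ball 0 (R+1)" "g analytic_on {z}" "g z \<noteq> 0" using s by (auto simp: good_circle_def)
      have "ln (norm (g z)) = (\<Sum>a\<in>A. real_of_int (zorder g a) * ln (norm (z - a))) + Re (L z)"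
        using L(2)[OF z'] by (intro ln_norm_factorization[OF A]) auto
      also have "\<dots> = p z - h z"
        by (simp add: p_def h_def zorder_eq_pole_orders[OF g] left_diff_distrib sum_subtractf)
      finally show "log_plus (norm (g z)) = u z - h z"
        by (simp add: log_plus_def u_def)
    qed (use s0 in auto)
    also have "\<dots> = circle_mean u s - circle_mean h s"
      using cont[OF s] s0 by (intro circle_mean_diff) (auto simp: u_def intro!: continuous_on_max)
    also have "circle_mean h s = int_count (\<lambda>z. real (pole_order g z)) s + (\<Sum>a\<in>A. real (pole_order g a) * ln (norm a))"
      unfolding h_def using s s0 nA[OF _ s]
      by (intro circle_mean_sum_ln_eq_int_count A) (auto simp: A_def pole_order_eq[OF g])
    finally show ?thesis by (simp add: characteristic_def counting_eq[OF gm s0])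
  qed
  have R0: "0 < r" using r by (simp add: good_circle_def)
  have "circle_mean u r \<le> circle_mean u R"
  proof (rule circle_mean_mono_radius)
    show "continuous_on (sphere 0 r) u" "continuous_on (sphere 0 R) u"
      unfolding u_def using cont[OF r] cont[OF R] rR by (auto intro!: continuous_on_max)
    fix z :: complex assume z: "norm z = r"
    hence zA: "z \<notin> A" using nA[OF _ r] rR by auto
    have zR: "norm z < R" using z rR by simp
    have contP: "continuous_on (sphere 0 R) (\<lambda>w. v w * Poisson_kernel z w)" if "continuous_on (sphere 0 R) v" for v
      by (intro continuous_intros that continuous_on_Poisson_kernel zR)
    have contu: "continuous_on (sphere 0 R) u" unfolding u_def using cont[OF R] by (auto intro!: continuous_on_max)
    have "p z \<le> circle_mean (\<lambda>w. p w * Poisson_kernel z w) R"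
      unfolding p_def using nA[OF _ R] Ls zR zA by (intro Poisson_inequality A) auto
    also have "\<dots> \<le> circle_mean (\<lambda>w. u w * Poisson_kernel z w) R"
      using R0 rR cont[OF R] contu zR
      by (intro circle_mean_mono contP mult_right_mono Poisson_kernel_nonneg) (auto simp: u_def)
    finally have 1: "p z \<le> circle_mean (\<lambda>w. u w * Poisson_kernel z w) R" .
    have "h z \<le> circle_mean (\<lambda>w. h w * Poisson_kernel z w) R"
      unfolding h_def using nA[OF _ R] zR zA Poisson_inequality[OF A, of R "\<lambda>a. real (pole_order g a)" "\<lambda>_. 0" z]
      by simp
    also have "\<dots> \<le> circle_mean (\<lambda>w. u w * Poisson_kernel z w) R"
      using R0 rR cont[OF R] contu zR
      by (intro circle_mean_mono contP mult_right_mono Poisson_kernel_nonneg) (auto simp: u_def)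
    finally show "u z \<le> circle_mean (\<lambda>w. u w * Poisson_kernel z w) R" using 1 by (simp add: u_def)
  qed (use R0 rR in auto)
  thus ?thesis using T[OF r] T[OF R] rR by simp
qed

section \<open>Borel's growth lemma and exceptional sets of finite measure\<close>

lemma Borel_growth_lemma:
  fixes \<Phi> :: "real \<Rightarrow> real"
  assumes mono: "\<And>r s. 1 \<le> r \<Longrightarrow> r \<le> s \<Longrightarrow> \<Phi> r \<le> \<Phi> s" and ge1: "\<And>r. 1 \<le> r \<Longrightarrow> 1 \<le> \<Phi> r"
  shows "\<exists>E\<in>lmeasurable. \<forall>r\<ge>1. r \<notin> E \<longrightarrow> \<Phi> (r + 1 / \<Phi> r) < 2 * \<Phi> r"
proof -
  define X where "X = (\<lambda>n::nat. {r. 1 \<le> r \<and> 2^n \<le> \<Phi> r \<and> \<Phi> r < 2^(n+1) \<and> 2 * \<Phi> r \<le> \<Phi> (r + 1 / \<Phi> r)})"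
  \<comment> \<open>For empty \<open>X n\<close> the choice is arbitrary; the interval around it
    still has the small length that the summation needs.\<close>
  define x where "x = (\<lambda>n. SOME r. r \<in> X n)"
  define I where "I = (\<lambda>n. {x n - (1/2)^n .. x n + (1/2)^n})"
  \<comment> \<open>At \<open>r + 1 / \<Phi> r\<close> the value has at least doubled and so has
    left the dyadic level \<open>n\<close>, while \<open>1 / \<Phi> r\<close> is at most
    \<open>2^(-n)\<close>. Thus the bad radii of level \<open>n\<close> lie within
    \<open>2^(-n)\<close> of each other.\<close>
  have less: "s < r + (1/2)^n" if "r \<in> X n" "s \<in> X n" for r s n
  proof -
    have pos: "\<Phi> r > 0" using that ge1[of r] by (auto simp: X_def)
    have "\<Phi> s < 2 * 2^n" "2 * 2^n \<le> 2 * \<Phi> r" "2 * \<Phi> r \<le> \<Phi> (r + 1 / \<Phi> r)"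
      using that by (auto simp: X_def)
    hence "\<Phi> s < \<Phi> (r + 1 / \<Phi> r)" by linarith
    hence "s < r + 1 / \<Phi> r"
    proof (rule contrapos_pp)
      assume "\<not> s < r + 1 / \<Phi> r"
      moreover have "1 \<le> r + 1 / \<Phi> r" using that pos by (auto simp: X_def intro: add_increasing2)
      ultimately show "\<not> \<Phi> s < \<Phi> (r + 1 / \<Phi> r)" using mono[of "r + 1 / \<Phi> r" s] by simp
    qed
    also have "1 / \<Phi> r \<le> 1 / 2^n" using that pos by (intro divide_left_mono) (auto simp: X_def)
    finally show ?thesis by (simp add: power_one_over)
  qed
  have XI: "X n \<subseteq> I n" for n
  proof
    fix r assume r: "r \<in> X n"
    hence "x n \<in> X n" unfolding x_def by (metis someI)
    from less[OF this r] less[OF r this] show "r \<in> I n" by (simp add: I_def)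
  qed
  have "(\<Union>n. I n) \<in> lmeasurable"
  proof (rule fmeasurableI)
    show "(\<Union>n. I n) \<in> sets lebesgue" by (auto simp: I_def)
    have "emeasure lebesgue (\<Union>n. I n) \<le> (\<Sum>n. emeasure lebesgue (I n))"
      by (rule emeasure_subadditive_countably) (auto simp: I_def)
    also have "\<dots> = (\<Sum>n. ennreal (2 * (1/2)^n))"
      by (intro suminf_cong) (simp add: I_def)
    also have "\<dots> = ennreal (\<Sum>n. 2 * (1/2)^n)"
      by (rule suminf_ennreal2) (auto intro!: summable_mult summable_geometric)
    also have "\<dots> < \<infinity>" by simp
    finally show "emeasure lebesgue (\<Union>n. I n) < \<infinity>" .
  qed
  moreover have "\<Phi> (r + 1 / \<Phi> r) < 2 * \<Phi> r" if r: "1 \<le> r" "r \<notin> (\<Union>n. I n)" for r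
  proof (rule ccontr)
    assume n: "\<not> \<Phi> (r + 1 / \<Phi> r) < 2 * \<Phi> r"
    define n where "n = nat \<lfloor>log 2 (\<Phi> r)\<rfloor>"
    have p: "\<Phi> r \<ge> 1" using ge1 r by auto
    hence l: "log 2 (\<Phi> r) \<ge> 0" by simp
    hence "real n \<le> log 2 (\<Phi> r)" "log 2 (\<Phi> r) < real (n + 1)" unfolding n_def by linarith+
    hence "2 powr real n \<le> \<Phi> r" "\<Phi> r < 2 powr real (n + 1)"
      using p by (simp_all only: le_log_iff log_less_iff)
    hence "2^n \<le> \<Phi> r" "\<Phi> r < 2^(n+1)" by (simp_all only: powr_realpow zero_less_numeral)
    hence "r \<in> X n" using n r by (simp add: X_def)
    thus False using XI r by blast
  qed
  ultimately show ?thesis by blast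
qed

text \<open>In contrast to \<^const>\<open>is_S\<close>, the exceptional set may depend on the statement that is to hold
  eventually.\<close>

definition almost_top :: "real filter" where
  "almost_top = (INF E\<in>lmeasurable. inf at_top (principal (- E)))"

lemma eventually_almost_top:
  "eventually P almost_top \<longleftrightarrow> (\<exists>E\<in>lmeasurable. \<forall>\<^sub>F r in at_top. r \<notin> E \<longrightarrow> P r)"
  unfolding almost_top_def
proof (subst eventually_INF_base)
  fix a b :: "real set" assume "a \<in> lmeasurable" "b \<in> lmeasurable"
  thus "\<exists>x\<in>lmeasurable. inf at_top (principal (- x)) \<le> inf (inf at_top (principal (- a))) (inf at_top (principal (- b)))"
    by (intro bexI[of _ "a \<union> b"]) (auto intro!: le_infI intro: le_infI1 le_infI2)
qed (auto simp: eventually_inf_principal)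

lemma almost_topI:
  assumes "E \<in> lmeasurable" "\<And>r. r \<ge> R \<Longrightarrow> r \<notin> E \<Longrightarrow> P r"
  shows "eventually P almost_top"
  unfolding eventually_almost_top using assms by (auto simp: eventually_at_top_linorder)

lemma eventually_almost_top_ge: "\<forall>\<^sub>F r in almost_top. r \<ge> c"
  by (rule almost_topI[of "{}" c]) auto

lemma eventually_almost_top_countable:
  assumes "countable {r. r > 0 \<and> \<not> P r}"
  shows "eventually P almost_top"
  by (rule almost_topI[of "{r. r > 0 \<and> \<not> P r}" 1])
     (use assms in \<open>auto intro!: negligible_imp_measurable null_sets_completionI countable_imp_null_set_lborel simp: negligible_iff_null_sets\<close>)

lemma eventually_good_circle:
  "nonzero_mero g \<Longrightarrow> eventually (good_circle g) almost_top"
  by (intro eventually_almost_top_countable countable_not_good_circle)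

section \<open>The lemma on the logarithmic derivative\<close>

text \<open>If \<open>x \<le> M\<close> and \<open>M \<ge> 0\<close>, then
  \<open>|x| \<le> 2 M - x\<close>. With \<open>M = ln (2 S)\<close> this reduces the absolute value
  to the known mean of \<open>ln |z - a|\<close>, which is nonnegative because
  \<open>R \<ge> 1\<close>.\<close>

lemma circle_mean_abs_ln_norm_diff_le:
  assumes "R \<ge> 1" "norm a \<noteq> R" "norm a \<le> S" "R \<le> S"
  shows "circle_mean (\<lambda>z. \<bar>ln (norm (z - a))\<bar>) R \<le> 2 * ln (2 * S)"
proof -
  have cont: "continuous_on (sphere 0 R) (\<lambda>z. ln (norm (z - a)))"
    using assms by (intro continuous_intros) auto
  have "circle_mean (\<lambda>z. \<bar>ln (norm (z - a))\<bar>) R \<le> circle_mean (\<lambda>z. 2 * ln (2 * S) - ln (norm (z - a))) R"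
  proof (intro circle_mean_mono continuous_intros cont)
    fix z :: complex assume z: "norm z = R"
    hence za: "norm (z - a) > 0" using assms by auto
    have "norm (z - a) \<le> 2 * S" using norm_triangle_ineq4[of z a] z assms by linarith
    hence "ln (norm (z - a)) \<le> ln (2 * S)" using za assms by (subst ln_le_cancel_iff) auto
    moreover have "ln (2 * S) \<ge> 0" using assms by simp
    ultimately show "\<bar>ln (norm (z - a))\<bar> \<le> 2 * ln (2 * S) - ln (norm (z - a))" by linarith
  qed (use assms in auto)
  also have "\<dots> = 2 * ln (2 * S) - circle_mean (\<lambda>z. ln (norm (z - a))) R"
    using assms cont by (subst circle_mean_diff) auto
  also have "\<dots> = 2 * ln (2 * S) - ln (if norm a < R then R else norm a)"
    using assms by (subst circle_mean_ln_norm_diff) auto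
  also have "\<dots> \<le> 2 * ln (2 * S)" using assms by simp
  finally show ?thesis .
qed

lemma proximity_le_characteristic:
  assumes "g meromorphic_on UNIV" "r \<ge> 1"
  shows "proximity g r \<le> characteristic g r"
  using counting_nonneg[OF assms] by (simp add: characteristic_def)

lemma counting_le_characteristic:
  assumes "regular_circle g r"
  shows "counting g r \<le> characteristic g r"
  using proximity_nonneg[OF assms] by (simp add: characteristic_def)

lemma nonzero_mero_imp_mero: "nonzero_mero g \<Longrightarrow> g meromorphic_on UNIV"
  by (simp add: nonzero_mero_def)

text \<open>\<open>Re L\<close> is \<open>ln |g|\<close> minus the logarithms of the linear factors,
  and the modulus of \<open>ln |g|\<close> is the sum of the positive logarithms of
  \<open>|g|\<close> and \<open>1 / |g|\<close>. This supplies the circle mean in the bound for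
  \<open>deriv L\<close> in terms of the characteristic.\<close>

lemma circle_mean_abs_Re_le:
  assumes g: "nonzero_mero g" and good: "good_circle g R" and R: "R \<ge> 1" "R \<le> S"
    and A: "finite A" "\<And>a. a \<in> A \<Longrightarrow> norm a \<le> S"
    and L: "L holomorphic_on cball 0 R"
    and fact: "\<And>z. norm z = R \<Longrightarrow> z \<notin> A \<and> g z = (\<Prod>a\<in>A. (z - a) powi n a) * exp (L z)"
  shows "circle_mean (\<lambda>z. \<bar>Re (L z)\<bar>) R
    \<le> characteristic g R + characteristic (\<lambda>z. 1 / g z) R + 2 * ln (2 * S) * (\<Sum>a\<in>A. \<bar>real_of_int (n a)\<bar>)"
proof -
  have nA: "norm a \<noteq> R" if "a \<in> A" for a using fact that by blast
  note reg = good_imp_regular[OF good] good_imp_regular[OF good_circle_one_over[OF good]]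
  have cont1: "continuous_on (sphere 0 R) (\<lambda>z. log_plus (norm (g z)))"
              "continuous_on (sphere 0 R) (\<lambda>z. log_plus (norm (1 / g z)))"
    using reg by (auto simp: regular_circle_def intro!: continuous_on_log_plus_norm)
  have cont2: "continuous_on (sphere 0 R) (\<lambda>z. \<bar>ln (norm (z - a))\<bar>)" if "a \<in> A" for a
    using nA[OF that] by (intro continuous_intros) auto
  have contL: "continuous_on (sphere 0 R) (\<lambda>z. \<bar>Re (L z)\<bar>)"
    by (intro continuous_intros holomorphic_on_imp_continuous_on holomorphic_on_subset[OF L]) auto
  have "circle_mean (\<lambda>z. \<bar>Re (L z)\<bar>) R \<le> circle_mean (\<lambda>z. (log_plus (norm (g z)) + log_plus (norm (1 / g z)))
      + (\<Sum>a\<in>A. \<bar>real_of_int (n a)\<bar> * \<bar>ln (norm (z - a))\<bar>)) R"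
  proof (rule circle_mean_mono)
    fix z :: complex assume z: "norm z = R"
    hence gz: "g z \<noteq> 0" using good by (simp add: good_circle_def)
    have "ln (norm (g z)) = (\<Sum>a\<in>A. of_int (n a) * ln (norm (z - a))) + Re (L z)"
      using fact[OF z] by (intro ln_norm_factorization A) auto
    hence "\<bar>Re (L z)\<bar> \<le> \<bar>ln (norm (g z))\<bar> + \<bar>\<Sum>a\<in>A. of_int (n a) * ln (norm (z - a))\<bar>" by linarith
    also have "\<bar>\<Sum>a\<in>A. of_int (n a) * ln (norm (z - a))\<bar> \<le> (\<Sum>a\<in>A. \<bar>of_int (n a) * ln (norm (z - a))\<bar>)"
      by (rule sum_abs)
    also have "\<bar>ln (norm (g z))\<bar> = log_plus (norm (g z)) + log_plus (norm (1 / g z))"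
      using gz by (auto simp: log_plus_def norm_divide ln_div)
    finally show "\<bar>Re (L z)\<bar> \<le> (log_plus (norm (g z)) + log_plus (norm (1 / g z)))
      + (\<Sum>a\<in>A. \<bar>real_of_int (n a)\<bar> * \<bar>ln (norm (z - a))\<bar>)" by (simp add: abs_mult)
  qed (use R in \<open>auto intro!: contL continuous_on_add continuous_on_sum continuous_on_mult_left cont1 cont2\<close>)
  also have "\<dots> = (proximity g R + proximity (\<lambda>z. 1 / g z) R)
      + circle_mean (\<lambda>z. \<Sum>a\<in>A. \<bar>real_of_int (n a)\<bar> * \<bar>ln (norm (z - a))\<bar>) R"
    unfolding proximity_eq_circle_mean[OF reg(1)] proximity_eq_circle_mean[OF reg(2)]
    using R by (subst circle_mean_add)
      (auto intro!: circle_mean_add continuous_on_add continuous_on_sum continuous_on_mult_left cont1 cont2)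
  also have "circle_mean (\<lambda>z. \<Sum>a\<in>A. \<bar>real_of_int (n a)\<bar> * \<bar>ln (norm (z - a))\<bar>) R
     = (\<Sum>a\<in>A. circle_mean (\<lambda>z. \<bar>real_of_int (n a)\<bar> * \<bar>ln (norm (z - a))\<bar>) R)"
    using R by (intro circle_mean_sum continuous_on_mult_left cont2) auto
  also have "\<dots> \<le> (\<Sum>a\<in>A. \<bar>real_of_int (n a)\<bar> * (2 * ln (2 * S)))"
    unfolding circle_mean_cmult using nA A R
    by (intro sum_mono mult_left_mono circle_mean_abs_ln_norm_diff_le) auto
  also have "proximity g R + proximity (\<lambda>z. 1 / g z) R \<le> characteristic g R + characteristic (\<lambda>z. 1 / g z) R"
    using R by (intro add_mono proximity_le_characteristic nonzero_mero_imp_mero nonzero_mero_inverse g)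
  finally show ?thesis by (simp add: sum_distrib_left mult_ac)
qed

text \<open>Each zero or pole with \<open>|a| \<le> S\<close> contributes, per multiplicity, at
  least \<open>ln W - ln S\<close> to \<open>N(W, g) + N(W, 1/g)\<close>.\<close>

lemma sum_abs_zorder_le:
  assumes g: "nonzero_mero g" and W: "good_circle g W" and S: "1 \<le> S" "S < W"
    and A: "finite A" "\<And>a. a \<in> A \<Longrightarrow> norm a \<le> S"
  shows "(\<Sum>a\<in>A. \<bar>real_of_int (zorder g a)\<bar>) * (ln W - ln S)
    \<le> characteristic g W + characteristic (\<lambda>z. 1 / g z) W"
proof -
  have W0: "W > 0" using S by simp
  let ?p = "\<lambda>z. real (pole_order g z)" and ?q = "\<lambda>z. real (pole_order (\<lambda>z. 1 / g z) z)"
  have lf: "loc_finite ?p" "loc_finite ?q"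
    by (intro loc_finite_pole_order' g nonzero_mero_inverse)+
  have eq: "\<bar>real_of_int (zorder g z)\<bar> = ?p z + ?q z" for z
    by (cases "zorder g z \<ge> 0") (simp_all add: pole_order_eq pole_order_one_over g)
  have "(\<Sum>a\<in>A. \<bar>real_of_int (zorder g a)\<bar>) * (ln W - ln S) = (\<Sum>a\<in>A. (?p a + ?q a) * (ln W - ln S))"
    by (simp add: eq sum_distrib_right)
  also have "\<dots> \<le> (\<Sum>a\<in>A. (?p a + ?q a) * (ln W - ln (norm a)))"
  proof (intro sum_mono mult_left_mono)
    fix a assume "a \<in> A"
    hence "ln (norm a) \<le> ln S" using S A(2)[of a] by (cases "a = 0") auto
    thus "ln W - ln S \<le> ln W - ln (norm a)" by simp
  qed auto
  also have "\<dots> \<le> (\<Sum>a\<in>A \<union> {z. norm z \<le> W \<and> ?p z + ?q z \<noteq> 0}. (?p a + ?q a) * (ln W - ln (norm a)))"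
    using A S by (intro sum_mono2 finite_UnI loc_finiteD[OF loc_finite_add[OF lf]] mult_nonneg_nonneg ln_diff_nonneg) auto
  also have "\<dots> = int_count (\<lambda>z. ?p z + ?q z) W"
    using A S by (intro int_count_superset[symmetric] finite_UnI loc_finiteD[OF loc_finite_add[OF lf]]) force+
  also have "\<dots> = counting g W + counting (\<lambda>z. 1 / g z) W"
    by (simp add: int_count_add lf counting_eq W0 nonzero_mero_imp_mero g nonzero_mero_inverse)
  also have "\<dots> \<le> characteristic g W + characteristic (\<lambda>z. 1 / g z) W"
    by (intro add_mono counting_le_characteristic good_imp_regular good_circle_one_over W)
  finally show ?thesis .
qed

lemma ln_diff_ge_ratio:
  assumes "0 < S" "S < (W::real)"
  shows "(W - S) / W \<le> ln W - ln S"
proof -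
  have "ln (S / W) \<le> S / W - 1" using assms by (intro ln_le_minus_one) auto
  thus ?thesis using assms by (simp add: ln_div diff_divide_distrib)
qed

lemma sqrt_sum_le: "(\<And>i. i \<in> I \<Longrightarrow> f i \<ge> 0) \<Longrightarrow> sqrt (sum f I) \<le> (\<Sum>i\<in>I. sqrt (f i))"
proof (induction I rule: infinite_finite_induct)
  case (insert i I)
  thus ?case using sqrt_add_le_add_sqrt[of "f i" "sum f I"] by (auto simp: sum_nonneg)
qed auto

text \<open>Jensen's inequality, by comparison with the tangent of the logarithm at \<open>1 + M\<close>.\<close>

lemma circle_mean_ln_le:
  assumes u: "continuous_on (sphere 0 r) u" "r \<ge> 0" "\<And>z. norm z = r \<Longrightarrow> u z \<ge> 0"
    and M: "circle_mean u r \<le> M"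
  shows "circle_mean (\<lambda>z. ln (1 + u z)) r \<le> ln (1 + M)"
proof -
  have M0: "M \<ge> 0" using circle_mean_nonneg[OF u] M by simp
  have pos: "1 + u z > 0" if "norm z = r" for z using u(3)[OF that] by simp
  have "circle_mean (\<lambda>z. ln (1 + u z)) r \<le> circle_mean (\<lambda>z. (1 / (1 + M)) * u z + (1 / (1 + M) + ln (1 + M) - 1)) r"
  proof (rule circle_mean_mono)
    show "continuous_on (sphere 0 r) (\<lambda>z. ln (1 + u z))"
      using pos by (intro continuous_intros u) (auto, force)
    fix z :: complex assume "norm z = r"
    hence uz: "1 + u z > 0" by (rule pos)
    have "ln ((1 + u z) / (1 + M)) \<le> (1 + u z) / (1 + M) - 1"
      using M0 uz by (intro ln_le_minus_one) auto
    moreover have "ln ((1 + u z) / (1 + M)) = ln (1 + u z) - ln (1 + M)"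
      using M0 uz ln_div[of "1 + u z" "1 + M"] by simp
    ultimately show "ln (1 + u z) \<le> (1 / (1 + M)) * u z + (1 / (1 + M) + ln (1 + M) - 1)"
      by (simp add: add_divide_distrib)
  qed (use M0 in \<open>auto intro!: continuous_intros u\<close>)
  also have "\<dots> = (1 / (1 + M)) * circle_mean u r + (1 / (1 + M) + ln (1 + M) - 1)"
    using u by (subst circle_mean_add)
      (auto intro!: continuous_on_mult_left simp del: times_divide_eq_left)
  also have "\<dots> \<le> (1 / (1 + M)) * M + (1 / (1 + M) + ln (1 + M) - 1)"
    using M M0 by (intro add_right_mono mult_left_mono) auto
  also have "(1 / (1 + M)) * M + 1 / (1 + M) = 1" using M0 by (simp add: field_simps)
  hence "(1 / (1 + M)) * M + (1 / (1 + M) + ln (1 + M) - 1) = ln (1 + M)" by linarith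
  finally show ?thesis .
qed

text \<open>The square root turns the singularities \<open>1 / |z - a|\<close> of a logarithmic
  derivative into integrable ones, and the shift by 1 makes the concavity argument for the logarithm
  applicable.\<close>

lemma log_plus_le_sqrt:
  assumes "x \<ge> 0"
  shows "log_plus x \<le> 2 * ln (1 + sqrt x)"
proof (cases "x \<le> 1")
  case True
  thus ?thesis using assms by (cases "x = 0") (auto simp: log_plus_def)
next
  case False
  have "log_plus x = ln (sqrt x ^ 2)" using False by (simp add: log_plus_def)
  also have "\<dots> = 2 * ln (sqrt x)" using False by (subst ln_realpow) auto
  also have "\<dots> \<le> 2 * ln (1 + sqrt x)" using False by (intro mult_left_mono) (auto simp: ln_le_cancel_iff add_pos_pos)
  finally show ?thesis .
qed

lemma good_circle_regular_logderiv:
  assumes "good_circle g r"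
  shows "regular_circle (\<lambda>z. deriv g z / g z) r"
proof -
  have "(\<lambda>z. deriv g z / g z) analytic_on {z}" if "norm z = r" for z
    using that assms by (auto simp: good_circle_def intro!: analytic_intros analytic_deriv)
  thus ?thesis using assms analytic_at_imp_isCont unfolding regular_circle_def good_circle_def
    by (auto intro!: continuous_at_imp_continuous_on)
qed

text \<open>Logarithmic differentiation of the factorization on \<open>|z| < S\<close> gives
  \<open>g'/g\<close> as the sum of \<open>n(a) / (z - a)\<close> plus \<open>L'\<close>. The circle
  \<open>R\<close> controls \<open>L'\<close> through \<open>Re L\<close>, and the circle
  \<open>W\<close> controls the number of zeros and poles in the disc. Here \<open>t\<close> bounds
  \<open>T(W, g) + T(W, 1/g)\<close> and \<open>n\<close> bounds that number, with
  multiplicity.\<close>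

lemma proximity_logderiv_bound:
  assumes g: "nonzero_mero g"
  shows "\<exists>C>0. \<exists>K\<ge>0. \<forall>r R S W. good_circle g r \<longrightarrow> good_circle g R \<longrightarrow> good_circle g W \<longrightarrow>
     1 \<le> r \<longrightarrow> r < R \<longrightarrow> R < S \<longrightarrow> S < W \<longrightarrow>
     (let t = 2 * characteristic g W + K; n = t * W / (W - S) in
      proximity (\<lambda>z. deriv g z / g z) r \<le> 2 * ln (2 + C * n + 2 * R / (R - r)^2 * (t + 4 * S * n)))"
proof -
  obtain C where C: "C > 0" "\<And>r a. r \<ge> 1 \<Longrightarrow> norm a \<noteq> r \<Longrightarrow> circle_mean (\<lambda>z. 1 / sqrt (norm (z - a))) r \<le> C"
    using circle_mean_inverse_sqrt_bounded by blast
  obtain K0 where K0: "\<And>r. good_circle g r \<Longrightarrow> characteristic (\<lambda>z. 1 / g z) r = characteristic g r + K0"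
    using first_main_theorem[OF g] by blast
  show ?thesis
  proof (rule exI[of _ C], rule conjI[OF C(1)], rule exI[of _ "\<bar>K0\<bar>"], intro conjI allI impI)
    fix r R S W
    assume good: "good_circle g r" "good_circle g R" "good_circle g W" and r1: "1 \<le> r" and lt: "r < R" "R < S" "S < W"
    define t where "t = 2 * characteristic g W + \<bar>K0\<bar>"
    define n where "n = t * W / (W - S)"
    define A where "A = {z \<in> ball 0 S. zorder g z \<noteq> 0}"
    define N where "N = (\<Sum>a\<in>A. \<bar>real_of_int (zorder g a)\<bar>)"
    define M where "M = 2 * R / (R - r)^2 * (t + 4 * S * n)"
    have A: "finite A" unfolding A_def by (rule finite_zorder_ball[OF g])
    have AS: "norm a \<le> S" if "a \<in> A" for a using that by (auto simp: A_def)
    obtain L where L: "L holomorphic_on ball 0 S"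
      "\<And>z. z \<in> ball 0 S \<Longrightarrow> g analytic_on {z} \<Longrightarrow> g z \<noteq> 0 \<Longrightarrow>
         z \<notin> A \<and> g z = (\<Prod>a\<in>A. (z - a) powi zorder g a) * exp (L z)"
      using mero_factorization[OF g open_ball convex_ball A_def A] by blast
    have N0: "N \<ge> 0" by (simp add: N_def sum_nonneg)
    have "N * ((W - S) / W) \<le> N * (ln W - ln S)"
      using N0 lt r1 by (intro mult_left_mono ln_diff_ge_ratio) auto
    also have "\<dots> \<le> characteristic g W + characteristic (\<lambda>z. 1 / g z) W"
      unfolding N_def using lt r1 AS by (intro sum_abs_zorder_le g good A) auto
    also have "\<dots> \<le> t" using K0[OF good(3)] by (simp add: t_def)
    finally have Nn: "N \<le> n" using lt r1 by (simp add: n_def field_simps)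
    have mono: "characteristic g R \<le> characteristic g W"
      using lt by (intro characteristic_mono g good) auto
    have LR: "L holomorphic_on cball 0 R" using lt by (intro holomorphic_on_subset[OF L(1)]) auto
    have "circle_mean (\<lambda>z. \<bar>Re (L z)\<bar>) R
       \<le> characteristic g R + characteristic (\<lambda>z. 1 / g z) R + 2 * ln (2 * S) * N"
      unfolding N_def using lt r1 good(2) L(2) AS
      by (intro circle_mean_abs_Re_le[OF g] good A LR) (auto simp: good_circle_def)
    also have "characteristic g R + characteristic (\<lambda>z. 1 / g z) R \<le> t"
      using K0[OF good(2)] mono by (simp add: t_def)
    also have "2 * ln (2 * S) * N \<le> 4 * S * n"
    proof (rule mult_mono)
      \<comment> \<open>A generous bound: the whole expression ends up under a logarithm.\<close>
      show "2 * ln (2 * S) \<le> 4 * S" using lt r1 ln_le_minus_one[of "2 * S"] by simp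
    qed (use Nn N0 lt r1 in auto)
    finally have mL: "circle_mean (\<lambda>z. \<bar>Re (L z)\<bar>) R \<le> t + 4 * S * n" by simp
    have dL: "norm (deriv L z) \<le> M" if z: "norm z = r" for z
    proof -
      have "norm (deriv L z) \<le> 2 * R / (R - norm z)^2 * circle_mean (\<lambda>w. \<bar>Re (L w)\<bar>) R"
        using z lt by (intro norm_deriv_le_circle_mean LR) auto
      also have "\<dots> \<le> M" unfolding M_def z using mL r1 lt by (intro mult_left_mono) auto
      finally show ?thesis .
    qed
    have M0: "M \<ge> 0" using order.trans[OF norm_ge_zero dL[of "of_real r"]] r1 by simp
    have nA: "norm a \<noteq> r" if "a \<in> A" for a
      using L(2)[of a] that good(1) lt by (auto simp: good_circle_def)
    let ?u = "\<lambda>z. sqrt (norm (deriv g z / g z))"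
    have reg: "regular_circle (\<lambda>z. deriv g z / g z) r" by (rule good_circle_regular_logderiv[OF good(1)])
    hence contu: "continuous_on (sphere 0 r) ?u"
      by (auto simp: regular_circle_def intro!: continuous_on_real_sqrt continuous_on_norm)
    have conta: "continuous_on (sphere 0 r) (\<lambda>z. 1 / sqrt (norm (z - a)))" if "a \<in> A" for a
      using nA[OF that] by (intro continuous_intros) auto
    have "circle_mean ?u r \<le> circle_mean (\<lambda>z. (\<Sum>a\<in>A. \<bar>real_of_int (zorder g a)\<bar> * (1 / sqrt (norm (z - a)))) + (1 + M)) r"
    proof (rule circle_mean_mono)
      fix z :: complex assume z: "norm z = r"
      have zS: "z \<in> ball 0 S" "g analytic_on {z}" "g z \<noteq> 0" using z good(1) lt by (auto simp: good_circle_def)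
      have "deriv g z / g z = (\<Sum>a\<in>A. of_int (zorder g a) / (z - a)) + deriv L z"
        by (rule deriv_over_factorization[OF open_ball zS(1) A L(1) _ zS(2,3)]) (use L(2) in blast)
      hence "norm (deriv g z / g z) \<le> norm (\<Sum>a\<in>A. of_int (zorder g a) / (z - a)) + norm (deriv L z)"
        by (simp add: norm_triangle_ineq)
      also have "\<dots> \<le> (\<Sum>a\<in>A. norm (of_int (zorder g a) / (z - a))) + M"
        by (intro add_mono norm_sum dL z)
      finally have "?u z \<le> sqrt ((\<Sum>a\<in>A. norm (of_int (zorder g a) / (z - a))) + M)" by simp
      also have "\<dots> \<le> sqrt (\<Sum>a\<in>A. norm (of_int (zorder g a) / (z - a))) + sqrt M"
        using M0 by (intro sqrt_add_le_add_sqrt sum_nonneg) auto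
      also have "sqrt M \<le> 1 + M"
        using M0 by (intro real_le_lsqrt) (auto simp: power2_eq_square algebra_simps)
      also have "sqrt (\<Sum>a\<in>A. norm (of_int (zorder g a) / (z - a))) \<le> (\<Sum>a\<in>A. sqrt (norm (of_int (zorder g a) / (z - a))))"
        by (intro sqrt_sum_le) auto
      also have "\<dots> \<le> (\<Sum>a\<in>A. \<bar>real_of_int (zorder g a)\<bar> * (1 / sqrt (norm (z - a))))"
      proof (rule sum_mono)
        fix a
        have "sqrt \<bar>real_of_int (zorder g a)\<bar> \<le> \<bar>real_of_int (zorder g a)\<bar>"
        proof (cases "zorder g a = 0")
          case False
          hence "1 \<le> \<bar>real_of_int (zorder g a)\<bar>" by linarith
          from mult_left_mono[OF this, of "\<bar>real_of_int (zorder g a)\<bar>"]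
          show ?thesis by (intro real_le_lsqrt) (auto simp: power2_eq_square)
        qed auto
        thus "sqrt (norm (of_int (zorder g a) / (z - a))) \<le> \<bar>real_of_int (zorder g a)\<bar> * (1 / sqrt (norm (z - a)))"
          by (simp add: norm_divide real_sqrt_divide divide_right_mono)
      qed
      finally show "?u z \<le> (\<Sum>a\<in>A. \<bar>real_of_int (zorder g a)\<bar> * (1 / sqrt (norm (z - a)))) + (1 + M)" by simp
    qed (use r1 in \<open>auto intro!: contu continuous_on_add continuous_on_sum continuous_on_mult_left conta simp del: times_divide_eq_right\<close>)
    also have "\<dots> = circle_mean (\<lambda>z. \<Sum>a\<in>A. \<bar>real_of_int (zorder g a)\<bar> * (1 / sqrt (norm (z - a)))) r + (1 + M)"
      using r1 by (subst circle_mean_add) (auto intro!: continuous_on_sum continuous_on_mult_left conta simp del: times_divide_eq_right)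
    also have "circle_mean (\<lambda>z. \<Sum>a\<in>A. \<bar>real_of_int (zorder g a)\<bar> * (1 / sqrt (norm (z - a)))) r
       = (\<Sum>a\<in>A. circle_mean (\<lambda>z. \<bar>real_of_int (zorder g a)\<bar> * (1 / sqrt (norm (z - a)))) r)"
      using r1 by (intro circle_mean_sum continuous_on_mult_left conta) auto
    also have "\<dots> \<le> (\<Sum>a\<in>A. \<bar>real_of_int (zorder g a)\<bar> * C)"
      unfolding circle_mean_cmult using r1 nA by (intro sum_mono mult_left_mono C) auto
    also have "\<dots> \<le> C * n" using mult_right_mono[OF Nn, of C] C(1) unfolding N_def sum_distrib_right by (simp add: mult.commute)
    finally have mu: "circle_mean ?u r \<le> C * n + (1 + M)" by simp
    have u0: "?u z \<ge> 0" for z by simp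
    have "proximity (\<lambda>z. deriv g z / g z) r \<le> circle_mean (\<lambda>z. 2 * ln (1 + ?u z)) r"
      unfolding proximity_eq_circle_mean[OF reg]
    proof (rule circle_mean_mono)
      show "continuous_on (sphere 0 r) (\<lambda>z. log_plus (norm (deriv g z / g z)))"
        using reg by (auto simp: regular_circle_def intro!: continuous_on_log_plus_norm)
      have "1 + ?u z \<noteq> 0" for z using u0[of z] by linarith
      thus "continuous_on (sphere 0 r) (\<lambda>z. 2 * ln (1 + ?u z))"
        by (intro continuous_on_mult_left continuous_on_ln continuous_on_add continuous_on_const contu) auto
    qed (use r1 in \<open>auto intro!: log_plus_le_sqrt\<close>)
    also have "\<dots> = 2 * circle_mean (\<lambda>z. ln (1 + ?u z)) r" by (rule circle_mean_cmult)
    also have "\<dots> \<le> 2 * ln (1 + (C * n + (1 + M)))"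
      using r1 by (intro mult_left_mono circle_mean_ln_le contu mu) auto
    finally have "proximity (\<lambda>z. deriv g z / g z) r \<le> 2 * ln (2 + C * n + M)"
      by (simp add: add_ac)
    thus "let t = 2 * characteristic g W + \<bar>K0\<bar>; n = t * W / (W - S) in
      proximity (\<lambda>z. deriv g z / g z) r \<le> 2 * ln (2 + C * n + 2 * R / (R - r)^2 * (t + 4 * S * n))"
      unfolding Let_def M_def n_def t_def .
  qed (use C in auto)
qed

theorem logarithmic_derivative_lemma:
  assumes g: "nonzero_mero g"
  shows "\<exists>B\<ge>0. \<forall>\<^sub>F r in almost_top.
     proximity (\<lambda>z. deriv g z / g z) r \<le> B * (1 + ln r + ln (characteristic g r + 2))"
proof -
  obtain C K where CK: "C > 0" "K \<ge> 0" and bound: "\<And>r R S W. good_circle g r \<Longrightarrow> good_circle g R \<Longrightarrow> good_circle g W \<Longrightarrow>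
     1 \<le> r \<Longrightarrow> r < R \<Longrightarrow> R < S \<Longrightarrow> S < W \<Longrightarrow>
     (let t = 2 * characteristic g W + K; n = t * W / (W - S) in
      proximity (\<lambda>z. deriv g z / g z) r \<le> 2 * ln (2 + C * n + 2 * R / (R - r)^2 * (t + 4 * S * n)))"
    using proximity_logderiv_bound[OF g] by blast
  let ?T = "characteristic g"
  \<comment> \<open>The growth lemma needs a function monotone on all radii, whereas the
    characteristic is known to be monotone only along good circles. The infimum over later good
    circles is monotone and agrees with \<open>?T r + 2\<close> at good \<open>r\<close>; the
    summand 2 keeps it away from 0.\<close>
  define X where "X = (\<lambda>r. {?T s + 2 | s. r \<le> s \<and> good_circle g s})"
  define \<Phi> where "\<Phi> = (\<lambda>r. Inf (X r))"
  have T0: "?T s \<ge> 0" if "good_circle g s" "s \<ge> 1" for s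
    using that by (intro characteristic_nonneg nonzero_mero_imp_mero g good_imp_regular)
  have ne: "X r \<noteq> {}" if "r \<ge> 1" for r
    using exists_good_circle[OF g, of r "r + 1"] that by (fastforce simp: X_def)
  have X2: "x \<ge> 2" if "x \<in> X r" "r \<ge> 1" for x r
    using that T0 by (force simp: X_def)
  hence bdd: "bdd_below (X r)" if "r \<ge> 1" for r using that by (auto simp: bdd_below_def)
  have \<Phi>2: "\<Phi> r \<ge> 2" if "r \<ge> 1" for r
    unfolding \<Phi>_def using ne[OF that] X2 that by (intro cInf_greatest) auto
  have mono: "\<Phi> r \<le> \<Phi> s" if "1 \<le> r" "r \<le> s" for r s
    unfolding \<Phi>_def using that by (intro cInf_superset_mono ne bdd) (auto simp: X_def)
  have \<Phi>_good: "\<Phi> r = ?T r + 2" if "good_circle g r" "r \<ge> 1" for r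
    unfolding \<Phi>_def
  proof (rule cInf_eq_minimum)
    fix x assume "x \<in> X r"
    then obtain s where "x = ?T s + 2" "r \<le> s" "good_circle g s" by (auto simp: X_def)
    thus "?T r + 2 \<le> x" using characteristic_mono[OF g that(1)] by (cases "r = s") auto
  qed (use that in \<open>auto simp: X_def\<close>)
  obtain E where E: "E \<in> lmeasurable" "\<And>r. r \<ge> 1 \<Longrightarrow> r \<notin> E \<Longrightarrow> \<Phi> (r + 1 / \<Phi> r) < 2 * \<Phi> r"
    using Borel_growth_lemma[of \<Phi>] mono \<Phi>2 by force
  define a where "a = 4 + K"
  \<comment> \<open>The summands come from the estimates below: \<open>n \<le> 12 a r F^2\<close>,
    and \<open>13968 = 4 * 36 * 97\<close>, where 97 is \<open>1 + 4 * 2 * 12\<close> from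
    \<open>t + 4 S n\<close>.\<close>
  define b where "b = 2 + 12 * a * C + 13968 * a"
  have a0: "a > 0" using CK by (simp add: a_def)
  have b0: "b \<ge> 2" using a0 CK by (simp add: b_def)
  have ev: "\<forall>\<^sub>F r in almost_top. \<Phi> (r + 1 / \<Phi> r) < 2 * \<Phi> r"
    by (rule almost_topI[OF E(1), of 1]) (rule E(2))
  show ?thesis
  proof (intro exI[of _ "2 * (ln b + 4)"] conjI)
    show "2 * (ln b + 4) \<ge> 0" using b0 by simp
    show "\<forall>\<^sub>F r in almost_top. proximity (\<lambda>z. deriv g z / g z) r \<le> 2 * (ln b + 4) * (1 + ln r + ln (?T r + 2))"
      using ev eventually_good_circle[OF g] eventually_almost_top_ge[of 1]
    proof eventually_elim
      case (elim r)
      note good = elim(2) and r1 = elim(3)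
      define F where "F = \<Phi> r"
      \<comment> \<open>The step length of the growth lemma. The radii \<open>R < S < W\<close> are
        placed in the interval from \<open>r\<close> to \<open>r + \<delta>\<close> with
        \<open>R - r\<close> and \<open>W - S\<close> at least \<open>\<delta> / 6\<close>, so the
        denominators cost only powers of \<open>F\<close>.\<close>
      define \<delta> where "\<delta> = 1 / F"
      have F2: "F \<ge> 2" and FT: "F = ?T r + 2" unfolding F_def using \<Phi>2[OF r1] \<Phi>_good[OF good r1] by simp_all
      have \<delta>: "\<delta> > 0" "\<delta> \<le> 1" using F2 by (auto simp: \<delta>_def)
      obtain R where R: "r + \<delta> / 6 < R" "R < r + 2 * \<delta> / 6" "good_circle g R"
        using exists_good_circle[OF g, of "r + \<delta> / 6" "r + 2 * \<delta> / 6"] r1 \<delta> by auto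
      define S where "S = r + 3 * \<delta> / 6"
      obtain W where W: "r + 5 * \<delta> / 6 < W" "W < r + \<delta>" "good_circle g W"
        using exists_good_circle[OF g, of "r + 5 * \<delta> / 6" "r + \<delta>"] r1 \<delta> by auto
      have ord: "r < R" "R < S" "S < W" and gap: "\<delta> / 6 \<le> R - r" "\<delta> / 6 \<le> W - S"
        and up: "W \<le> 2 * r" "R \<le> 2 * r" "S \<le> 2 * r" and W1: "W \<ge> 1"
        using R W \<delta> r1 by (auto simp: S_def)
      \<comment> \<open>Monotonicity and the growth lemma replace the characteristic at the larger
        radius by a multiple of the one at \<open>r\<close>.\<close>
      have "?T W + 2 = \<Phi> W" using \<Phi>_good[OF W(3) W1] by simp
      also have "\<dots> \<le> \<Phi> (r + 1 / \<Phi> r)"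
        using W W1 by (intro mono) (auto simp: \<delta>_def F_def)
      also have "\<dots> < 2 * F" using elim(1) by (simp add: F_def)
      finally have TW: "?T W \<le> 2 * F" by simp
      define t where "t = 2 * ?T W + K"
      define n where "n = t * W / (W - S)"
      define M where "M = 2 * R / (R - r)^2 * (t + 4 * S * n)"
      have t0: "t \<ge> 0" using T0[OF W(3) W1] CK by (simp add: t_def)
      have n0: "n \<ge> 0" using t0 W1 ord by (simp add: n_def)
      have M0: "M \<ge> 0" using t0 n0 r1 ord by (simp add: M_def)
      have "t \<le> 4 * F + K" using TW by (simp add: t_def)
      also have "K \<le> K * F" using F2 CK mult_left_mono[of 1 F K] by simp
      finally have t_le: "t \<le> a * F" by (simp add: a_def algebra_simps)
      have inv: "1 / (W - S) \<le> 6 * F"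
      proof -
        have "1 / (W - S) \<le> 1 / (\<delta> / 6)" using gap \<delta> ord by (intro divide_left_mono) auto
        thus ?thesis by (simp add: \<delta>_def)
      qed
      have inv2: "1 / (R - r)^2 \<le> (6 * F)^2"
      proof -
        have "1 / (R - r) \<le> 1 / (\<delta> / 6)" using gap \<delta> ord by (intro divide_left_mono) auto
        hence "(1 / (R - r))^2 \<le> (6 * F)^2" using ord by (intro power_mono) (auto simp: \<delta>_def)
        thus ?thesis by (simp add: power_divide)
      qed
      have "n = t * W * (1 / (W - S))" by (simp add: n_def)
      also have "\<dots> \<le> (a * F) * (2 * r) * (6 * F)"
        using t_le inv up t0 W1 ord r1 a0 F2 by (intro mult_mono mult_nonneg_nonneg) auto
      finally have n_le: "n \<le> 12 * a * r * F^2" by (simp add: power2_eq_square mult_ac)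
      have r2: "1 \<le> r^2" and rr: "r \<le> r^3" using r1 by (auto simp: power_increasing[of 1 3 r, simplified])
      have F24: "F^2 \<le> F^4" and FF: "F \<le> F^2" "1 \<le> F^4"
        using F2 power_increasing[of 1 2 F] power_increasing[of 2 4 F] by auto
      have "t + 4 * S * n \<le> a * F + 4 * (2 * r) * (12 * a * r * F^2)"
        using t_le up n_le n0 r1 a0 ord by (intro add_mono mult_mono) auto
      also have "a * F \<le> a * (r^2 * F^2)"
        using a0 mult_mono[OF r2 FF(1)] F2 by (intro mult_left_mono) auto
      finally have tn: "t + 4 * S * n \<le> 97 * a * r^2 * F^2" by (simp add: power2_eq_square mult_ac)
      have "M = 2 * R * (1 / (R - r)^2) * (t + 4 * S * n)" by (simp add: M_def)
      also have "\<dots> \<le> (2 * (2 * r)) * (6 * F)^2 * (97 * a * r^2 * F^2)"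
        using tn inv2 up t0 n0 r1 a0 ord F2 by (intro mult_mono mult_nonneg_nonneg add_nonneg_nonneg) auto
      also have "\<dots> = 13968 * a * r^3 * F^4" by (simp add: eval_nat_numeral mult_ac)
      finally have M_le: "M \<le> 13968 * a * (r^3 * F^4)" by (simp add: mult_ac)
      have "C * n \<le> C * (12 * a * (r^3 * F^4))"
      proof -
        have "r * F^2 \<le> r^3 * F^4" using rr F24 r1 F2 by (intro mult_mono) auto
        hence "12 * a * (r * F^2) \<le> 12 * a * (r^3 * F^4)" using a0 by (intro mult_left_mono) auto
        thus ?thesis using n_le CK by (intro mult_left_mono) (auto simp: mult_ac)
      qed
      moreover have "1 \<le> r^3 * F^4" using mult_mono[of 1 "r^3" 1 "F^4"] rr r1 FF by auto
      ultimately have "2 + C * n + M \<le> 2 * (r^3 * F^4) + C * (12 * a * (r^3 * F^4)) + 13968 * a * (r^3 * F^4)"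
        using M_le by linarith
      also have "\<dots> = b * (r^3 * F^4)" by (simp add: b_def algebra_simps)
      finally have le: "2 + C * n + M \<le> b * (r^3 * F^4)" .
      have "proximity (\<lambda>z. deriv g z / g z) r \<le> 2 * ln (2 + C * n + M)"
        using bound[OF good R(3) W(3) r1 ord] unfolding Let_def M_def n_def t_def .
      also have "\<dots> \<le> 2 * ln (b * (r^3 * F^4))"
      proof -
        have "0 \<le> C * n" using CK n0 by simp
        hence "0 < 2 + C * n + M" using M0 by linarith
        thus ?thesis using le by (intro mult_left_mono) (simp_all add: ln_mono)
      qed
      also have "\<dots> = 2 * (ln b + 3 * ln r + 4 * ln F)"
        using b0 r1 F2 by (simp add: ln_mult ln_realpow)
      also have "\<dots> \<le> 2 * ((ln b + 4) * (1 + ln r + ln F))"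
      proof -
        have "ln b \<ge> 0" "ln r \<ge> 0" "ln F \<ge> 0" using b0 r1 F2 by auto
        hence "ln b * ln r \<ge> 0" "ln b * ln F \<ge> 0" "ln r \<ge> 0" by auto
        thus ?thesis by (simp add: algebra_simps)
      qed
      finally show ?case by (simp only: FT mult.assoc)
    qed
  qed
qed

section \<open>Growth of transcendental functions\<close>

lemma transcendental_imp_nonzero_mero:
  assumes "transcendental_meromorphic f"
  shows "nonzero_mero f"
proof (rule nonzero_mero_if_frequently)
  show "f meromorphic_on UNIV" using assms by (simp add: transcendental_meromorphic_def)
  show "\<not> (\<forall>\<^sub>\<approx>z. f z = 0)"
  proof
    assume "\<forall>\<^sub>\<approx>z. f z = 0"
    hence "\<forall>\<^sub>\<approx>z. f z = poly 0 z / poly 1 z" by simp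
    hence "rational_fun f" unfolding rational_fun_def by (metis one_neq_zero)
    thus False using assms by (simp add: transcendental_meromorphic_def)
  qed
qed

lemma rational_if_powi_product:
  assumes "finite A" "\<forall>\<^sub>\<approx>z. z \<notin> A \<and> f z = (\<Prod>a\<in>A. (z - a) powi n a) * c"
  shows "rational_fun f"
  unfolding rational_fun_def
proof (intro exI conjI)
  let ?p = "[:c:] * (\<Prod>a\<in>A. [:-a, 1:] ^ nat (n a))" and ?q = "\<Prod>a\<in>A. [:-a, 1:] ^ nat (- n a)"
  show "?q \<noteq> 0" using assms(1) by simp
  show "\<forall>\<^sub>\<approx>z. f z = poly ?p z / poly ?q z"
    using assms(2)
  proof eventually_elim
    case (elim z)
    have "(z - a) powi n a = (z - a) ^ nat (n a) / (z - a) ^ nat (- n a)" for a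
      by (auto simp: power_int_def field_simps)
    thus ?case using elim
      by (simp add: poly_prod poly_power prod_dividef mult.commute)
  qed
qed

text \<open>If \<open>T(r, f) < K ln r\<close> for arbitrarily large \<open>r\<close>, there are finitely many zeros and poles, so that
  \<open>f = R exp L\<close> with \<open>R\<close> rational, and the bound on the circle means of \<open>\<bar>Re L\<bar>\<close> forces \<open>L' = 0\<close>.\<close>

theorem transcendental_growth:
  assumes f: "transcendental_meromorphic f"
  shows "\<exists>R. \<forall>r\<ge>R. good_circle f r \<longrightarrow> K * ln r \<le> characteristic f r"
proof (rule ccontr)
  assume neg: "\<not> ?thesis"
  have nf: "nonzero_mero f" by (rule transcendental_imp_nonzero_mero[OF f])
  obtain K0 where K0: "\<And>r. good_circle f r \<Longrightarrow> characteristic (\<lambda>z. 1 / f z) r = characteristic f r + K0"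
    using first_main_theorem[OF nf] by blast
  define C where "C = 2 * \<bar>K\<bar> + \<bar>K0\<bar>"
  have C0: "C \<ge> 0" by (simp add: C_def)
  \<comment> \<open>Radii \<open>r \<ge> 3\<close> have \<open>ln r \<ge> 1\<close>, so the additive
    constant of the first main theorem is absorbed into the factor of \<open>ln r\<close>.\<close>
  have ex: "\<exists>r\<ge>R. good_circle f r \<and> characteristic f r + characteristic (\<lambda>z. 1 / f z) r \<le> C * ln r" for R
  proof -
    obtain r where r: "r \<ge> max R 3" "good_circle f r" "characteristic f r < K * ln r"
      using neg by (meson not_le)
    have "exp 1 \<le> r" using r(1) exp_le by linarith
    hence ln1: "ln r \<ge> 1" using r(1) by (subst ln_ge_iff) auto
    have "K * ln r \<le> \<bar>K\<bar> * ln r" using ln1 by (intro mult_right_mono) auto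
    moreover have "K0 \<le> \<bar>K0\<bar> * ln r" using mult_left_mono[OF ln1, of "\<bar>K0\<bar>"] by simp
    ultimately have "characteristic f r + characteristic (\<lambda>z. 1 / f z) r \<le> C * ln r"
      using r(3) K0[OF r(2)] by (simp add: C_def algebra_simps)
    thus ?thesis using r by auto
  qed
  define A where "A = {z. zorder f z \<noteq> 0}"
  have "finite A \<and> card A \<le> nat \<lceil>2 * C\<rceil>"
  proof (rule finite_if_finite_subsets_card_bdd)
    fix G assume G: "G \<subseteq> A" "finite G"
    obtain S0 where S0: "\<And>a. a \<in> G \<Longrightarrow> norm a \<le> S0"
      using finite_imp_bounded[OF G(2)] by (auto simp: bounded_iff)
    define S where "S = max S0 2"
    have S: "S \<ge> 2" "\<And>a. a \<in> G \<Longrightarrow> norm a \<le> S" using S0 by (force simp: S_def)+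
    \<comment> \<open>With \<open>r \<ge> S^2\<close> the factor \<open>ln r - ln S\<close> is at
      least \<open>ln r / 2\<close>. The factor \<open>ln r\<close> then cancels and leaves the
      bound \<open>2 C\<close>, independent of \<open>G\<close>.\<close>
    obtain r where r: "r \<ge> S^2" "good_circle f r" "characteristic f r + characteristic (\<lambda>z. 1 / f z) r \<le> C * ln r"
      using ex by blast
    have "S < S^2" using S by (simp add: power2_eq_square)
    hence Sr: "S < r" using r by linarith
    have "ln (S^2) \<le> ln r" using r S Sr by (subst ln_le_cancel_iff) auto
    hence lnS: "2 * ln S \<le> ln r" using S by (simp add: ln_realpow)
    have lnr: "ln r > 0" using Sr S by simp
    have "real (card G) = (\<Sum>a\<in>G. 1)" by simp
    also have "\<dots> \<le> (\<Sum>a\<in>G. \<bar>real_of_int (zorder f a)\<bar>)"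
      using G by (intro sum_mono) (force simp: A_def)
    finally have cG: "real (card G) \<le> (\<Sum>a\<in>G. \<bar>real_of_int (zorder f a)\<bar>)" .
    have "real (card G) * (ln r / 2) \<le> (\<Sum>a\<in>G. \<bar>real_of_int (zorder f a)\<bar>) * (ln r - ln S)"
      using cG lnS lnr by (intro mult_mono) auto
    also have "\<dots> \<le> C * ln r"
      using sum_abs_zorder_le[OF nf r(2) _ Sr G(2) S(2)] S r(3) by simp
    finally have "real (card G) \<le> 2 * C" using lnr by (simp add: field_simps)
    thus "card G \<le> nat \<lceil>2 * C\<rceil>" by linarith
  qed
  hence A: "finite A" ..
  obtain L where L: "L holomorphic_on UNIV"
    "\<And>z. f analytic_on {z} \<Longrightarrow> f z \<noteq> 0 \<Longrightarrow> z \<notin> A \<and> f z = (\<Prod>a\<in>A. (z - a) powi zorder f a) * exp (L z)"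
    using mero_factorization[OF nf open_UNIV convex_UNIV _ A] by (auto simp: A_def)
  obtain S0 where S0: "\<And>a. a \<in> A \<Longrightarrow> norm a \<le> S0"
    using finite_imp_bounded[OF A] by (auto simp: bounded_iff)
  define N where "N = (\<Sum>a\<in>A. \<bar>real_of_int (zorder f a)\<bar>)"
  have dL: "deriv L z = 0" for z
  proof -
    have "norm (deriv L z) \<le> \<epsilon>" if \<epsilon>: "\<epsilon> > 0" for \<epsilon>
    proof -
      have "((\<lambda>r. 8 / r * (C * ln r + 2 * ln (2 * r) * N)) \<longlongrightarrow> 0) at_top" by real_asymp
      hence "\<forall>\<^sub>F r in at_top. 8 / r * (C * ln r + 2 * ln (2 * r) * N) < \<epsilon>"
        using \<epsilon> by (rule order_tendstoD)
      then obtain R0 where R0: "\<And>r. r \<ge> R0 \<Longrightarrow> 8 / r * (C * ln r + 2 * ln (2 * r) * N) < \<epsilon>"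
        by (auto simp: eventually_at_top_linorder)
      \<comment> \<open>From \<open>r \<ge> 2 |z|\<close> follows
        \<open>r - |z| \<ge> r / 2\<close>, so the prefactor of the derivative bound is at most
        \<open>8 / r\<close>, which beats the logarithms.\<close>
      obtain r where r: "r \<ge> max (max R0 S0) (max (2 * norm z) 1)" "good_circle f r"
         "characteristic f r + characteristic (\<lambda>z. 1 / f z) r \<le> C * ln r"
        using ex by blast
      have r1: "r \<ge> 1" "r \<ge> S0" "r \<ge> 2 * norm z" "r \<ge> R0" using r(1) by auto
      have Lr: "L holomorphic_on cball 0 r" by (rule holomorphic_on_subset[OF L(1)]) auto
      have zr: "norm z < r" using r1 by linarith
      have "circle_mean (\<lambda>z. \<bar>Re (L z)\<bar>) r
        \<le> characteristic f r + characteristic (\<lambda>z. 1 / f z) r + 2 * ln (2 * r) * N"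
        unfolding N_def using r(2) L(2) r1 S0
        by (intro circle_mean_abs_Re_le[OF nf] A Lr) (auto simp: good_circle_def intro: order.trans)
      also have "\<dots> \<le> C * ln r + 2 * ln (2 * r) * N" using r(3) by simp
      finally have m: "circle_mean (\<lambda>z. \<bar>Re (L z)\<bar>) r \<le> C * ln r + 2 * ln (2 * r) * N" .
      have pos: "C * ln r + 2 * ln (2 * r) * N \<ge> 0"
        using C0 r1 by (auto simp: N_def intro!: add_nonneg_nonneg mult_nonneg_nonneg sum_nonneg)
      have "norm (deriv L z) \<le> 2 * r / (r - norm z)^2 * circle_mean (\<lambda>z. \<bar>Re (L z)\<bar>) r"
        by (rule norm_deriv_le_circle_mean[OF Lr zr])
      also have "\<dots> \<le> 2 * r / (r - norm z)^2 * (C * ln r + 2 * ln (2 * r) * N)"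
        using m r1 by (intro mult_left_mono) auto
      also have "\<dots> \<le> 2 * r / (r / 2)^2 * (C * ln r + 2 * ln (2 * r) * N)"
        using r1 zr pos by (intro mult_right_mono divide_left_mono power_mono mult_pos_pos zero_less_power) auto
      also have "2 * r / (r / 2)^2 = 8 / r" using r1 by (simp add: power2_eq_square)
      finally show ?thesis using R0[OF r1(4)] by linarith
    qed
    hence "norm (deriv L z) \<le> 0" by (rule field_le_epsilon[where y = 0, simplified])
    thus ?thesis by simp
  qed
  have "\<exists>c. \<forall>z\<in>UNIV. L z = c"
  proof (rule has_field_derivative_zero_constant[OF convex_UNIV])
    fix z :: complex
    have "(L has_field_derivative deriv L z) (at z)" using L(1) holomorphic_derivI by blast
    thus "(L has_field_derivative 0) (at z within UNIV)" by (simp add: dL)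
  qed
  then obtain c where c: "\<And>z. L z = c" by blast
  have "\<forall>\<^sub>\<approx>z. f analytic_on {z}" "\<forall>\<^sub>\<approx>z. f z \<noteq> 0"
    using nf meromorphic_on_imp_analytic_cosparse by (auto simp: nonzero_mero_def)
  hence "\<forall>\<^sub>\<approx>z. z \<notin> A \<and> f z = (\<Prod>a\<in>A. (z - a) powi zorder f a) * exp c"
    by eventually_elim (use L(2) c in auto)
  hence "rational_fun f" by (rule rational_if_powi_product[OF A])
  thus False using f by (simp add: transcendental_meromorphic_def)
qed

section \<open>Orders of differential polynomials\<close>

text \<open>Unlike a lower bound for \<^const>\<open>zorder\<close>, which is arbitrary for a function vanishing identically
  near \<open>z\<close>, this is closed under sums and products.\<close>

definition ord_ge :: "(complex \<Rightarrow> complex) \<Rightarrow> complex \<Rightarrow> int \<Rightarrow> bool" where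
  "ord_ge g z n \<longleftrightarrow> (\<exists>F. (\<lambda>w. g (z + w)) has_laurent_expansion F \<and> (\<forall>k<n. fls_nth F k = 0))"

lemma fls_subdegree_ge_iff: "F \<noteq> 0 \<Longrightarrow> n \<le> fls_subdegree F \<longleftrightarrow> (\<forall>k<n. fls_nth F k = 0)"
  by (auto intro: fls_subdegree_geI)

lemma ord_ge_mono: "ord_ge g z n \<Longrightarrow> m \<le> n \<Longrightarrow> ord_ge g z m"
  unfolding ord_ge_def by force

lemma ord_ge_const [intro]: "ord_ge (\<lambda>_. c) z 0"
  unfolding ord_ge_def by (intro exI[of _ "fls_const c"]) auto

lemma ord_ge_add:
  assumes "ord_ge f z n" "ord_ge g z n"
  shows "ord_ge (\<lambda>z. f z + g z) z n"
proof -
  obtain F G where "(\<lambda>w. f (z + w)) has_laurent_expansion F" "\<forall>k<n. fls_nth F k = 0"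
    "(\<lambda>w. g (z + w)) has_laurent_expansion G" "\<forall>k<n. fls_nth G k = 0"
    using assms by (auto simp: ord_ge_def)
  thus ?thesis unfolding ord_ge_def
    by (intro exI[of _ "F + G"]) (auto intro: has_laurent_expansion_add)
qed

lemma ord_ge_mult:
  assumes "ord_ge f z n" "ord_ge g z m"
  shows "ord_ge (\<lambda>z. f z * g z) z (n + m)"
proof -
  obtain F G where FG: "(\<lambda>w. f (z + w)) has_laurent_expansion F" "\<forall>k<n. fls_nth F k = 0"
    "(\<lambda>w. g (z + w)) has_laurent_expansion G" "\<forall>k<m. fls_nth G k = 0"
    using assms by (auto simp: ord_ge_def)
  have "fls_nth (F * G) k = 0" if "k < n + m" for k
  proof (cases "F = 0 \<or> G = 0")
    case False
    hence "n \<le> fls_subdegree F" "m \<le> fls_subdegree G" using FG fls_subdegree_ge_iff by auto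
    thus ?thesis using False that by (intro fls_eq0_below_subdegree) simp
  qed auto
  thus ?thesis unfolding ord_ge_def using FG
    by (intro exI[of _ "F * G"]) (auto intro: has_laurent_expansion_mult)
qed

lemma ord_ge_sum:
  "(\<And>i. i \<in> I \<Longrightarrow> ord_ge (f i) z n) \<Longrightarrow> n \<le> 0 \<or> I \<noteq> {} \<and> finite I \<Longrightarrow> ord_ge (\<lambda>z. \<Sum>i\<in>I. f i z) z n"
proof (induction I rule: infinite_finite_induct)
  case (insert i I)
  show ?case
  proof (cases "I = {}")
    case False
    thus ?thesis using insert by (simp add: ord_ge_add)
  qed (use insert in simp)
qed (auto intro: ord_ge_mono[OF ord_ge_const])

lemma ord_ge_power: "ord_ge f z n \<Longrightarrow> ord_ge (\<lambda>z. f z ^ k) z (int k * n)"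
proof (induction k)
  case (Suc k)
  thus ?case using ord_ge_mult[of f z n "\<lambda>z. f z ^ k" "int k * n"] by (simp add: algebra_simps)
qed (use ord_ge_const[of 1] in simp)

lemma ord_ge_prod:
  "(\<And>i. i \<in> I \<Longrightarrow> ord_ge (f i) z (n i)) \<Longrightarrow> ord_ge (\<lambda>z. \<Prod>i\<in>I. f i z) z (\<Sum>i\<in>I. n i)"
proof (induction I rule: infinite_finite_induct)
  case (insert i I)
  thus ?case using ord_ge_mult[of "f i" z "n i" "\<lambda>z. \<Prod>i\<in>I. f i z"] by simp
qed (use ord_ge_const[of 1] in simp_all)

lemma has_laurent_expansion_deriv_shift:
  assumes "(\<lambda>w. f (z + w)) has_laurent_expansion F"
  shows "(\<lambda>w. deriv f (z + w)) has_laurent_expansion fls_deriv F"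
proof -
  have "deriv (\<lambda>w. f (z + w)) has_laurent_expansion fls_deriv F"
    using assms by (rule has_laurent_expansion_deriv)
  also have "deriv (\<lambda>w. f (z + w)) = (\<lambda>w. deriv f (z + w))"
    by (simp add: deriv_shift_0' add_ac o_def fun_eq_iff)
  finally show ?thesis .
qed

lemma ord_ge_deriv: "ord_ge f z n \<Longrightarrow> ord_ge (deriv f) z (n - 1)"
  unfolding ord_ge_def using has_laurent_expansion_deriv_shift by fastforce

text \<open>The coefficient of index -1 of a derivative is 0 times the constant coefficient. Hence
  nothing is lost at order 0, where the general rule for derivatives would only give -1.\<close>

lemma ord_ge_deriv_0:
  assumes "ord_ge f z 0"
  shows "ord_ge (deriv f) z 0"
proof -
  obtain F where F: "(\<lambda>w. f (z + w)) has_laurent_expansion F" "\<forall>k<0. fls_nth F k = 0"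
    using assms by (auto simp: ord_ge_def)
  have "fls_nth (fls_deriv F) k = 0" if "k < 0" for k
  proof (cases "k = -1")
    case False
    hence "k + 1 < 0" using that by simp
    thus ?thesis using F(2) by simp
  qed simp
  thus ?thesis unfolding ord_ge_def using has_laurent_expansion_deriv_shift[OF F(1)] by blast
qed

lemma ord_ge_higher_deriv: "ord_ge f z n \<Longrightarrow> ord_ge ((deriv ^^ i) f) z (n - int i)"
proof (induction i)
  case (Suc i)
  thus ?case using ord_ge_deriv[of "(deriv ^^ i) f" z "n - int i"] by (simp add: algebra_simps)
qed simp

lemma ord_ge_higher_deriv_0: "ord_ge f z 0 \<Longrightarrow> ord_ge ((deriv ^^ i) f) z 0"
  by (induction i) (auto intro: ord_ge_deriv_0)

lemma ord_ge_iff_zorder: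
  assumes "nonzero_mero g"
  shows "ord_ge g z n \<longleftrightarrow> n \<le> zorder g z"
proof -
  obtain G where G: "(\<lambda>w. g (z + w)) has_laurent_expansion G"
    using nonzero_meroD(1)[OF assms, of z] by (auto simp: meromorphic_on_def)
  have nz: "G \<noteq> 0" using nonzero_meroD(2)[OF assms, of z] has_laurent_expansion_eventually_nonzero_iff[OF G] by simp
  have "ord_ge g z n \<longleftrightarrow> (\<forall>k<n. fls_nth G k = 0)"
    unfolding ord_ge_def using G has_laurent_expansion_unique by blast
  thus ?thesis using fls_subdegree_ge_iff[OF nz] has_laurent_expansion_zorder[OF G nz] by simp
qed

lemma pole_order_laurent:
  assumes "(\<lambda>w. g (z + w)) has_laurent_expansion G"
  shows "pole_order g z = nat (- fls_subdegree G)"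
proof (cases "fls_subdegree G < 0")
  case True
  hence "G \<noteq> 0" by auto
  thus ?thesis using True has_laurent_expansion_zorder[OF assms] has_laurent_expansion_imp_is_pole_iff[OF assms]
    by (simp add: pole_order_def)
next
  case False
  thus ?thesis using has_laurent_expansion_imp_is_pole_iff[OF assms] by (simp add: pole_order_def)
qed

lemma ord_ge_pole_order:
  assumes "g meromorphic_on UNIV"
  shows "ord_ge g z (- int (pole_order g z))"
proof -
  obtain G where G: "(\<lambda>w. g (z + w)) has_laurent_expansion G"
    using assms by (auto simp: meromorphic_on_def)
  show ?thesis unfolding ord_ge_def pole_order_laurent[OF G]
    by (intro exI[of _ G] conjI G) auto
qed

lemma pole_order_le:
  assumes "ord_ge g z (- int n)"
  shows "pole_order g z \<le> n"
proof -
  obtain G where G: "(\<lambda>w. g (z + w)) has_laurent_expansion G" "\<forall>k < - int n. fls_nth G k = 0"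
    using assms by (auto simp: ord_ge_def)
  show ?thesis unfolding pole_order_laurent[OF G(1)]
    using fls_subdegree_ge_iff[of G "- int n"] G(2) by (cases "G = 0") auto
qed

lemma is_pole_iff_pole_order:
  assumes "g meromorphic_on UNIV"
  shows "is_pole g z \<longleftrightarrow> pole_order g z > 0"
proof -
  obtain G where G: "(\<lambda>w. g (z + w)) has_laurent_expansion G"
    using assms by (auto simp: meromorphic_on_def)
  show ?thesis unfolding pole_order_laurent[OF G] has_laurent_expansion_imp_is_pole_iff[OF G] by simp
qed

text \<open>As an equation of functions it has to hold also where \<open>f\<close> is not
  differentiable. Both functions have the same derivative relation, so the choice made by
  \<open>deriv\<close> is the same.\<close>

lemma deriv_diff_const: "deriv (\<lambda>z. f z - c) = deriv f"
proof
  fix z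
  have "((\<lambda>z. f z - c) has_field_derivative D) (at z) \<longleftrightarrow> (f has_field_derivative D) (at z)" for D
  proof
    assume "((\<lambda>z. f z - c) has_field_derivative D) (at z)"
    from DERIV_add[OF this DERIV_const[of c]] show "(f has_field_derivative D) (at z)" by simp
  next
    assume "(f has_field_derivative D) (at z)"
    from DERIV_diff[OF this DERIV_const[of c]] show "((\<lambda>z. f z - c) has_field_derivative D) (at z)" by simp
  qed
  thus "deriv (\<lambda>z. f z - c) z = deriv f z" by (simp add: deriv_def)
qed

text \<open>The Laurent series of \<open>P\<close> at 0 has zero derivative, hence is constant; the
  identity theorem carries the value \<open>c\<close> from a punctured neighbourhood of 0 to the
  plane.\<close>

lemma constant_if_deriv_zero:
  assumes "P meromorphic_on UNIV" "\<not> nonzero_mero (deriv P)"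
  shows "\<exists>c. \<forall>\<^sub>\<approx>z. P z = c"
proof -
  have "deriv P meromorphic_on UNIV" using assms(1) by (rule meromorphic_on_deriv)
  hence 0: "\<forall>\<^sub>\<approx>z. deriv P z = 0" using assms(2) nonzero_mero_if_frequently by blast
  obtain F where F: "(\<lambda>w. P (0 + w)) has_laurent_expansion F"
    using assms(1) unfolding meromorphic_on_def by blast
  have "\<forall>\<^sub>F z in at 0. deriv P z = 0" using eventually_cosparse_imp_eventually_at[OF 0, of 0 UNIV] by simp
  hence "fls_deriv F = 0"
    using has_laurent_expansion_eventually_zero_iff[OF has_laurent_expansion_deriv_shift[OF F]] by simp
  hence Fc: "F = fls_const (fls_nth F 0)" by (simp add: fls_deriv_eq_0_iff)
  define c where "c = fls_nth F 0"
  have "(\<lambda>w. P (0 + w) - c) has_laurent_expansion F - fls_const c"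
    by (intro laurent_expansion_intros F)
  hence "(\<lambda>w. P (0 + w) - c) has_laurent_expansion 0" using Fc by (simp add: c_def)
  from has_laurent_expansion_eventually_zero_iff[of "\<lambda>z. P z - c" 0, OF this]
  have "\<forall>\<^sub>F z in at 0. P z = c" by simp
  hence "\<not> (\<forall>\<^sub>F z in at 0. P z \<noteq> c)"
    using eventually_conj[of "\<lambda>z. P z = c" "at 0" "\<lambda>z. P z \<noteq> c"] eventually_False[of "at (0::complex)"]
    by (auto dest: eventually_mono)
  hence "\<not> (\<forall>\<^sub>\<approx>z. P z \<noteq> c)"
    using eventually_cosparse_imp_eventually_at[of _ UNIV 0 UNIV] by auto
  thus ?thesis using meromorphic_imp_constant_or_avoid[OF assms(1) open_UNIV connected_UNIV, of c] by blast
qed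

text \<open>A set sparse in the whole plane is closed, so the zero set of \<open>g\<close> is open
  and \<open>g\<close> vanishes near each of its zeros.\<close>

lemma deriv_zero_if_zero:
  assumes "\<forall>\<^sub>\<approx>z. g z = (0::complex)"
  shows "\<forall>\<^sub>\<approx>z. deriv g z = 0"
proof -
  have op: "open {z. g z = 0}"
  proof -
    have "{z. g z \<noteq> 0} sparse_in UNIV" using assms by (simp add: eventually_cosparse)
    hence "closed {z. g z \<noteq> 0}" by (rule sparse_in_UNIV_imp_closed)
    moreover have "{z. g z = 0} = - {z. g z \<noteq> 0}" by auto
    ultimately show ?thesis by (simp add: open_Compl)
  qed
  have "deriv g z = 0" if "g z = 0" for z
  proof -
    have "\<forall>\<^sub>F w in nhds z. w \<in> {z. g z = 0}" using op that by (intro eventually_nhds_in_open) auto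
    hence "\<forall>\<^sub>F w in nhds z. g w = 0" by simp
    hence "deriv g z = deriv (\<lambda>_. 0) z" by (intro deriv_cong_ev) auto
    thus ?thesis by simp
  qed
  thus ?thesis by (rule eventually_mono[OF assms])
qed

section \<open>Zeros and poles of \<open>P\<close> in terms of those of \<open>f\<close>\<close>

lemma diff_poly_meromorphic:
  assumes "f meromorphic_on UNIV" "\<And>j. j \<in> {1..t} \<Longrightarrow> b j meromorphic_on UNIV"
  shows "diff_poly k t b q f meromorphic_on UNIV"
  unfolding diff_poly_def diff_monomial_def by (intro meromorphic_intros assms)

definition monomial_weight :: "nat \<Rightarrow> (nat \<Rightarrow> nat \<Rightarrow> nat) \<Rightarrow> nat \<Rightarrow> nat" where
  "monomial_weight k q j = (\<Sum>i=1..k. i * q i j)"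

lemma monomial_weight_eq: "monomial_weight k q j = (\<Sum>i\<le>k. i * q i j)"
  unfolding monomial_weight_def by (intro sum.mono_neutral_left) (auto simp: Suc_le_eq)

text \<open>The \<open>i\<close>-th derivative lowers the order by at most \<open>i\<close>, so a
  monomial has order at least degree times \<open>m\<close> minus its weight. Homogeneity makes the
  factor of \<open>m\<close> the same for all monomials, which allows \<open>m\<close> of either
  sign. All coefficient poles are charged to every term.\<close>

lemma ord_ge_diff_poly:
  assumes f: "ord_ge f z m" and b: "\<And>j. j \<in> {1..t} \<Longrightarrow> b j meromorphic_on UNIV" and t: "t \<ge> 1"
    and d: "\<And>j. j \<in> {1..t} \<Longrightarrow> monomial_degree k q j = d"
    and \<nu>: "\<And>j. j \<in> {1..t} \<Longrightarrow> monomial_weight k q j \<le> \<nu>"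
  shows "ord_ge (diff_poly k t b q f) z (int d * m - int \<nu> - int (\<Sum>j=1..t. pole_order (b j) z))"
  unfolding diff_poly_def diff_monomial_def
proof (rule ord_ge_sum)
  fix j assume j: "j \<in> {1..t}"
  have deg: "int (\<Sum>i\<le>k. q i j) = int d" using d[OF j] by (simp only: monomial_degree_def)
  have wt: "int (\<Sum>i\<le>k. i * q i j) = int (monomial_weight k q j)" by (simp only: monomial_weight_eq)
  have "int (q i j) * (m - int i) = int (q i j) * m - int (i * q i j)" for i
    by (simp add: right_diff_distrib)
  hence "(\<Sum>i\<le>k. int (q i j) * (m - int i)) = (\<Sum>i\<le>k. int (q i j)) * m - (\<Sum>i\<le>k. int (i * q i j))"
    by (simp only: sum_subtractf sum_distrib_right)
  hence eq: "(\<Sum>i\<le>k. int (q i j) * (m - int i)) = int d * m - int (monomial_weight k q j)"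
    by (simp only: deg[symmetric] wt[symmetric] of_nat_sum)
  have "ord_ge (\<lambda>z. \<Prod>i\<le>k. (deriv ^^ i) f z ^ q i j) z (\<Sum>i\<le>k. int (q i j) * (m - int i))"
    by (intro ord_ge_prod ord_ge_power ord_ge_higher_deriv f)
  from ord_ge_mult[OF ord_ge_pole_order[OF b[OF j]] this[unfolded eq]]
  have *: "ord_ge (\<lambda>z. b j z * (\<Prod>i\<le>k. (deriv ^^ i) f z ^ q i j)) z
      (- int (pole_order (b j) z) + (int d * m - int (monomial_weight k q j)))" .
  have "int (pole_order (b j) z) \<le> int (\<Sum>j=1..t. pole_order (b j) z)"
    unfolding of_nat_le_iff using j by (intro member_le_sum) auto
  moreover have "int (monomial_weight k q j) \<le> int \<nu>" using \<nu>[OF j] by (simp only: of_nat_le_iff)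
  moreover have "D - n - S \<le> - p + (D - w)" if "p \<le> S" "w \<le> n" for D n S p w :: int
    using that by simp
  ultimately have "int d * m - int \<nu> - int (\<Sum>j=1..t. pole_order (b j) z)
      \<le> - int (pole_order (b j) z) + (int d * m - int (monomial_weight k q j))"
    by blast
  with * show "ord_ge (\<lambda>z. b j z * (\<Prod>i\<le>k. (deriv ^^ i) f z ^ q i j)) z
      (int d * m - int \<nu> - int (\<Sum>j=1..t. pole_order (b j) z))"
    by (rule ord_ge_mono)
qed (use t in auto)

text \<open>For \<open>p \<ge> 1\<close> one has \<open>p + i \<le> (i + 1) p\<close>, and for
  \<open>p = 0\<close> no pole arises. The bound is thus proportional to the pole order, in contrast
  to \<open>p + i\<close>.\<close>

lemma ord_ge_higher_deriv_pole:
  assumes "f meromorphic_on UNIV"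
  shows "ord_ge ((deriv ^^ i) f) z (- int ((i + 1) * pole_order f z))"
proof (cases "pole_order f z = 0")
  case True
  thus ?thesis using ord_ge_higher_deriv_0[of f z i] ord_ge_pole_order[OF assms, of z] by simp
next
  case False
  hence "i * 1 \<le> i * pole_order f z" by (intro mult_left_mono) auto
  thus ?thesis
    by (intro ord_ge_mono[OF ord_ge_higher_deriv[OF ord_ge_pole_order[OF assms]]]) (simp flip: of_nat_mult)
qed

text \<open>Proportionality to \<open>pole_order f z\<close> serves two ends: it bounds
  \<open>N(r, P)\<close> by a multiple of \<open>N(r, f)\<close> plus the coefficients, and away
  from poles of \<open>f\<close> it leaves only poles of coefficients.\<close>

lemma ord_ge_diff_poly_pole:
  assumes f: "f meromorphic_on UNIV" and b: "\<And>j. j \<in> {1..t} \<Longrightarrow> b j meromorphic_on UNIV"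
    and d: "\<And>j. j \<in> {1..t} \<Longrightarrow> monomial_degree k q j = d"
    and \<nu>: "\<And>j. j \<in> {1..t} \<Longrightarrow> monomial_weight k q j \<le> \<nu>"
  shows "ord_ge (diff_poly k t b q f) z (- int ((d + \<nu>) * pole_order f z + (\<Sum>j=1..t. pole_order (b j) z)))"
  unfolding diff_poly_def diff_monomial_def
proof (rule ord_ge_sum)
  let ?p = "pole_order f z"
  fix j assume j: "j \<in> {1..t}"
  have "(\<Sum>i\<le>k. q i j * (i + 1)) = d + monomial_weight k q j"
    using d[OF j] unfolding monomial_degree_def monomial_weight_eq
    by (simp add: sum.distrib algebra_simps)
  hence "(\<Sum>i\<le>k. q i j * (i + 1)) * ?p = (d + monomial_weight k q j) * ?p" by simp
  hence "(\<Sum>i\<le>k. q i j * ((i + 1) * ?p)) = (d + monomial_weight k q j) * ?p"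
    by (simp only: sum_distrib_right mult.assoc)
  hence "int (\<Sum>i\<le>k. q i j * ((i + 1) * ?p)) = int ((d + monomial_weight k q j) * ?p)" by (rule arg_cong)
  hence eq: "(\<Sum>i\<le>k. int (q i j) * (- int ((i + 1) * ?p))) = - int ((d + monomial_weight k q j) * ?p)"
    by (simp only: mult_minus_right sum_negf of_nat_sum of_nat_mult)
  have "ord_ge (\<lambda>z. \<Prod>i\<le>k. (deriv ^^ i) f z ^ q i j) z (\<Sum>i\<le>k. int (q i j) * (- int ((i + 1) * ?p)))"
    by (intro ord_ge_prod ord_ge_power ord_ge_higher_deriv_pole f)
  from ord_ge_mult[OF ord_ge_pole_order[OF b[OF j]] this[unfolded eq]]
  have "ord_ge (\<lambda>z. b j z * (\<Prod>i\<le>k. (deriv ^^ i) f z ^ q i j)) z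
      (- int (pole_order (b j) z) + - int ((d + monomial_weight k q j) * ?p))" .
  moreover have "pole_order (b j) z \<le> (\<Sum>j=1..t. pole_order (b j) z)"
    using j by (intro member_le_sum) auto
  moreover have "(d + monomial_weight k q j) * ?p \<le> (d + \<nu>) * ?p"
    using \<nu>[OF j] by (intro mult_right_mono add_left_mono) auto
  moreover have "- int (X + S) \<le> - int x + - int Y" if "x \<le> S" "Y \<le> X" for x S X Y
    using that by simp
  ultimately show "ord_ge (\<lambda>z. b j z * (\<Prod>i\<le>k. (deriv ^^ i) f z ^ q i j)) z
      (- int ((d + \<nu>) * ?p + (\<Sum>j=1..t. pole_order (b j) z)))"
    by (blast intro: ord_ge_mono)
qed auto

lemma zorder_cong_const:
  assumes "\<forall>\<^sub>\<approx>z. P z = c" "c \<noteq> 0"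
  shows "zorder P z = 0"
proof -
  have "\<forall>\<^sub>F w in at z. P w = c" using eventually_cosparse_imp_eventually_at[OF assms(1), of z UNIV] by simp
  hence "zorder P z = zorder (\<lambda>_. c) z" by (intro zorder_cong) auto
  thus ?thesis using assms by simp
qed

text \<open>The local comparison behind the second main theorem for the values \<open>0\<close>, \<open>1\<close>, \<open>\<infinity>\<close> of \<open>P\<close>;
  \<open>s\<close> bounds the contribution of the poles of the coefficients.\<close>

lemma order_inequality:
  fixes d \<nu> s :: nat
  assumes f: "nonzero_mero f" and P: "nonzero_mero P" and Q: "nonzero_mero (\<lambda>z. P z - 1)"
    and P': "nonzero_mero (deriv P)"
    and low: "ord_ge P z (int d * zorder f z - int \<nu> - int s)"
    and pole: "\<not> is_pole f z \<Longrightarrow> ord_ge P z (- int s)"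
  shows "int d * int (pole_order (\<lambda>z. 1 / f z) z) - zorder (\<lambda>z. deriv P z / (P z - 1)) z
    \<le> of_bool (is_pole f z) + (int \<nu> + 1) * of_bool (is_pole (\<lambda>z. 1 / f z) z)
       + of_bool (is_pole (\<lambda>z. 1 / (P z - 1)) z) + int s"
proof -
  define Q where "Q = (\<lambda>z. P z - 1)"
  have nQ: "nonzero_mero Q" using Q by (simp add: Q_def)
  define m where "m = zorder f z"
  define e where "e = zorder Q z"
  define p where "p = zorder P z"
  define D where "D = int d * m"
  define w where "w = zorder (\<lambda>z. deriv P z / (P z - 1)) z"
  have w: "w = zorder (deriv P) z - e"
    unfolding w_def e_def Q_def by (intro zorder_divide nonzero_meroD P' Q)
  \<comment> \<open>At a zero or a pole of \<open>P - 1\<close> the logarithmic derivative has a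
    simple pole.\<close>
  have w1: "w = -1" if "e \<noteq> 0"
  proof -
    have "zorder (deriv Q) z = e - 1" unfolding e_def
      by (intro zorder_deriv_minus_1 nonzero_meroD nQ) (use that in \<open>simp add: e_def\<close>)
    thus ?thesis using w by (simp add: Q_def deriv_diff_const)
  qed
  have pge: "D - int \<nu> - int s \<le> p"
    using low unfolding ord_ge_iff_zorder[OF P] by (simp add: D_def m_def p_def)
  have one: "(\<lambda>_. 1) meromorphic_on {z}" "\<exists>\<^sub>F x in at z. (1::complex) \<noteq> 0" by (auto intro: meromorphic_intros)
  \<comment> \<open>Where \<open>P\<close> vanishes, \<open>P - 1\<close> takes the value -1 and has
    order 0.\<close>
  have e_pos: "e = 0" if "p \<ge> 1"
    unfolding e_def Q_def
    by (subst zorder_diff2) (use that one nonzero_meroD[OF P] in \<open>auto simp: p_def\<close>)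
  have e_neg: "e = p" if "p < 0"
    unfolding e_def Q_def
    by (subst zorder_diff1) (use that one nonzero_meroD[OF P] in \<open>auto simp: p_def\<close>)
  have e_0: "e \<ge> 0" if "p \<ge> 0"
  proof -
    have "ord_ge P z 0" using that ord_ge_iff_zorder[OF P] by (simp add: p_def)
    from ord_ge_add[OF this ord_ge_const[of "-1"]] have "ord_ge Q z 0" by (simp add: Q_def)
    thus ?thesis using ord_ge_iff_zorder[OF nQ] by (simp add: e_def)
  qed
  have w0: "w \<ge> 0 \<and> w \<ge> p - 1" if "e = 0"
  proof -
    have p0: "p \<ge> 0" using that e_neg by force
    hence "ord_ge P z 0" "ord_ge P z p" using ord_ge_iff_zorder[OF P] by (simp_all add: p_def)
    hence "ord_ge (deriv P) z 0" "ord_ge (deriv P) z (p - 1)" by (auto intro: ord_ge_deriv ord_ge_deriv_0)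
    thus ?thesis using that w ord_ge_iff_zorder[OF P'] by simp
  qed
  have "is_pole (\<lambda>z. 1 / (P z - 1)) z \<longleftrightarrow> e > 0"
    using is_pole_iff_zorder[OF nonzero_mero_inverse[OF nQ]] zorder_one_over[OF nQ]
    by (simp add: e_def Q_def)
  moreover have "is_pole (\<lambda>z. 1 / f z) z \<longleftrightarrow> m > 0" "is_pole f z \<longleftrightarrow> m < 0"
    using is_pole_iff_zorder[OF nonzero_mero_inverse[OF f]] zorder_one_over[OF f] is_pole_iff_zorder[OF f]
    by (simp_all add: m_def)
  moreover have "int d * int (pole_order (\<lambda>z. 1 / f z) z) = (if m > 0 then D else 0)"
    by (simp add: pole_order_one_over[OF f] D_def m_def)
  ultimately have goal: ?thesis if
    "(if m > 0 then D else 0) - w \<le> of_bool (m < 0) + (int \<nu> + 1) * of_bool (m > 0) + of_bool (e > 0) + int s"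
    using that by (simp only: w_def)
  \<comment> \<open>A pole of \<open>P\<close> away from the poles of \<open>f\<close> must come
    from a coefficient, so \<open>s \<ge> 1\<close> pays for the simple pole of the logarithmic
    derivative.\<close>
  have s0: "int s \<ge> 1" if "m \<ge> 0" "p < 0"
    using pole that ord_ge_iff_zorder[OF P, of z "- int s"] is_pole_iff_zorder[OF f, of z]
    by (auto simp: m_def p_def)
  show ?thesis
  proof (rule goal)
    show "(if m > 0 then D else 0) - w \<le> of_bool (m < 0) + (int \<nu> + 1) * of_bool (m > 0) + of_bool (e > 0) + int s"
    proof (cases "e = 0")
      case True
      \<comment> \<open>For \<open>m > 0\<close>,
        \<open>w \<ge> p - 1 \<ge> D - \<nu> - s - 1\<close>; this is where \<open>\<nu> + 1\<close>
        comes from. Otherwise the left-hand side is \<open>-w \<le> 0\<close>.\<close>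
      thus ?thesis using w0 pge by (cases "m > 0") auto
    next
      case False
      \<comment> \<open>The simple pole adds 1 on the left. For \<open>m > 0\<close>,
        \<open>p \<le> 0\<close> forces \<open>D \<le> \<nu> + s\<close>; for \<open>m < 0\<close>
        the term of the pole of \<open>f\<close> pays; for \<open>m = 0\<close> either
        \<open>e > 0\<close> or \<open>s \<ge> 1\<close> does.\<close>
      hence "w = -1" "p < 1" using w1 e_pos by force+
      moreover have "e > 0" if "p \<ge> 0" using e_0[OF that] False by simp
      ultimately show ?thesis using pge s0 e_neg
        by (cases "m > 0"; cases "p < 0"; cases "m = 0") auto
    qed
  qed
qed

section \<open>Growth relative to the characteristic\<close>

text \<open>A one-sided big-O along \<open>almost_top\<close>. Large negative values of
  \<open>u\<close> are permitted, as is necessary for differences such as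
  \<open>c T(r, f) - N(r)\<close>.\<close>

definition dominated :: "(real \<Rightarrow> real) \<Rightarrow> (real \<Rightarrow> real) \<Rightarrow> bool" where
  "dominated u v \<longleftrightarrow> (\<exists>B\<ge>0. \<forall>\<^sub>F r in almost_top. u r \<le> B * v r)"

lemma dominated_mono:
  assumes "dominated u w" "\<forall>\<^sub>F r in almost_top. u' r \<le> u r"
  shows "dominated u' w"
proof -
  obtain B where B: "B \<ge> 0" "\<forall>\<^sub>F r in almost_top. u r \<le> B * w r"
    using assms(1) by (auto simp: dominated_def)
  have "\<forall>\<^sub>F r in almost_top. u' r \<le> B * w r" using B(2) assms(2) by eventually_elim linarith
  thus ?thesis using B(1) by (auto simp: dominated_def)
qed

lemma dominated_trans:
  assumes "dominated u v" "dominated v w"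
  shows "dominated u w"
proof -
  obtain B C where B: "B \<ge> 0" "\<forall>\<^sub>F r in almost_top. u r \<le> B * v r"
     and C: "C \<ge> 0" "\<forall>\<^sub>F r in almost_top. v r \<le> C * w r"
    using assms by (auto simp: dominated_def)
  have "\<forall>\<^sub>F r in almost_top. u r \<le> (B * C) * w r" using B(2) C(2)
  proof eventually_elim
    case (elim r)
    from mult_left_mono[OF elim(2) B(1)] elim(1) show ?case by (simp add: mult.assoc)
  qed
  thus ?thesis using B(1) C(1) unfolding dominated_def by (intro exI[of _ "B * C"]) auto
qed

lemma dominated_add:
  assumes "dominated u w" "dominated v w"
  shows "dominated (\<lambda>r. u r + v r) w"
proof -
  obtain B C where B: "B \<ge> 0" "\<forall>\<^sub>F r in almost_top. u r \<le> B * w r"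
     and C: "C \<ge> 0" "\<forall>\<^sub>F r in almost_top. v r \<le> C * w r"
    using assms by (auto simp: dominated_def)
  have "\<forall>\<^sub>F r in almost_top. u r + v r \<le> (B + C) * w r" using B(2) C(2)
    by eventually_elim (simp add: distrib_right)
  thus ?thesis using B(1) C(1) unfolding dominated_def by (intro exI[of _ "B + C"]) auto
qed

lemma dominated_le: "\<forall>\<^sub>F r in almost_top. u r \<le> w r \<Longrightarrow> dominated u w"
  unfolding dominated_def by (intro exI[of _ 1]) auto

lemma dominated_cmult:
  assumes "dominated u w" "c \<ge> 0"
  shows "dominated (\<lambda>r. c * u r) w"
proof -
  have "dominated (\<lambda>r. c * u r) u" unfolding dominated_def using assms(2) by (intro exI[of _ c]) auto
  thus ?thesis using assms(1) by (rule dominated_trans)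
qed

lemma dominated_const:
  assumes "\<forall>\<^sub>F r in almost_top. 1 \<le> w r"
  shows "dominated (\<lambda>_. c) w"
  unfolding dominated_def
proof (intro exI[of _ "\<bar>c\<bar>"] conjI)
  show "\<forall>\<^sub>F r in almost_top. c \<le> \<bar>c\<bar> * w r" using assms
  proof eventually_elim
    case (elim r)
    from mult_left_mono[OF this abs_ge_zero[of c]] show ?case by linarith
  qed
qed auto

lemma dominated_sum:
  assumes "\<And>i. i \<in> I \<Longrightarrow> dominated (u i) w" "\<forall>\<^sub>F r in almost_top. 1 \<le> w r"
  shows "dominated (\<lambda>r. \<Sum>i\<in>I. u i r) w"
  using assms(1)
proof (induction I rule: infinite_finite_induct)
  case (insert i I)
  thus ?case by (simp add: dominated_add)
qed (simp_all add: dominated_const assms(2))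

lemma eventually_circle:
  assumes "\<forall>\<^sub>\<approx>z. R (z::complex)"
  shows "\<forall>\<^sub>F r in almost_top. \<forall>z. norm z = r \<longrightarrow> R z"
  by (rule eventually_almost_top_countable, rule countable_subset[OF _ countable_bad_circles[OF assms]]) auto

lemma eventually_regular_circle:
  assumes "g meromorphic_on UNIV"
  shows "eventually (regular_circle g) almost_top"
  using eventually_circle[OF meromorphic_on_imp_analytic_cosparse[OF assms]] eventually_almost_top_ge[of 1]
proof eventually_elim
  case (elim r)
  thus ?case using analytic_at_imp_isCont unfolding regular_circle_def
    by (auto intro!: continuous_at_imp_continuous_on)
qed

section \<open>Calculus of the positive logarithm and of proximity functions\<close>

lemma log_plus_mono: "0 \<le> x \<Longrightarrow> x \<le> y \<Longrightarrow> log_plus x \<le> log_plus y"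
  by (simp add: log_plus_eq)

lemma le_exp_log_plus: "x \<ge> 0 \<Longrightarrow> x \<le> exp (log_plus x)"
  by (simp add: log_plus_eq)

lemma log_plus_leI:
  assumes "0 \<le> x" "x \<le> exp y" "0 \<le> y"
  shows "log_plus x \<le> y"
proof (cases "x = 0")
  case False
  hence "ln x \<le> ln (exp y)" using assms by (intro ln_mono) auto
  thus ?thesis using assms by (simp add: log_plus_def)
qed (use assms in \<open>simp add: log_plus_def\<close>)

lemma log_plus_mult: "0 \<le> x \<Longrightarrow> 0 \<le> y \<Longrightarrow> log_plus (x * y) \<le> log_plus x + log_plus y"
  by (rule log_plus_leI) (auto simp: exp_add intro!: mult_mono le_exp_log_plus)

lemma log_plus_power: "0 \<le> x \<Longrightarrow> log_plus (x ^ n) = real n * log_plus x"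
proof (cases "x \<le> 1")
  case True
  assume "0 \<le> x"
  thus ?thesis using True power_le_one[of x n] by (simp add: log_plus_eq max_def)
next
  case False
  hence "1 \<le> x ^ n" by simp
  thus ?thesis using False by (simp add: log_plus_eq max_def ln_realpow)
qed

lemma log_plus_prod: "(\<And>i. i \<in> I \<Longrightarrow> 0 \<le> x i) \<Longrightarrow> log_plus (\<Prod>i\<in>I. x i) \<le> (\<Sum>i\<in>I. log_plus (x i))"
proof (induction I rule: infinite_finite_induct)
  case (insert i I)
  thus ?case using log_plus_mult[of "x i" "\<Prod>i\<in>I. x i"] by (force simp: prod_nonneg)
qed (auto simp: log_plus_def)

lemma log_plus_sum:
  assumes "finite I" "I \<noteq> {}" "\<And>i. i \<in> I \<Longrightarrow> 0 \<le> x i"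
  shows "log_plus (\<Sum>i\<in>I. x i) \<le> (\<Sum>i\<in>I. log_plus (x i)) + ln (real (card I))"
proof (rule log_plus_leI)
  have c: "real (card I) \<ge> 1" using assms by (simp add: Suc_le_eq card_gt_0_iff)
  show "0 \<le> (\<Sum>i\<in>I. log_plus (x i)) + ln (real (card I))" using c by (simp add: sum_nonneg)
  have "(\<Sum>i\<in>I. x i) \<le> (\<Sum>i\<in>I. exp (\<Sum>i\<in>I. log_plus (x i)))"
  proof (rule sum_mono)
    fix i assume i: "i \<in> I"
    have "x i \<le> exp (log_plus (x i))" using assms(3)[OF i] by (rule le_exp_log_plus)
    also have "log_plus (x i) \<le> (\<Sum>i\<in>I. log_plus (x i))" using i assms by (intro member_le_sum) auto
    finally show "x i \<le> exp (\<Sum>i\<in>I. log_plus (x i))" by simp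
  qed
  also have "\<dots> = exp ((\<Sum>i\<in>I. log_plus (x i)) + ln (real (card I)))"
    using c by (simp add: exp_add)
  finally show "(\<Sum>i\<in>I. x i) \<le> exp ((\<Sum>i\<in>I. log_plus (x i)) + ln (real (card I)))" .
qed (use assms in \<open>auto intro: sum_nonneg\<close>)

lemma log_plus_add:
  assumes "0 \<le> x" "0 \<le> y"
  shows "log_plus (x + y) \<le> log_plus x + log_plus y + ln 2"
  using log_plus_sum[of "UNIV :: bool set" "\<lambda>b. if b then x else y"] assms by (simp add: UNIV_bool add_ac)

lemma proximity_leI:
  assumes "regular_circle g r" "continuous_on (sphere 0 r) u"
    and "\<And>z. norm z = r \<Longrightarrow> log_plus (norm (g z)) \<le> u z"
  shows "proximity g r \<le> circle_mean u r"
  unfolding proximity_eq_circle_mean[OF assms(1)] using assms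
  by (intro circle_mean_mono continuous_on_log_plus_norm) (auto simp: regular_circle_def)

lemma continuous_on_log_plus_regular:
  "regular_circle g r \<Longrightarrow> continuous_on (sphere 0 r) (\<lambda>z. log_plus (norm (g z)))"
  by (auto simp: regular_circle_def intro: continuous_on_log_plus_norm)

lemma regular_circle_mult: "regular_circle g r \<Longrightarrow> regular_circle h r \<Longrightarrow> regular_circle (\<lambda>z. g z * h z) r"
  by (auto simp: regular_circle_def intro!: continuous_intros)

lemma regular_circle_divide: "regular_circle g r \<Longrightarrow> good_circle h r \<Longrightarrow> regular_circle (\<lambda>z. g z / h z) r"
  using good_imp_regular[of h r] by (auto simp: regular_circle_def good_circle_def intro!: continuous_intros)

lemma proximity_mult:
  assumes "regular_circle g r" "regular_circle h r"
  shows "proximity (\<lambda>z. g z * h z) r \<le> proximity g r + proximity h r"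
proof -
  have "proximity (\<lambda>z. g z * h z) r \<le> circle_mean (\<lambda>z. log_plus (norm (g z)) + log_plus (norm (h z))) r"
    using assms by (intro proximity_leI regular_circle_mult continuous_on_add continuous_on_log_plus_regular)
      (auto simp: norm_mult intro: log_plus_mult)
  also have "\<dots> = proximity g r + proximity h r"
    using assms regular_circleD[OF assms(1)] by (subst circle_mean_add)
      (auto simp: proximity_eq_circle_mean intro: continuous_on_log_plus_regular)
  finally show ?thesis .
qed

lemma proximity_cong:
  assumes "regular_circle g r" "\<And>z. norm z = r \<Longrightarrow> g z = h z"
  shows "proximity g r = proximity h r"
proof -
  have "continuous_on (sphere 0 r) h \<longleftrightarrow> continuous_on (sphere 0 r) g"
    using assms(2) by (intro continuous_on_cong) auto
  hence "regular_circle h r" using assms by (auto simp: regular_circle_def)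
  thus ?thesis using assms regular_circleD[OF assms(1)]
    by (auto simp: proximity_eq_circle_mean intro: circle_mean_cong)
qed

lemma counting_mono:
  assumes "g meromorphic_on UNIV" "f meromorphic_on UNIV" "r \<ge> 1"
    and "\<And>z. pole_order g z \<le> c * pole_order f z"
  shows "counting g r \<le> real c * counting f r"
proof -
  have "counting g r \<le> int_count (\<lambda>z. real c * real (pole_order f z)) r"
    using assms by (simp only: counting_eq) (intro int_count_mono loc_finite_cmult loc_finite_pole_order assms,
      simp flip: of_nat_mult)
  thus ?thesis using assms by (simp add: counting_eq int_count_cmult)
qed

lemma reduced_counting_le_counting:
  assumes "g meromorphic_on UNIV" "r \<ge> 1"
  shows "reduced_counting g r \<le> counting g r"
  using assms by (simp add: counting_eq reduced_counting_eq)
   (intro int_count_mono loc_finite_is_pole loc_finite_pole_order assms, auto simp: is_pole_iff_pole_order)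

lemma reduced_counting_nonneg:
  assumes "g meromorphic_on UNIV" "r \<ge> 1"
  shows "0 \<le> reduced_counting g r"
  using assms by (simp add: reduced_counting_eq int_count_nonneg)

text \<open>The size of the error in the logarithmic derivative lemma. The summand 1 lets it
  dominate constants, and the shift by 2 keeps the last logarithm positive for nonnegative
  characteristic.\<close>

definition log_scale :: "(complex \<Rightarrow> complex) \<Rightarrow> real \<Rightarrow> real" where
  "log_scale f r = 1 + ln r + ln (characteristic f r + 2)"

lemma eventually_characteristic_nonneg:
  assumes "g meromorphic_on UNIV"
  shows "\<forall>\<^sub>F r in almost_top. characteristic g r \<ge> 0"
  using eventually_regular_circle[OF assms] eventually_almost_top_ge[of 1]
  by eventually_elim (rule characteristic_nonneg[OF assms])

lemma log_scale_bounds: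
  assumes "r \<ge> 1" "characteristic f r \<ge> 0"
  shows "1 \<le> log_scale f r" "log_scale f r \<le> 2 * (r * (characteristic f r + 2))"
proof -
  let ?x = "characteristic f r + 2"
  show "1 \<le> log_scale f r" using assms by (simp add: log_scale_def)
  have "ln r \<le> r - 1" "ln ?x \<le> ?x - 1" 
    using assms ln_le_minus_one[of r] ln_le_minus_one[of ?x] by linarith+
  hence "log_scale f r \<le> r + ?x" using assms by (simp add: log_scale_def)
  moreover have "r \<le> r * ?x" "?x \<le> r * ?x"
    using assms mult_left_mono[of 1 ?x r] mult_right_mono[of 1 r ?x] by auto
  ultimately show "log_scale f r \<le> 2 * (r * ?x)" by linarith
qed

lemma eventually_log_scale_ge_1:
  assumes "f meromorphic_on UNIV"
  shows "\<forall>\<^sub>F r in almost_top. 1 \<le> log_scale f r"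
  using eventually_characteristic_nonneg[OF assms] eventually_almost_top_ge[of 1]
  by eventually_elim (rule log_scale_bounds)

text \<open>The hypothesis makes \<open>T(r, g) + 2\<close> at most a constant times
  \<open>r (T(r, f) + 2)\<close>, and the logarithm of such a product is again of size
  \<open>log_scale f\<close>. Thus the error for \<open>g\<close> is measured in terms of
  \<open>f\<close>.\<close>

lemma logarithmic_derivative_dominated:
  assumes f: "f meromorphic_on UNIV" and g: "nonzero_mero g"
    and dom: "dominated (characteristic g) (\<lambda>r. log_scale f r + characteristic f r)"
  shows "dominated (proximity (\<lambda>z. deriv g z / g z)) (log_scale f)"
proof -
  obtain B where B: "B \<ge> 0" "\<forall>\<^sub>F r in almost_top.
     proximity (\<lambda>z. deriv g z / g z) r \<le> B * (1 + ln r + ln (characteristic g r + 2))"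
    using logarithmic_derivative_lemma[OF g] by blast
  obtain C where C: "C \<ge> 0" "\<forall>\<^sub>F r in almost_top. characteristic g r \<le> C * (log_scale f r + characteristic f r)"
    using dom by (auto simp: dominated_def)
  define D where "D = 3 * C + 1"
  have D: "D \<ge> 1" using C by (simp add: D_def)
  have "\<forall>\<^sub>F r in almost_top. proximity (\<lambda>z. deriv g z / g z) r \<le> B * (2 + ln D) * log_scale f r"
    using B(2) C(2) eventually_characteristic_nonneg[OF f]
      eventually_characteristic_nonneg[OF nonzero_mero_imp_mero[OF g]] eventually_almost_top_ge[of 1]
  proof eventually_elim
    case (elim r)
    let ?x = "characteristic f r + 2"
    have x: "?x \<ge> 2" and r1: "r \<ge> 1" using elim by auto
    note ls = log_scale_bounds[OF elim(5,3)]
    have "?x \<le> r * ?x" using x r1 mult_right_mono[of 1 r ?x] by auto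
    moreover have "C * (log_scale f r + characteristic f r) \<le> C * (3 * (r * ?x))"
      using ls(2) calculation C(1) by (intro mult_left_mono) auto
    moreover have "2 \<le> r * ?x" using x calculation by linarith
    ultimately have "characteristic g r + 2 \<le> D * (r * ?x)"
      using elim(2) x by (simp add: D_def algebra_simps)
    hence "ln (characteristic g r + 2) \<le> ln (D * (r * ?x))"
      using elim(4) by (intro ln_mono) auto
    also have "\<dots> = ln D + (ln r + ln ?x)" using D r1 x by (simp add: ln_mult)
    finally have "1 + ln r + ln (characteristic g r + 2) \<le> log_scale f r + ln D + ln r"
      by (simp add: log_scale_def)
    also have "ln D \<le> ln D * log_scale f r" using mult_left_mono[OF ls(1), of "ln D"] D by simp
    also have "ln r \<le> log_scale f r" using x by (simp add: log_scale_def)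
    finally have "1 + ln r + ln (characteristic g r + 2) \<le> (2 + ln D) * log_scale f r"
      by (simp add: algebra_simps)
    from order.trans[OF elim(1) mult_left_mono[OF this B(1)]] show ?case by (simp add: mult.assoc)
  qed
  thus ?thesis unfolding dominated_def using B(1) D by (intro exI[of _ "B * (2 + ln D)"]) auto
qed

text \<open>Induction along \<open>f^(i+1) / f = (f^(i+1) / f^(i)) (f^(i) / f)\<close>. The
  induction hypothesis also bounds \<open>T(r, f^(i))\<close> by a multiple of
  \<open>T(r, f)\<close> plus the error, as needed before the logarithmic derivative of
  \<open>f^(i)\<close> can be estimated.\<close>

lemma higher_deriv_dominated:
  assumes f: "nonzero_mero f"
  shows "dominated (proximity (\<lambda>z. (deriv ^^ i) f z / f z)) (log_scale f)"
proof (induction i)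
  case 0
  have fm: "f meromorphic_on UNIV" by (rule nonzero_mero_imp_mero[OF f])
  have "\<forall>\<^sub>F r in almost_top. proximity (\<lambda>z. (deriv ^^ 0) f z / f z) r \<le> log_scale f r"
    using eventually_good_circle[OF f] eventually_log_scale_ge_1[OF fm]
  proof eventually_elim
    case (elim r)
    have "proximity (\<lambda>z. (deriv ^^ 0) f z / f z) r \<le> circle_mean (\<lambda>_. 0) r"
      using elim(1) by (intro proximity_leI regular_circle_divide)
        (auto simp: good_imp_regular good_circle_def log_plus_def)
    thus ?case using elim(2) by simp
  qed
  thus ?case by (rule dominated_le)
next
  case (Suc i)
  let ?g = "(deriv ^^ i) f"
  have fm: "f meromorphic_on UNIV" by (rule nonzero_mero_imp_mero[OF f])
  have gm: "?g meromorphic_on UNIV" by (rule meromorphic_on_higher_deriv[OF fm])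
  note ls1 = eventually_log_scale_ge_1[OF fm]
  show ?case
  proof (cases "nonzero_mero ?g")
    case True
    have "dominated (\<lambda>r. proximity (\<lambda>z. ?g z / f z) r + real (i + 2) * characteristic f r)
       (\<lambda>r. log_scale f r + characteristic f r)"
    proof (intro dominated_add dominated_cmult)
      have "dominated (log_scale f) (\<lambda>r. log_scale f r + characteristic f r)"
        using eventually_characteristic_nonneg[OF fm] by (intro dominated_le) (auto elim: eventually_mono)
      thus "dominated (proximity (\<lambda>z. ?g z / f z)) (\<lambda>r. log_scale f r + characteristic f r)"
        by (rule dominated_trans[OF Suc])
      show "dominated (characteristic f) (\<lambda>r. log_scale f r + characteristic f r)"
        using ls1 by (intro dominated_le) (auto elim: eventually_mono)
    qed auto
    moreover have "\<forall>\<^sub>F r in almost_top. characteristic ?g r \<le> proximity (\<lambda>z. ?g z / f z) r + real (i + 2) * characteristic f r"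
      using eventually_good_circle[OF f] eventually_regular_circle[OF gm] eventually_almost_top_ge[of 1]
    proof eventually_elim
      case (elim r)
      have reg: "regular_circle (\<lambda>z. ?g z / f z) r" by (rule regular_circle_divide[OF elim(2,1)])
      have "proximity ?g r = proximity (\<lambda>z. (?g z / f z) * f z) r"
        using elim by (intro proximity_cong) (auto simp: good_circle_def)
      also have "\<dots> \<le> proximity (\<lambda>z. ?g z / f z) r + proximity f r"
        by (intro proximity_mult reg good_imp_regular elim)
      also have "proximity f r \<le> characteristic f r"
        by (intro proximity_le_characteristic fm elim)
      finally have 1: "proximity ?g r \<le> proximity (\<lambda>z. ?g z / f z) r + characteristic f r" by simp
      have "counting ?g r \<le> real (i + 1) * counting f r"
        by (intro counting_mono gm fm elim pole_order_le ord_ge_higher_deriv_pole)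
      also have "\<dots> \<le> real (i + 1) * characteristic f r"
        by (intro mult_left_mono counting_le_characteristic good_imp_regular elim) auto
      finally show ?case using 1 by (simp add: characteristic_def algebra_simps)
    qed
    ultimately have "dominated (characteristic ?g) (\<lambda>r. log_scale f r + characteristic f r)"
      by (rule dominated_mono)
    from logarithmic_derivative_dominated[OF fm True this]
    have "dominated (\<lambda>r. proximity (\<lambda>z. deriv ?g z / ?g z) r + proximity (\<lambda>z. ?g z / f z) r) (log_scale f)"
      using Suc by (rule dominated_add)
    moreover have "\<forall>\<^sub>F r in almost_top. proximity (\<lambda>z. (deriv ^^ Suc i) f z / f z) r
       \<le> proximity (\<lambda>z. deriv ?g z / ?g z) r + proximity (\<lambda>z. ?g z / f z) r"
      using eventually_good_circle[OF f] eventually_good_circle[OF True]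
    proof eventually_elim
      case (elim r)
      have reg: "regular_circle (\<lambda>z. deriv ?g z / ?g z) r" "regular_circle (\<lambda>z. ?g z / f z) r"
        by (intro good_circle_regular_logderiv regular_circle_divide good_imp_regular elim)+
      have "proximity (\<lambda>z. (deriv ^^ Suc i) f z / f z) r = proximity (\<lambda>z. (deriv ?g z / ?g z) * (?g z / f z)) r"
        by (intro proximity_cong[symmetric] regular_circle_mult reg) (use elim in \<open>auto simp: good_circle_def\<close>)
      also have "\<dots> \<le> proximity (\<lambda>z. deriv ?g z / ?g z) r + proximity (\<lambda>z. ?g z / f z) r"
        by (rule proximity_mult[OF reg])
      finally show ?case .
    qed
    ultimately show ?thesis by (rule dominated_mono)
  next
    \<comment> \<open>For a polynomial \<open>f\<close> some derivative vanishes identically and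
      cannot serve as a divisor; the next quotient is then 0 on almost all circles.\<close>
    case False
    hence "\<forall>\<^sub>\<approx>z. ?g z = 0" using nonzero_mero_if_frequently[OF gm] by blast
    hence "\<forall>\<^sub>\<approx>z. (deriv ^^ Suc i) f z = 0" using deriv_zero_if_zero by simp
    from eventually_circle[OF this] ls1 eventually_almost_top_ge[of 1]
    have "\<forall>\<^sub>F r in almost_top. proximity (\<lambda>z. (deriv ^^ Suc i) f z / f z) r \<le> log_scale f r"
    proof eventually_elim
      case (elim r)
      have "proximity (\<lambda>_. 0) r = proximity (\<lambda>z. (deriv ^^ Suc i) f z / f z) r"
        using elim by (intro proximity_cong) (auto simp: regular_circle_def)
      moreover have "proximity (\<lambda>_. 0) r = 0"
        using elim by (subst proximity_eq_circle_mean) (auto simp: regular_circle_def log_plus_def)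
      ultimately show ?case using elim(2) by simp
    qed
    thus ?thesis by (rule dominated_le)
  qed
qed

section \<open>The second main theorem for a differential polynomial\<close>

text \<open>Homogeneity distributes the \<open>d\<close> factors of \<open>f ^ d\<close> exactly
  over the factors of each monomial, so \<open>P / f^d\<close> is a polynomial in the quotients
  \<open>f^(i) / f\<close> alone.\<close>

lemma diff_poly_over_power:
  assumes deg: "\<And>j. j \<in> {1..t} \<Longrightarrow> monomial_degree k q j = d"
  shows "diff_poly k t b q f z / f z ^ d = (\<Sum>j=1..t. b j z * (\<Prod>i\<le>k. ((deriv ^^ i) f z / f z) ^ q i j))"
proof -
  have "(\<Prod>i\<le>k. ((deriv ^^ i) f z / f z) ^ q i j) = diff_monomial k q j f z / f z ^ d" if "j \<in> {1..t}" for j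
    unfolding diff_monomial_def deg[OF that, symmetric] monomial_degree_def
    by (simp add: power_divide prod_dividef power_sum)
  thus ?thesis by (simp add: diff_poly_def sum_divide_distrib)
qed

lemma proximity_diff_poly_over_power:
  assumes t: "t \<ge> 1" and deg: "\<And>j. j \<in> {1..t} \<Longrightarrow> monomial_degree k q j = d"
    and b: "\<And>j. j \<in> {1..t} \<Longrightarrow> regular_circle (b j) r"
    and f: "\<And>i. i \<le> k \<Longrightarrow> regular_circle (\<lambda>z. (deriv ^^ i) f z / f z) r"
  shows "regular_circle (\<lambda>z. diff_poly k t b q f z / f z ^ d) r"
    and "proximity (\<lambda>z. diff_poly k t b q f z / f z ^ d) r
      \<le> (\<Sum>j=1..t. proximity (b j) r + (\<Sum>i\<le>k. real (q i j) * proximity (\<lambda>z. (deriv ^^ i) f z / f z) r)) + ln (real t)"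
proof -
  let ?h = "\<lambda>i z. (deriv ^^ i) f z / f z"
  let ?U = "\<lambda>z. (\<Sum>j=1..t. log_plus (norm (b j z)) + (\<Sum>i\<le>k. real (q i j) * log_plus (norm (?h i z)))) + ln (real t)"
  have r: "r > 0" using regular_circleD[OF b[of 1]] t by simp
  have contb: "continuous_on (sphere 0 r) (b j)" if "j \<in> {1..t}" for j
    using b[OF that] by (simp add: regular_circle_def)
  have contf: "continuous_on (sphere 0 r) (?h i)" if "i \<le> k" for i
    using f[OF that] by (simp add: regular_circle_def)
  have eq: "diff_poly k t b q f z / f z ^ d = (\<Sum>j=1..t. b j z * (\<Prod>i\<le>k. ?h i z ^ q i j))" for z
    by (rule diff_poly_over_power[OF deg])
  show reg: "regular_circle (\<lambda>z. diff_poly k t b q f z / f z ^ d) r"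
    unfolding eq regular_circle_def
    using r by (intro conjI continuous_intros contb contf) auto
  have lpb: "continuous_on (sphere 0 r) (\<lambda>z. log_plus (norm (b j z)))" if "j \<in> {1..t}" for j
    by (rule continuous_on_log_plus_regular[OF b[OF that]])
  have lpf: "continuous_on (sphere 0 r) (\<lambda>z. real n * log_plus (norm (?h i z)))" if "i \<le> k" for i n
    by (intro continuous_on_mult_left continuous_on_log_plus_regular f that)
  have lps: "continuous_on (sphere 0 r) (\<lambda>z. \<Sum>i\<le>k. real (q i j) * log_plus (norm (?h i z)))" for j
    by (intro continuous_on_sum lpf) auto
  have "proximity (\<lambda>z. diff_poly k t b q f z / f z ^ d) r
     \<le> circle_mean (\<lambda>z. ?U z) r"
  proof (rule proximity_leI[OF reg])
    show "continuous_on (sphere 0 r) (\<lambda>z. ?U z)"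
      by (intro continuous_on_add continuous_on_sum continuous_on_const lpb lpf) auto
    fix z :: complex
    have monom: "log_plus (norm (b j z * (\<Prod>i\<le>k. ?h i z ^ q i j)))
        \<le> log_plus (norm (b j z)) + (\<Sum>i\<le>k. real (q i j) * log_plus (norm (?h i z)))" for j
    proof -
      have "norm (b j z * (\<Prod>i\<le>k. ?h i z ^ q i j)) = norm (b j z) * (\<Prod>i\<le>k. norm (?h i z) ^ q i j)"
        by (simp add: norm_mult norm_power prod_norm[symmetric])
      hence "log_plus (norm (b j z * (\<Prod>i\<le>k. ?h i z ^ q i j)))
         \<le> log_plus (norm (b j z)) + log_plus (\<Prod>i\<le>k. norm (?h i z) ^ q i j)"
        by (simp only:) (intro log_plus_mult prod_nonneg, auto)
      also have "log_plus (\<Prod>i\<le>k. norm (?h i z) ^ q i j) \<le> (\<Sum>i\<le>k. log_plus (norm (?h i z) ^ q i j))"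
        by (intro log_plus_prod) auto
      also have "\<dots> = (\<Sum>i\<le>k. real (q i j) * log_plus (norm (?h i z)))"
        by (intro sum.cong refl log_plus_power) auto
      finally show ?thesis by simp
    qed
    have "norm (diff_poly k t b q f z / f z ^ d) \<le> (\<Sum>j=1..t. norm (b j z * (\<Prod>i\<le>k. ?h i z ^ q i j)))"
      unfolding eq by (rule norm_sum)
    hence "log_plus (norm (diff_poly k t b q f z / f z ^ d)) \<le> log_plus (\<Sum>j=1..t. norm (b j z * (\<Prod>i\<le>k. ?h i z ^ q i j)))"
      by (intro log_plus_mono) auto
    also have "\<dots> \<le> (\<Sum>j=1..t. log_plus (norm (b j z * (\<Prod>i\<le>k. ?h i z ^ q i j)))) + ln (real (card {1..t}))"
      using t by (intro log_plus_sum) auto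
    also have "\<dots> \<le> ?U z"
      using monom by (intro add_mono sum_mono) auto
    finally show "log_plus (norm (diff_poly k t b q f z / f z ^ d))
       \<le> ?U z" .
  qed
  also have "\<dots> = (\<Sum>j=1..t. circle_mean (\<lambda>z. log_plus (norm (b j z)) + (\<Sum>i\<le>k. real (q i j) * log_plus (norm (?h i z)))) r) + ln (real t)"
    using r by (subst circle_mean_add, auto intro!: continuous_on_add continuous_on_sum lpb lpf simp del: of_nat_sum)
      (intro circle_mean_sum continuous_on_add lpb lps, auto)
  also have "\<dots> = (\<Sum>j=1..t. proximity (b j) r + (\<Sum>i\<le>k. real (q i j) * proximity (?h i) r)) + ln (real t)"
  proof -
    have "circle_mean (\<lambda>z. log_plus (norm (b j z)) + (\<Sum>i\<le>k. real (q i j) * log_plus (norm (?h i z)))) r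
       = proximity (b j) r + (\<Sum>i\<le>k. real (q i j) * proximity (?h i) r)" if j: "j \<in> {1..t}" for j
    proof -
      have "circle_mean (\<lambda>z. \<Sum>i\<le>k. real (q i j) * log_plus (norm (?h i z))) r
          = (\<Sum>i\<le>k. circle_mean (\<lambda>z. real (q i j) * log_plus (norm (?h i z))) r)"
        using r by (intro circle_mean_sum lpf) auto
      also have "\<dots> = (\<Sum>i\<le>k. real (q i j) * proximity (?h i) r)"
        unfolding circle_mean_cmult using f by (intro sum.cong refl) (simp add: proximity_eq_circle_mean)
      finally show ?thesis using r
        by (subst circle_mean_add[OF lpb[OF j] lps]) (simp_all add: proximity_eq_circle_mean[OF b[OF j]])
    qed
    thus ?thesis by simp
  qed
  finally show "proximity (\<lambda>z. diff_poly k t b q f z / f z ^ d) r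
      \<le> (\<Sum>j=1..t. proximity (b j) r + (\<Sum>i\<le>k. real (q i j) * proximity (?h i) r)) + ln (real t)" .
qed

lemma is_S_imp_almost_top:
  assumes "is_S f u"
  shows "u \<in> o[almost_top](characteristic f)"
proof -
  obtain E where E: "E \<in> lmeasurable" "u \<in> o[inf at_top (principal (- E))](characteristic f)"
    using assms by (auto simp: is_S_def)
  have "almost_top \<le> inf at_top (principal (- E))"
    unfolding almost_top_def by (rule INF_lower[OF E(1)])
  thus ?thesis using E(2) landau_o.small.filter_mono by blast
qed

lemma counting_eq_int_count_sum:
  assumes "\<And>j. j \<in> J \<Longrightarrow> b j meromorphic_on UNIV" "r > 0"
  shows "int_count (\<lambda>z. \<Sum>j\<in>J. real (pole_order (b j) z)) r = (\<Sum>j\<in>J. counting (b j) r)"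
  using assms by (subst int_count_sum) (auto simp: counting_eq intro: loc_finite_pole_order)

lemma characteristic_diff_one:
  assumes P: "P meromorphic_on UNIV" and reg: "regular_circle P r" and r: "r \<ge> 1"
  shows "characteristic (\<lambda>z. P z - 1) r \<le> characteristic P r + ln 2"
proof -
  let ?Q = "\<lambda>z. P z - 1"
  have Q: "?Q meromorphic_on UNIV" by (intro meromorphic_intros P)
  have "pole_order ?Q z \<le> 1 * pole_order P z" for z
  proof -
    have "ord_ge (\<lambda>z. P z + (-1)) z (- int (pole_order P z))"
      by (intro ord_ge_add ord_ge_pole_order P ord_ge_mono[OF ord_ge_const]) auto
    thus ?thesis using pole_order_le[of ?Q z] by simp
  qed
  hence "counting ?Q r \<le> counting P r" using counting_mono[OF Q P r, of 1] by simp
  moreover have "proximity ?Q r \<le> circle_mean (\<lambda>z. log_plus (norm (P z)) + ln 2) r"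
  proof (rule proximity_leI)
    show "regular_circle ?Q r" using reg by (auto simp: regular_circle_def intro!: continuous_intros)
    show "continuous_on (sphere 0 r) (\<lambda>z. log_plus (norm (P z)) + ln 2)"
      by (intro continuous_on_add continuous_on_const continuous_on_log_plus_regular reg)
    fix z :: complex
    have "log_plus (norm (P z - 1)) \<le> log_plus (norm (P z) + 1)"
      using norm_triangle_ineq4[of "P z" 1] by (intro log_plus_mono) auto
    also have "\<dots> \<le> log_plus (norm (P z)) + log_plus 1 + ln 2" by (intro log_plus_add) auto
    finally show "log_plus (norm (P z - 1)) \<le> log_plus (norm (P z)) + ln 2" by (simp add: log_plus_def)
  qed
  hence "proximity ?Q r \<le> proximity P r + ln 2"
    using reg r by (subst (asm) circle_mean_add)
      (auto simp: proximity_eq_circle_mean intro: continuous_on_log_plus_regular)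
  ultimately show ?thesis by (simp add: characteristic_def)
qed

text \<open>With \<open>u = P / f^d\<close>, \<open>v = P' / P\<close> and
  \<open>w = (P - 1) / P'\<close> one has \<open>1 / f^d = u - u v w\<close>. The quotient
  \<open>u\<close> occurs in both summands, hence the factor 2.\<close>

lemma proximity_one_over_power:
  assumes f: "good_circle f r" and P: "good_circle P r" and W: "good_circle (\<lambda>z. deriv P z / (P z - 1)) r"
  shows "real d * proximity (\<lambda>z. 1 / f z) r
    \<le> 2 * proximity (\<lambda>z. P z / f z ^ d) r + proximity (\<lambda>z. deriv P z / P z) r
      + proximity (\<lambda>z. (P z - 1) / deriv P z) r + ln 2"
proof -
  let ?u = "\<lambda>z. P z / f z ^ d" and ?v = "\<lambda>z. deriv P z / P z" and ?w = "\<lambda>z. (P z - 1) / deriv P z"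
  have r: "r \<ge> 0" using f by (simp add: good_circle_def)
  have reg1: "regular_circle (\<lambda>z. 1 / f z) r" by (intro good_imp_regular good_circle_one_over f)
  have "good_circle (\<lambda>z. f z ^ d) r" using f by (auto simp: good_circle_def intro!: analytic_intros)
  hence regu: "regular_circle ?u r" by (intro regular_circle_divide good_imp_regular P)
  have regv: "regular_circle ?v r" by (rule good_circle_regular_logderiv[OF P])
  have regw: "regular_circle ?w r" using good_imp_regular[OF good_circle_one_over[OF W]] by simp
  note cont = continuous_on_log_plus_regular[OF regu] continuous_on_log_plus_regular[OF regv]
    continuous_on_log_plus_regular[OF regw]
  have "real d * proximity (\<lambda>z. 1 / f z) r = circle_mean (\<lambda>z. real d * log_plus (norm (1 / f z))) r"
    by (simp add: proximity_eq_circle_mean[OF reg1])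
  also have "\<dots> \<le> circle_mean (\<lambda>z. (2 * log_plus (norm (?u z)) + log_plus (norm (?v z))) + (log_plus (norm (?w z)) + ln 2)) r"
  proof (rule circle_mean_mono)
    fix z :: complex assume z: "norm z = r"
    have nz: "f z \<noteq> 0" "P z \<noteq> 0" "deriv P z \<noteq> 0" "P z - 1 \<noteq> 0"
      using z f P W by (auto simp: good_circle_def)
    have eq: "1 / f z ^ d = ?u z - ?u z * (?v z * ?w z)" using nz by (simp add: field_simps)
    have "norm (1 / f z) ^ d = norm (1 / f z ^ d)"
      by (simp add: norm_divide norm_power power_divide)
    also have "\<dots> = norm (?u z - ?u z * (?v z * ?w z))" by (rule arg_cong[OF eq])
    also have "\<dots> \<le> norm (?u z) + norm (?u z) * (norm (?v z) * norm (?w z))"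
      using norm_triangle_ineq4[of "?u z" "?u z * (?v z * ?w z)"] by (simp only: norm_mult)
    finally have "log_plus (norm (1 / f z) ^ d) \<le> log_plus (norm (?u z) + norm (?u z) * (norm (?v z) * norm (?w z)))"
      by (intro log_plus_mono) auto
    also have "\<dots> \<le> log_plus (norm (?u z)) + log_plus (norm (?u z) * (norm (?v z) * norm (?w z))) + ln 2"
      by (intro log_plus_add) auto
    also have "log_plus (norm (?u z) * (norm (?v z) * norm (?w z))) \<le> log_plus (norm (?u z)) + log_plus (norm (?v z) * norm (?w z))"
      by (intro log_plus_mult) auto
    also have "log_plus (norm (?v z) * norm (?w z)) \<le> log_plus (norm (?v z)) + log_plus (norm (?w z))"
      by (intro log_plus_mult) auto
    finally show "real d * log_plus (norm (1 / f z)) \<le> (2 * log_plus (norm (?u z)) + log_plus (norm (?v z))) + (log_plus (norm (?w z)) + ln 2)"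
      by (simp add: log_plus_power)
  qed (intro r continuous_on_mult_left continuous_on_log_plus_regular reg1 continuous_on_add continuous_on_const cont)+
  also have "\<dots> = circle_mean (\<lambda>z. 2 * log_plus (norm (?u z)) + log_plus (norm (?v z))) r
       + circle_mean (\<lambda>z. log_plus (norm (?w z)) + ln 2) r"
    by (intro circle_mean_add r continuous_on_mult_left continuous_on_add continuous_on_const cont)
  also have "\<dots> = (2 * proximity ?u r + proximity ?v r) + (proximity ?w r + ln 2)"
    using r by (simp add: circle_mean_add continuous_on_mult_left cont
        proximity_eq_circle_mean[OF regu] proximity_eq_circle_mean[OF regv] proximity_eq_circle_mean[OF regw])
  finally show ?thesis by simp
qed

lemma int_count_of_bool_pole_le:
  assumes "g meromorphic_on UNIV" "r \<ge> 1" "regular_circle g r"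
  shows "int_count (\<lambda>z. of_bool (is_pole g z)) r \<le> characteristic g r"
  using reduced_counting_le_counting[OF assms(1,2)] counting_le_characteristic[OF assms(3)] assms
  by (simp add: reduced_counting_eq)

lemma nonzero_mero_diff_const:
  assumes "P meromorphic_on UNIV" "nonzero_mero (deriv P)"
  shows "nonzero_mero (\<lambda>z. P z - c)"
proof (rule nonzero_mero_if_frequently)
  show "(\<lambda>z. P z - c) meromorphic_on UNIV" by (intro meromorphic_intros assms)
  show "\<not> (\<forall>\<^sub>\<approx>z. P z - c = 0)"
  proof
    assume "\<forall>\<^sub>\<approx>z. P z - c = 0"
    from deriv_zero_if_zero[OF this] have "\<forall>\<^sub>\<approx>z. deriv P z = 0" by (simp add: deriv_diff_const)
    moreover have "\<forall>\<^sub>\<approx>z. deriv P z \<noteq> 0" using assms(2) by (simp add: nonzero_mero_def)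
    ultimately have "\<forall>\<^sub>\<approx>z::complex. False" by eventually_elim simp
    thus False by simp
  qed
qed

text \<open>A constant \<open>P\<close> needs a separate, easier argument, since \<open>P'\<close> vanishes.\<close>

lemma characteristic_bound_const:
  fixes d \<nu> :: nat
  assumes f: "nonzero_mero f" and b: "\<And>j. j \<in> J \<Longrightarrow> b j meromorphic_on UNIV"
    and low: "\<And>z. ord_ge P z (int d * zorder f z - int \<nu> - int (\<Sum>j\<in>J. pole_order (b j) z))"
    and c: "\<forall>\<^sub>\<approx>z. P z = c" "c \<noteq> 0"
  shows "\<exists>K. \<forall>\<^sub>F r in almost_top. (real d - real \<nu> - 2) * characteristic f r
    \<le> proximity (\<lambda>z. P z / f z ^ d) r + (\<Sum>j\<in>J. counting (b j) r) + K"
proof -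
  obtain K0 where K0: "\<And>r. good_circle f r \<Longrightarrow> characteristic (\<lambda>z. 1 / f z) r = characteristic f r + K0"
    using first_main_theorem[OF f] by blast
  let ?s = "\<lambda>z. \<Sum>j\<in>J. pole_order (b j) z"
  have Pm: "P meromorphic_on UNIV" using iffD2[OF meromorphic_on_cong'[OF c(1) refl] meromorphic_on_const] .
  have nP: "nonzero_mero P" unfolding nonzero_mero_def using Pm c by (auto elim: eventually_mono)
  have fi: "nonzero_mero (\<lambda>z. 1 / f z)" by (rule nonzero_mero_inverse[OF f])
  note fim = nonzero_mero_imp_mero[OF fi]
  have ptw: "real d * real (pole_order (\<lambda>z. 1 / f z) z) \<le> real \<nu> * of_bool (is_pole (\<lambda>z. 1 / f z) z) + (\<Sum>j\<in>J. real (pole_order (b j) z))" for z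
  proof (cases "zorder f z > 0")
    case True
    \<comment> \<open>A function equal to \<open>c \<noteq> 0\<close> off a sparse set has order 0,
      so the lower bound for the order of \<open>P\<close> reads
      \<open>d m \<le> \<nu> + s\<close>.\<close>
    have "int d * zorder f z - int \<nu> - int (?s z) \<le> 0"
      using low[of z] zorder_cong_const[OF c, of z] by (simp add: ord_ge_iff_zorder[OF nP])
    hence "int d * int (pole_order (\<lambda>z. 1 / f z) z) \<le> int \<nu> + int (?s z)"
      using True by (simp add: pole_order_one_over[OF f])
    hence "d * pole_order (\<lambda>z. 1 / f z) z \<le> \<nu> + ?s z" by (simp only: of_nat_mult[symmetric] of_nat_add[symmetric] of_nat_le_iff)
    hence "real (d * pole_order (\<lambda>z. 1 / f z) z) \<le> real (\<nu> + ?s z)" by (simp only: of_nat_le_iff)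
    moreover have "is_pole (\<lambda>z. 1 / f z) z" using True by (simp add: is_pole_iff_zorder[OF fi] zorder_one_over[OF f])
    ultimately show ?thesis by simp
  next
    case False
    thus ?thesis by (auto simp: pole_order_one_over[OF f] intro!: add_nonneg_nonneg sum_nonneg)
  qed
  have "\<forall>\<^sub>F r in almost_top. (real d - real \<nu> - 2) * characteristic f r
    \<le> proximity (\<lambda>z. P z / f z ^ d) r + (\<Sum>j\<in>J. counting (b j) r) + (log_plus (norm (1 / c)) + real \<nu> * K0 - real d * K0)"
    using eventually_circle[OF c(1)] eventually_good_circle[OF f] eventually_almost_top_ge[of 1]
      eventually_characteristic_nonneg[OF nonzero_mero_imp_mero[OF f]]
  proof eventually_elim
    case (elim r)
    note good = elim(2) and r1 = elim(3)
    have r0: "r \<ge> 0" "r > 0" using r1 by auto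
    have regi: "regular_circle (\<lambda>z. 1 / f z) r" by (intro good_imp_regular good_circle_one_over good)
    have goodd: "good_circle (\<lambda>z. f z ^ d) r" using good by (auto simp: good_circle_def intro!: analytic_intros)
    have "continuous_on (sphere 0 r) P \<longleftrightarrow> continuous_on (sphere 0 r) (\<lambda>_::complex. c)"
      by (intro continuous_on_cong) (use elim(1) in auto)
    hence "regular_circle P r" using r0 by (simp add: regular_circle_def)
    hence regu: "regular_circle (\<lambda>z. P z / f z ^ d) r" by (rule regular_circle_divide[OF _ goodd])
    have "real d * proximity (\<lambda>z. 1 / f z) r = circle_mean (\<lambda>z. real d * log_plus (norm (1 / f z))) r"
      by (simp add: proximity_eq_circle_mean[OF regi])
    also have "\<dots> \<le> circle_mean (\<lambda>z. log_plus (norm (P z / f z ^ d)) + log_plus (norm (1 / c))) r"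
    proof (rule circle_mean_mono)
      fix z :: complex assume z: "norm z = r"
      hence "norm (1 / f z) ^ d = norm (P z / f z ^ d) * norm (1 / c)"
        using elim(1) c(2) by (simp add: norm_divide norm_power power_divide)
      hence "log_plus (norm (1 / f z) ^ d) \<le> log_plus (norm (P z / f z ^ d)) + log_plus (norm (1 / c))"
        by (simp only:) (intro log_plus_mult, auto)
      thus "real d * log_plus (norm (1 / f z)) \<le> log_plus (norm (P z / f z ^ d)) + log_plus (norm (1 / c))"
        by (simp add: log_plus_power)
    qed (intro r0 continuous_on_mult_left continuous_on_log_plus_regular regi regu continuous_on_add continuous_on_const)+
    also have "\<dots> = proximity (\<lambda>z. P z / f z ^ d) r + log_plus (norm (1 / c))"
      using r0 by (subst circle_mean_add) (auto simp: proximity_eq_circle_mean[OF regu]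
          intro: continuous_on_log_plus_regular[OF regu])
    finally have prox: "real d * proximity (\<lambda>z. 1 / f z) r \<le> proximity (\<lambda>z. P z / f z ^ d) r + log_plus (norm (1 / c))" .
    have "real d * counting (\<lambda>z. 1 / f z) r = int_count (\<lambda>z. real d * real (pole_order (\<lambda>z. 1 / f z) z)) r"
      by (simp add: counting_eq[OF fim r0(2)] int_count_cmult)
    also have "\<dots> \<le> int_count (\<lambda>z. real \<nu> * of_bool (is_pole (\<lambda>z. 1 / f z) z) + (\<Sum>j\<in>J. real (pole_order (b j) z))) r"
      using ptw r1 by (intro int_count_mono loc_finite_add loc_finite_cmult loc_finite_sum loc_finite_pole_order
          loc_finite_is_pole fim b) auto
    also have "\<dots> = real \<nu> * int_count (\<lambda>z. of_bool (is_pole (\<lambda>z. 1 / f z) z)) r + (\<Sum>j\<in>J. counting (b j) r)"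
      by (subst int_count_add) (auto intro!: loc_finite_cmult loc_finite_sum loc_finite_pole_order
          loc_finite_is_pole fim b simp: int_count_cmult counting_eq_int_count_sum[OF b r0(2)])
    also have "int_count (\<lambda>z. of_bool (is_pole (\<lambda>z. 1 / f z) z)) r \<le> characteristic (\<lambda>z. 1 / f z) r"
      by (intro int_count_of_bool_pole_le fim r1 regi)
    finally have "real d * counting (\<lambda>z. 1 / f z) r \<le> real \<nu> * characteristic (\<lambda>z. 1 / f z) r + (\<Sum>j\<in>J. counting (b j) r)"
      by (simp add: mult_left_mono)
    with prox have "real d * characteristic (\<lambda>z. 1 / f z) r \<le> proximity (\<lambda>z. P z / f z ^ d) r
        + log_plus (norm (1 / c)) + real \<nu> * characteristic (\<lambda>z. 1 / f z) r + (\<Sum>j\<in>J. counting (b j) r)"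
      by (simp add: characteristic_def[of "\<lambda>z. 1 / f z"] distrib_left)
    \<comment> \<open>The estimate obtained has the better factor \<open>d - \<nu>\<close>;
      nonnegativity of \<open>T(r, f)\<close> permits the smaller
      \<open>d - \<nu> - 2\<close>.\<close>
    thus ?case using elim(4) unfolding K0[OF good] by (simp add: algebra_simps)
  qed
  thus ?thesis by blast
qed

text \<open>A zero of \<open>f\<close> of high order makes \<open>W = P' / (P - 1)\<close> vanish to
  nearly \<open>d\<close> times that order. The counts of both must therefore be subtracted point by
  point before anything is estimated; what remains is bounded per distinct point.\<close>

lemma characteristic_bound:
  fixes d \<nu> :: nat
  assumes f: "nonzero_mero f" and b: "\<And>j. j \<in> J \<Longrightarrow> b j meromorphic_on UNIV"
    and P: "nonzero_mero P" and P': "nonzero_mero (deriv P)"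
    and low: "\<And>z. ord_ge P z (int d * zorder f z - int \<nu> - int (\<Sum>j\<in>J. pole_order (b j) z))"
    and pole: "\<And>z. \<not> is_pole f z \<Longrightarrow> ord_ge P z (- int (\<Sum>j\<in>J. pole_order (b j) z))"
  shows "\<exists>K. \<forall>\<^sub>F r in almost_top. (real d - real \<nu> - 2) * characteristic f r
    \<le> reduced_counting (\<lambda>z. 1 / (P z - 1)) r + 2 * proximity (\<lambda>z. P z / f z ^ d) r
      + proximity (\<lambda>z. deriv P z / P z) r + proximity (\<lambda>z. deriv P z / (P z - 1)) r
      + (\<Sum>j\<in>J. counting (b j) r) + K"
proof -
  let ?s = "\<lambda>z. \<Sum>j\<in>J. pole_order (b j) z"
  let ?W = "\<lambda>z. deriv P z / (P z - 1)"
  have Pm: "P meromorphic_on UNIV" and fm: "f meromorphic_on UNIV"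
    by (intro nonzero_mero_imp_mero P f)+
  have nQ: "nonzero_mero (\<lambda>z. P z - 1)" by (rule nonzero_mero_diff_const[OF Pm P'])
  have nW: "nonzero_mero ?W" by (intro nonzero_mero_divide P' nQ)
  have fi: "nonzero_mero (\<lambda>z. 1 / f z)" and Qi: "nonzero_mero (\<lambda>z. 1 / (P z - 1))"
    by (intro nonzero_mero_inverse f nQ)+
  note fim = nonzero_mero_imp_mero[OF fi] and Qim = nonzero_mero_imp_mero[OF Qi]
  obtain K0 where K0: "\<And>r. good_circle f r \<Longrightarrow> characteristic (\<lambda>z. 1 / f z) r = characteristic f r + K0"
    using first_main_theorem[OF f] by blast
  obtain K1 where K1: "\<And>r. good_circle ?W r \<Longrightarrow>
     circle_mean (\<lambda>z. ln (norm (?W z))) r = int_count (\<lambda>z. real_of_int (zorder ?W z)) r + K1"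
    using Jensen_formula[OF nW] by blast
  have ptw: "real d * real (pole_order (\<lambda>z. 1 / f z) z) - real_of_int (zorder ?W z)
     \<le> (of_bool (is_pole f z) + (real \<nu> + 1) * of_bool (is_pole (\<lambda>z. 1 / f z) z))
       + (of_bool (is_pole (\<lambda>z. 1 / (P z - 1)) z) + (\<Sum>j\<in>J. real (pole_order (b j) z)))" for z
  proof -
    have "real_of_int (int d * int (pole_order (\<lambda>z. 1 / f z) z) - zorder ?W z)
       \<le> real_of_int (of_bool (is_pole f z) + (int \<nu> + 1) * of_bool (is_pole (\<lambda>z. 1 / f z) z)
           + of_bool (is_pole (\<lambda>z. 1 / (P z - 1)) z) + int (?s z))"
      by (subst of_int_le_iff) (intro order_inequality f P P' nQ low pole)
    thus ?thesis by (simp add: of_bool_def split: if_splits)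
  qed
  have "\<forall>\<^sub>F r in almost_top. (real d - real \<nu> - 2) * characteristic f r
    \<le> reduced_counting (\<lambda>z. 1 / (P z - 1)) r + 2 * proximity (\<lambda>z. P z / f z ^ d) r
      + proximity (\<lambda>z. deriv P z / P z) r + proximity ?W r + (\<Sum>j\<in>J. counting (b j) r)
      + (ln 2 - K1 + (real \<nu> + 1 - real d) * K0)"
    using eventually_good_circle[OF f] eventually_good_circle[OF P] eventually_good_circle[OF nW]
      eventually_almost_top_ge[of 1]
  proof eventually_elim
    case (elim r)
    note good = elim(1) and r1 = elim(4)
    have r0: "r > 0" using r1 by auto
    have regi: "regular_circle (\<lambda>z. 1 / f z) r" by (intro good_imp_regular good_circle_one_over good)
    have "proximity ?W r - proximity (\<lambda>z. 1 / ?W z) r = int_count (\<lambda>z. real_of_int (zorder ?W z)) r + K1"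
      using proximity_diff_one_over[OF elim(3)] K1[OF elim(3)] by simp
    \<comment> \<open>Jensen's formula for \<open>W\<close>: the proximity function of
      \<open>1 / W\<close> becomes that of \<open>W\<close>, which is a logarithmic derivative of
      \<open>P - 1\<close>, minus the count of orders.\<close>
    hence W: "proximity (\<lambda>z. (P z - 1) / deriv P z) r = proximity ?W r - int_count (\<lambda>z. real_of_int (zorder ?W z)) r - K1"
      by simp
    have "real d * counting (\<lambda>z. 1 / f z) r - int_count (\<lambda>z. real_of_int (zorder ?W z)) r
       = int_count (\<lambda>z. real d * real (pole_order (\<lambda>z. 1 / f z) z) - real_of_int (zorder ?W z)) r"
      by (subst int_count_diff) (auto simp: counting_eq[OF fim r0] int_count_cmult
          intro!: loc_finite_cmult loc_finite_pole_order fim loc_finite_zorder nW)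
    also have "\<dots> \<le> int_count (\<lambda>z. (of_bool (is_pole f z) + (real \<nu> + 1) * of_bool (is_pole (\<lambda>z. 1 / f z) z))
       + (of_bool (is_pole (\<lambda>z. 1 / (P z - 1)) z) + (\<Sum>j\<in>J. real (pole_order (b j) z)))) r"
      using ptw r1 by (intro int_count_mono loc_finite_add loc_finite_diff loc_finite_cmult loc_finite_sum
          loc_finite_pole_order loc_finite_is_pole fim fm Qim b loc_finite_zorder nW) auto
    also have "\<dots> = (int_count (\<lambda>z. of_bool (is_pole f z)) r + (real \<nu> + 1) * int_count (\<lambda>z. of_bool (is_pole (\<lambda>z. 1 / f z) z)) r)
       + (reduced_counting (\<lambda>z. 1 / (P z - 1)) r + (\<Sum>j\<in>J. counting (b j) r))"
    proof -
      note lf = loc_finite_is_pole[OF fm] loc_finite_cmult[OF loc_finite_is_pole[OF fim], of "real \<nu> + 1"]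
        loc_finite_is_pole[OF Qim] loc_finite_sum[OF loc_finite_pole_order[OF b]]
      show ?thesis
        by (simp only: int_count_add[OF loc_finite_add[OF lf(1,2)] loc_finite_add[OF lf(3,4)]]
            int_count_add[OF lf(1,2)] int_count_add[OF lf(3,4)] int_count_cmult
            counting_eq_int_count_sum[OF b r0] reduced_counting_eq[OF Qim r0])
    qed
    also have "\<dots> \<le> (characteristic f r + (real \<nu> + 1) * characteristic (\<lambda>z. 1 / f z) r)
       + (reduced_counting (\<lambda>z. 1 / (P z - 1)) r + (\<Sum>j\<in>J. counting (b j) r))"
      by (intro add_mono mult_left_mono int_count_of_bool_pole_le fim fm r1 regi good_imp_regular good) auto
    finally have cnt: "real d * counting (\<lambda>z. 1 / f z) r - int_count (\<lambda>z. real_of_int (zorder ?W z)) r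
       \<le> (characteristic f r + (real \<nu> + 1) * (characteristic f r + K0))
       + (reduced_counting (\<lambda>z. 1 / (P z - 1)) r + (\<Sum>j\<in>J. counting (b j) r))"
      unfolding K0[OF good] .
    have "real d * (characteristic f r + K0) = real d * proximity (\<lambda>z. 1 / f z) r + real d * counting (\<lambda>z. 1 / f z) r"
      unfolding K0[OF good, symmetric] characteristic_def[of "\<lambda>z. 1 / f z"] by (rule distrib_left)
    thus ?case using proximity_one_over_power[OF elim(1,2,3), of d] cnt unfolding W
      by (simp add: algebra_simps)
  qed
  thus ?thesis by blast
qed

section \<open>From domination to an error term with one exceptional set\<close>

lemma characteristic_filterlim:
  assumes f: "transcendental_meromorphic f" and F: "F \<le> at_top" "eventually (good_circle f) F"
  shows "ln \<in> o[F](characteristic f)" "filterlim (characteristic f) at_top F"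
proof -
  have nf: "nonzero_mero f" by (rule transcendental_imp_nonzero_mero[OF f])
  have ev: "\<forall>\<^sub>F r in F. K * ln r \<le> characteristic f r" for K
  proof -
    obtain R where R: "\<And>r. r \<ge> R \<Longrightarrow> good_circle f r \<Longrightarrow> K * ln r \<le> characteristic f r"
      using transcendental_growth[OF f] by blast
    have "\<forall>\<^sub>F r in F. r \<ge> R" using filter_leD[OF F(1) eventually_ge_at_top] .
    with F(2) show ?thesis by eventually_elim (rule R)
  qed
  have large: "\<forall>\<^sub>F r in F. r \<ge> c" for c using filter_leD[OF F(1) eventually_ge_at_top] .
  show "ln \<in> o[F](characteristic f)"
  proof (rule landau_o.smallI)
    fix c :: real assume c: "c > 0"
    show "\<forall>\<^sub>F r in F. norm (ln r) \<le> c * norm (characteristic f r)"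
      using ev[of "1 / c"] large[of 1]
    proof eventually_elim
      case (elim r)
      have "0 \<le> 1 / c * ln r" using c elim(2) by simp
      hence "characteristic f r \<ge> 0" using elim(1) by linarith
      thus ?case using elim c by (simp add: field_simps)
    qed
  qed
  show "filterlim (characteristic f) at_top F"
    unfolding filterlim_at_top
  proof
    fix Z :: real
    show "\<forall>\<^sub>F r in F. Z \<le> characteristic f r"
      using ev[of "\<bar>Z\<bar>"] large[of 3]
    proof eventually_elim
      case (elim r)
      have "exp 1 \<le> r" using elim(2) exp_le by linarith
      hence "1 \<le> ln r" using elim(2) by (subst ln_ge_iff) auto
      from mult_left_mono[OF this, of "\<bar>Z\<bar>"] elim(1) show ?case by simp
    qed
  qed
qed

text \<open>Only finitely many estimates remain at this point: the domination, the good circles, and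
  the smallness of each coefficient. Their exceptional sets are extracted and united, and all limits
  are then taken along the single resulting filter.\<close>

lemma is_S_from_dominated:
  assumes f: "transcendental_meromorphic f" and b: "small_coefficients f t b" and c: "c > 0"
    and dom: "dominated (\<lambda>r. c * characteristic f r - N r) (\<lambda>r. log_scale f r + (\<Sum>j=1..t. characteristic (b j) r))"
  shows "\<exists>S. is_S f S \<and> (\<forall>r>0. characteristic f r \<le> 1 / c * N r + S r)"
proof -
  let ?T = "characteristic f"
  let ?L = "\<lambda>r. log_scale f r + (\<Sum>j=1..t. characteristic (b j) r)"
  have nf: "nonzero_mero f" by (rule transcendental_imp_nonzero_mero[OF f])
  obtain B E0 where B: "B \<ge> 0" "E0 \<in> lmeasurable"
      "\<forall>\<^sub>F r in at_top. r \<notin> E0 \<longrightarrow> c * ?T r - N r \<le> B * ?L r"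
    using dom by (auto simp: dominated_def eventually_almost_top)
  obtain E1 where E1: "E1 \<in> lmeasurable" "\<forall>\<^sub>F r in at_top. r \<notin> E1 \<longrightarrow> good_circle f r"
    using eventually_good_circle[OF nf] by (auto simp: eventually_almost_top)
  have "\<forall>j\<in>{1..t}. \<exists>E\<in>lmeasurable. characteristic (b j) \<in> o[inf at_top (principal (- E))](?T)"
    using b by (auto simp: small_coefficients_def is_S_def)
  then obtain E2 where E2: "\<And>j. j \<in> {1..t} \<Longrightarrow> E2 j \<in> lmeasurable"
     "\<And>j. j \<in> {1..t} \<Longrightarrow> characteristic (b j) \<in> o[inf at_top (principal (- E2 j))](?T)"
    by (metis (no_types, lifting))
  define E3 where "E3 = E0 \<union> E1 \<union> (\<Union>j\<in>{1..t}. E2 j)"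
  \<comment> \<open>The exceptional set in \<open>is_S\<close> must consist of positive numbers;
    discarding the rest does not matter at infinity.\<close>
  define E where "E = E3 \<inter> {0<..}"
  define F where "F = inf at_top (principal (- E))"
  have E3: "E3 \<in> lmeasurable" unfolding E3_def using B(2) E1(1) E2(1) by (intro fmeasurable.Un fmeasurable.finite_UN) auto
  hence E: "E \<in> lmeasurable" unfolding E_def by (intro fmeasurable_Int_fmeasurable) auto
  have Ftop: "F \<le> at_top" by (simp add: F_def)
  have evF: "eventually Q F" if "X \<subseteq> E3" "\<forall>\<^sub>F r in at_top. r \<notin> X \<longrightarrow> Q r" for Q X
    unfolding F_def eventually_inf_principal using that(2) eventually_gt_at_top[of 0]
    by eventually_elim (use that(1) in \<open>auto simp: E_def\<close>)
  have FE: "F \<le> inf at_top (principal (- X))" if "X \<subseteq> E3" for X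
  proof -
    have "eventually (\<lambda>r. r \<in> - X) F" by (rule evF[OF that]) auto
    thus ?thesis using Ftop by (simp add: le_principal)
  qed
  have good: "eventually (good_circle f) F" by (rule evF[OF _ E1(2)]) (auto simp: E3_def)
  note gr = characteristic_filterlim[OF f Ftop good]
  \<comment> \<open>Composition of \<open>ln (x + 2) = o(x)\<close> with the characteristic, which
    tends to infinity along \<open>F\<close>.\<close>
  have lnT: "(\<lambda>r. ln (?T r + 2)) \<in> o[F](?T)"
  proof -
    have "(\<lambda>x::real. ln (x + 2)) \<in> o(\<lambda>x. x)" by real_asymp
    from landau_o.small.compose[OF this gr(2)] show ?thesis by simp
  qed
  have one: "(\<lambda>_. 1) \<in> o[F](?T)"
  proof -
    have "(\<lambda>x::real. 1::real) \<in> o(\<lambda>x. x)" by real_asymp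
    from landau_o.small.compose[OF this gr(2)] show ?thesis by simp
  qed
  have L: "?L \<in> o[F](?T)" unfolding log_scale_def
  proof (intro sum_in_smallo one gr(1) lnT big_sum_in_smallo)
    fix j assume j: "j \<in> {1..t}"
    have "E2 j \<subseteq> E3" using j by (auto simp: E3_def)
    thus "characteristic (b j) \<in> o[F](?T)" using landau_o.small.filter_mono[OF FE E2(2)[OF j]] by blast
  qed
  \<comment> \<open>Taking the positive part of the exact defect makes the inequality true for every
    radius; only the smallness of \<open>S\<close> involves the exceptional set.\<close>
  define S where "S = (\<lambda>r. max 0 (?T r - 1 / c * N r))"
  have "S \<in> O[F](?L)"
  proof (rule bigoI)
    have "\<forall>\<^sub>F r in F. c * ?T r - N r \<le> B * ?L r" by (rule evF[OF _ B(3)]) (auto simp: E3_def)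
    thus "\<forall>\<^sub>F r in F. norm (S r) \<le> (B / c) * norm (?L r)"
    proof eventually_elim
      case (elim r)
      have "?T r - 1 / c * N r = (c * ?T r - N r) / c" using c by (simp add: field_simps)
      also have "\<dots> \<le> (B * ?L r) / c" using elim c by (intro divide_right_mono) auto
      also have "\<dots> = (B / c) * ?L r" by simp
      also have "\<dots> \<le> (B / c) * norm (?L r)" using B(1) c by (intro mult_left_mono) auto
      finally show ?case using B(1) c by (simp add: S_def)
    qed
  qed
  hence "S \<in> o[F](?T)" using L by (rule landau_o.big_small_trans)
  hence "is_S f S" unfolding is_S_def F_def using E by (intro bexI[of _ E]) (auto simp: E_def)
  moreover have "?T r \<le> 1 / c * N r + S r" for r unfolding S_def by linarith
  ultimately show ?thesis by blast
qed

theorem theorem2p2: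
  fixes f :: "complex \<Rightarrow> complex"
    and b :: "nat \<Rightarrow> complex \<Rightarrow> complex"
    and q :: "nat \<Rightarrow> nat \<Rightarrow> nat"
    and k t d \<nu> :: nat
  assumes "transcendental_meromorphic f"
    and "k \<ge> 1" and "t \<ge> 1"
    and "small_coefficients f t b"
    and "homogeneous_of_degree k t q d"
    and "\<forall>j\<in>{1..t}. q 0 j \<ge> 1 \<and> q k j \<ge> 1"
    and "\<nu> = Max ((\<lambda>j. \<Sum>i=1..k. i * q i j) ` {1..t})"
    and "real d - real \<nu> > 2"
  shows "(\<forall>\<^sub>\<approx>z. diff_poly k t b q f z = 0) \<or>
    (\<exists>S. is_S f S \<and> (\<forall>r>0. characteristic f r \<le>
       1 / (real d - real \<nu> - 2) *
         reduced_counting (\<lambda>z. 1 / (diff_poly k t b q f z - 1)) r + S r))"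
proof (cases "\<forall>\<^sub>\<approx>z. diff_poly k t b q f z = 0")
  case False
  define P where "P = diff_poly k t b q f"
  let ?T = "characteristic f"
  let ?N = "\<lambda>r. reduced_counting (\<lambda>z. 1 / (P z - 1)) r"
  let ?B = "\<lambda>r. \<Sum>j=1..t. characteristic (b j) r"
  \<comment> \<open>\<open>?L\<close> is the scale of the final error and is small against
    \<open>?T\<close>. The coarser \<open>?LT\<close> bounds the characteristics of auxiliary
    functions, which enter the error only through their logarithms.\<close>
  let ?L = "\<lambda>r. log_scale f r + ?B r"
  let ?LT = "\<lambda>r. log_scale f r + ?T r"
  have f: "nonzero_mero f" by (rule transcendental_imp_nonzero_mero[OF assms(1)])
  note fm = nonzero_mero_imp_mero[OF f]
  have bm: "b j meromorphic_on UNIV" if "j \<in> {1..t}" for j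
    using assms(4) that by (simp add: small_coefficients_def)
  have deg: "monomial_degree k q j = d" if "j \<in> {1..t}" for j
    using assms(5) that by (simp add: homogeneous_of_degree_def)
  have wt: "monomial_weight k q j \<le> \<nu>" if "j \<in> {1..t}" for j
    unfolding assms(7) monomial_weight_def using that by (intro Max_ge) auto
  have Pm: "P meromorphic_on UNIV" unfolding P_def by (intro diff_poly_meromorphic fm bm)
  have P: "nonzero_mero P" using False by (intro nonzero_mero_if_frequently Pm) (simp add: P_def)
  have low: "ord_ge P z (int d * zorder f z - int \<nu> - int (\<Sum>j=1..t. pole_order (b j) z))" for z
    unfolding P_def using assms(3) by (intro ord_ge_diff_poly bm deg wt) (auto simp: ord_ge_iff_zorder[OF f])
  have hi: "ord_ge P z (- int ((d + \<nu>) * pole_order f z + (\<Sum>j=1..t. pole_order (b j) z)))" for z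
    unfolding P_def by (intro ord_ge_diff_poly_pole bm deg wt fm)
  have pole: "ord_ge P z (- int (\<Sum>j=1..t. pole_order (b j) z))" if "\<not> is_pole f z" for z
    using hi[of z] that is_pole_iff_pole_order[OF fm, of z] by simp

  note ls1 = eventually_log_scale_ge_1[OF fm] and T0 = eventually_characteristic_nonneg[OF fm]
  have bT0: "\<forall>\<^sub>F r in almost_top. \<forall>j\<in>{1..t}. characteristic (b j) r \<ge> 0"
    by (intro eventually_ball_finite ballI eventually_characteristic_nonneg bm) auto
  have breg: "\<forall>\<^sub>F r in almost_top. \<forall>j\<in>{1..t}. regular_circle (b j) r"
    by (intro eventually_ball_finite ballI eventually_regular_circle bm) auto
  have B0: "\<forall>\<^sub>F r in almost_top. ?B r \<ge> 0" using bT0 by eventually_elim (auto intro: sum_nonneg)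
  have L1: "\<forall>\<^sub>F r in almost_top. 1 \<le> ?L r" using ls1 B0 by eventually_elim linarith
  have LT1: "\<forall>\<^sub>F r in almost_top. 1 \<le> ?LT r" using ls1 T0 by eventually_elim linarith
  have ls_L: "dominated (log_scale f) ?L"
    using B0 by (intro dominated_le) (auto elim: eventually_mono)
  have B_L: "dominated ?B ?L" using ls1 by (intro dominated_le) (auto elim: eventually_mono)
  have ls_LT: "dominated (log_scale f) ?LT"
    using T0 by (intro dominated_le) (auto elim: eventually_mono)
  have T_LT: "dominated ?T ?LT" using ls1 by (intro dominated_le) (auto elim: eventually_mono)
  \<comment> \<open>Smallness is used here with the constant 1 only, which turns it into
    domination.\<close>
  have b_T: "dominated (characteristic (b j)) ?T" if "j \<in> {1..t}" for j
  proof -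
    have "characteristic (b j) \<in> o[almost_top](?T)"
      using assms(4) that by (intro is_S_imp_almost_top) (simp add: small_coefficients_def)
    from landau_o.smallD[OF this zero_less_one] T0
    have "\<forall>\<^sub>F r in almost_top. characteristic (b j) r \<le> ?T r" by eventually_elim simp
    thus ?thesis by (rule dominated_le)
  qed
  have B_LT: "dominated ?B ?LT"
    by (intro dominated_sum dominated_trans[OF b_T T_LT] LT1)
  have L_LT: "dominated ?L ?LT" by (intro dominated_add ls_LT B_LT)

  let ?u = "\<lambda>z. P z / f z ^ d"
  have fi_reg: "\<forall>\<^sub>F r in almost_top. \<forall>i\<in>{..k}. regular_circle ((deriv ^^ i) f) r"
    by (intro eventually_ball_finite ballI eventually_regular_circle meromorphic_on_higher_deriv fm) auto
  have prox_u: "dominated (proximity ?u) ?L"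
  proof (rule dominated_mono)
    show "dominated (\<lambda>r. (?B r + (\<Sum>j=1..t. \<Sum>i\<le>k. real (q i j) * proximity (\<lambda>z. (deriv ^^ i) f z / f z) r)) + ln (real t)) ?L"
      by (intro dominated_add B_L dominated_sum dominated_cmult L1 dominated_const
          dominated_trans[OF higher_deriv_dominated[OF f] ls_L]) auto
    show "\<forall>\<^sub>F r in almost_top. proximity ?u r
       \<le> (?B r + (\<Sum>j=1..t. \<Sum>i\<le>k. real (q i j) * proximity (\<lambda>z. (deriv ^^ i) f z / f z) r)) + ln (real t)"
      using breg fi_reg eventually_good_circle[OF f] eventually_almost_top_ge[of 1]
    proof eventually_elim
      case (elim r)
      have "proximity ?u r \<le> (\<Sum>j=1..t. proximity (b j) r
          + (\<Sum>i\<le>k. real (q i j) * proximity (\<lambda>z. (deriv ^^ i) f z / f z) r)) + ln (real t)"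
        unfolding P_def using elim assms(3)
        by (intro proximity_diff_poly_over_power deg regular_circle_divide) auto
      also have "\<dots> \<le> (\<Sum>j=1..t. characteristic (b j) r
          + (\<Sum>i\<le>k. real (q i j) * proximity (\<lambda>z. (deriv ^^ i) f z / f z) r)) + ln (real t)"
        using elim by (intro add_right_mono sum_mono proximity_le_characteristic bm)
      finally show ?case by (simp add: sum.distrib)
    qed
  qed
  \<comment> \<open>The a priori bound for \<open>P\<close>, obtained from
    \<open>P = (P / f^d) f^d\<close> for the proximity and from the linear bound on pole orders for
    the counting function.\<close>
  have TP: "dominated (characteristic P) ?LT"
  proof (rule dominated_mono)
    show "dominated (\<lambda>r. (proximity ?u r + real d * ?T r) + (real (d + \<nu>) * ?T r + ?B r)) ?LT"
      by (intro dominated_add dominated_cmult T_LT B_LT dominated_trans[OF prox_u L_LT]) auto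
    show "\<forall>\<^sub>F r in almost_top. characteristic P r \<le> (proximity ?u r + real d * ?T r) + (real (d + \<nu>) * ?T r + ?B r)"
      using breg eventually_good_circle[OF f] eventually_good_circle[OF P] eventually_almost_top_ge[of 1]
    proof eventually_elim
      case (elim r)
      have r0: "r > 0" using elim by simp
      have fd: "good_circle (\<lambda>z. f z ^ d) r" using elim(2) by (auto simp: good_circle_def intro!: analytic_intros)
      have regu: "regular_circle ?u r" by (intro regular_circle_divide fd good_imp_regular elim)
      have "proximity P r = proximity (\<lambda>z. ?u z * f z ^ d) r"
        using elim by (intro proximity_cong good_imp_regular) (auto simp: good_circle_def)
      also have "\<dots> \<le> proximity ?u r + proximity (\<lambda>z. f z ^ d) r"
        by (intro proximity_mult regu good_imp_regular fd)
      also have "proximity (\<lambda>z. f z ^ d) r = real d * proximity f r"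
        by (simp add: proximity_eq_circle_mean good_imp_regular fd elim(2) norm_power log_plus_power)
      also have "real d * proximity f r \<le> real d * ?T r"
        by (intro mult_left_mono proximity_le_characteristic fm elim) auto
      finally have m: "proximity P r \<le> proximity ?u r + real d * ?T r" by simp
      have "pole_order P z \<le> (d + \<nu>) * pole_order f z + (\<Sum>j=1..t. pole_order (b j) z)" for z
        by (rule pole_order_le[OF hi])
      hence po: "real (pole_order P z) \<le> real (d + \<nu>) * real (pole_order f z) + (\<Sum>j=1..t. real (pole_order (b j) z))" for z
        using of_nat_le_iff[where ?'a = real] by (simp only: of_nat_mult[symmetric] of_nat_sum[symmetric] of_nat_add[symmetric])
      have "counting P r \<le> int_count (\<lambda>z. real (d + \<nu>) * real (pole_order f z) + (\<Sum>j=1..t. real (pole_order (b j) z))) r"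
        unfolding counting_eq[OF Pm r0] using po elim
        by (intro int_count_mono loc_finite_add loc_finite_cmult loc_finite_sum loc_finite_pole_order Pm fm bm) auto
      also have "\<dots> = real (d + \<nu>) * counting f r + (\<Sum>j=1..t. counting (b j) r)"
        by (simp only: int_count_cmult counting_eq[OF fm r0] counting_eq_int_count_sum[OF bm r0]
            int_count_add[OF loc_finite_cmult[OF loc_finite_pole_order[OF fm]] loc_finite_sum[OF loc_finite_pole_order[OF bm]]])
      also have "\<dots> \<le> real (d + \<nu>) * ?T r + ?B r"
        using elim good_imp_regular[OF elim(2)] by (intro add_mono mult_left_mono sum_mono counting_le_characteristic) auto
      finally show ?case using m unfolding characteristic_def[of P] by linarith
    qed
  qed
  have dP: "dominated (proximity (\<lambda>z. deriv P z / P z)) ?L"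
    by (rule dominated_trans[OF logarithmic_derivative_dominated[OF fm P TP] ls_L])
  have bcount: "\<forall>\<^sub>F r in almost_top. (\<Sum>j=1..t. counting (b j) r) \<le> ?B r"
    using breg by eventually_elim (intro sum_mono counting_le_characteristic, auto)

  have "dominated (\<lambda>r. (real d - real \<nu> - 2) * ?T r - ?N r) ?L"
  proof (cases "nonzero_mero (deriv P)")
    case True
    obtain K where K: "\<forall>\<^sub>F r in almost_top. (real d - real \<nu> - 2) * ?T r
       \<le> ?N r + 2 * proximity ?u r + proximity (\<lambda>z. deriv P z / P z) r
         + proximity (\<lambda>z. deriv P z / (P z - 1)) r + (\<Sum>j=1..t. counting (b j) r) + K"
      using characteristic_bound[OF f bm P True low pole] by blast
    have Q: "nonzero_mero (\<lambda>z. P z - 1)" by (rule nonzero_mero_diff_const[OF Pm True])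
    have TQ: "dominated (characteristic (\<lambda>z. P z - 1)) ?LT"
    proof (rule dominated_mono)
      show "dominated (\<lambda>r. characteristic P r + ln 2) ?LT"
        by (intro dominated_add TP dominated_const LT1)
      show "\<forall>\<^sub>F r in almost_top. characteristic (\<lambda>z. P z - 1) r \<le> characteristic P r + ln 2"
        using eventually_good_circle[OF P] eventually_almost_top_ge[of 1]
        by eventually_elim (intro characteristic_diff_one Pm good_imp_regular)
    qed
    have dQ: "dominated (proximity (\<lambda>z. deriv P z / (P z - 1))) ?L"
      using dominated_trans[OF logarithmic_derivative_dominated[OF fm Q TQ] ls_L]
      by (simp add: deriv_diff_const)
    show ?thesis
    proof (rule dominated_mono)
      show "dominated (\<lambda>r. 2 * proximity ?u r + proximity (\<lambda>z. deriv P z / P z) r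
         + proximity (\<lambda>z. deriv P z / (P z - 1)) r + ?B r + K) ?L"
        by (intro dominated_add dominated_cmult prox_u dP dQ B_L dominated_const L1) auto
      show "\<forall>\<^sub>F r in almost_top. (real d - real \<nu> - 2) * ?T r - ?N r
         \<le> 2 * proximity ?u r + proximity (\<lambda>z. deriv P z / P z) r
         + proximity (\<lambda>z. deriv P z / (P z - 1)) r + ?B r + K"
        using K bcount by eventually_elim linarith
    qed
  next
    case False
    obtain c where c: "\<forall>\<^sub>\<approx>z. P z = c" using constant_if_deriv_zero[OF Pm False] by blast
    have c0: "c \<noteq> 0" using c \<open>\<not> (\<forall>\<^sub>\<approx>z. diff_poly k t b q f z = 0)\<close> by (auto simp: P_def)
    obtain K where K: "\<forall>\<^sub>F r in almost_top. (real d - real \<nu> - 2) * ?T r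
       \<le> proximity ?u r + (\<Sum>j=1..t. counting (b j) r) + K"
      using characteristic_bound_const[OF f bm low c c0] by blast
    \<comment> \<open>Only nonnegativity of the reduced count enters. This covers
      \<open>c = 1\<close> as well, where \<open>1 / (P - 1)\<close> is 0 off a sparse set by the
      convention for division.\<close>
    have Qi: "(\<lambda>z. 1 / (P z - 1)) meromorphic_on UNIV" by (intro meromorphic_intros Pm)
    show ?thesis
    proof (rule dominated_mono)
      show "dominated (\<lambda>r. proximity ?u r + ?B r + K) ?L"
        by (intro dominated_add prox_u B_L dominated_const L1)
      show "\<forall>\<^sub>F r in almost_top. (real d - real \<nu> - 2) * ?T r - ?N r \<le> proximity ?u r + ?B r + K"
        using K bcount eventually_almost_top_ge[of 1]
      proof eventually_elim
        case (elim r)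
        thus ?case using reduced_counting_nonneg[OF Qi elim(3)] by linarith
      qed
    qed
  qed
  hence "\<exists>S. is_S f S \<and> (\<forall>r>0. ?T r \<le> 1 / (real d - real \<nu> - 2) * ?N r + S r)"
    using assms(8) by (intro is_S_from_dominated[OF assms(1,4)]) auto
  thus ?thesis unfolding P_def by blast
qed blast

end
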